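(* Let $n\ge3$, $l\ge1$ an integer, and $f=f_{[n]}$. Then $f^lD$ and $D'$ are locally nilpotent, and the automorphism $\phi:=\exp(f^lD)\circ\exp(D')\circ\exp(-f^lD)$ of $k[\mathbf{x}]$ is co-tame, i.e. the subgroup $\langle \phi,\mathrm{Aff}_n(k)\rangle$ of $\mathrm{Aut}_k k[\mathbf{x}]$ contains $\mathrm{TA}_n(k)$.
   Context: Let $k$ be a field of characteristic zero and $k[\mathbf{x}]=k[x_1,\ldots,x_n]$, $n\ge3$. An automorphism $\phi$ of the $k$-algebra $k[\mathbf{x}]$ is written $\phi=(\phi(x_1),\ldots,\phi(x_n))$ and $\circ$ denotes composition of $k$-algebra maps. $\mathrm{Aff}_n(k)$ is the group of affine automorphisms $(x_1,\ldots,x_n)A+\mathbf{b}$ with $A\in GL_n(k)$, $\mathbf{b}\in k^n$; $\mathrm{BA}_n(k)$ is the group of triangular automorphisms $(a_1x_1+f_1,\ldots,a_nx_n+f_n)$ with $a_i\in k^*$, $f_i\in k[x_1,\ldots,x_{i-1}]$; $\mathrm{TA}_n(k)=\langle\mathrm{Aff}_n(k),\mathrm{BA}_n(k)\rangle$. For a locally nilpotent derivation $E$, $\exp E(g)=\sum_{i\ge0}E^i(g)/i!$. Define $D=\sum_{j=1}^{n-1}(n-j)\,x_{j+1}\,\partial/\partial x_j$ and $D'=\sum_{j=2}^{n}(j-1)\,x_{j-1}\,\partial/\partial x_j$. Define $f_{[n]}$: if $n=2m-1$ ($m\ge2$), $f_{[2m-1]}=\frac12\sum_{i=1}^{2m-1}(-1)^{i-1}\binom{2m-2}{i-1}x_ix_{2m-i}$;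 if $n=2m$ ($m\ge2$), $f_{[2m]}=D(f_{[2m-1]})^2-2D^2(f_{[2m-1]})f_{[2m-1]}$ (with $f_{[2m-1]}$ viewed in $k[x_1,\ldots,x_{2m}]$ and $D$ the derivation for $n=2m$). It is known that $f_{[n]}\in\ker D\cap\ker D'$. *)

theory Defs
  imports "HOL-Library.Poly_Mapping" "HOL-Algebra.Generated_Groups"
begin

text \<open>A polynomial is a finitely supported map from monomials (exponent vectors
  nat =>0 nat, variable indices starting at 1) to coefficients.\<close>

type_synonym 'k mpoly = "(nat \<Rightarrow>\<^sub>0 nat) \<Rightarrow>\<^sub>0 'k"

definition Const :: "'k::comm_ring_1 \<Rightarrow> 'k mpoly" where
  "Const c = Poly_Mapping.single 0 c"

definition Var :: "nat \<Rightarrow> 'k::comm_ring_1 mpoly" where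
  "Var i = Poly_Mapping.single (Poly_Mapping.single i 1) 1"

definition polys :: "nat \<Rightarrow> 'k::comm_ring_1 mpoly set" where
  "polys n = {p. \<forall>m \<in> Poly_Mapping.keys p. Poly_Mapping.keys m \<subseteq> {1..n}}"

definition subst :: "(nat \<Rightarrow> 'k::comm_ring_1 mpoly) \<Rightarrow> 'k mpoly \<Rightarrow> 'k mpoly" where
  "subst F p = (\<Sum>m \<in> Poly_Mapping.keys p.
      Const (Poly_Mapping.lookup p m) * (\<Prod>i \<in> Poly_Mapping.keys m. F i ^ Poly_Mapping.lookup m i))"

definition pdiff :: "nat \<Rightarrow> 'k::comm_ring_1 mpoly \<Rightarrow> 'k mpoly" where
  "pdiff i p = (\<Sum>m \<in> Poly_Mapping.keys p.
      Poly_Mapping.single (Poly_Mapping.update i (Poly_Mapping.lookup m i - 1) m)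
        (of_nat (Poly_Mapping.lookup m i) * Poly_Mapping.lookup p m))"

text \<open>An endomorphism phi of k[x_1..x_n] is represented by the tuple
  (phi(x_1),...,phi(x_n)), extended by x_i for i outside 1..n.\<close>

definition endos :: "nat \<Rightarrow> (nat \<Rightarrow> 'k::comm_ring_1 mpoly) set" where
  "endos n = {F. (\<forall>i \<in> {1..n}. F i \<in> polys n) \<and> (\<forall>i. i \<notin> {1..n} \<longrightarrow> F i = Var i)}"

definition comp_map :: "(nat \<Rightarrow> 'k::comm_ring_1 mpoly) \<Rightarrow> (nat \<Rightarrow> 'k mpoly) \<Rightarrow> (nat \<Rightarrow> 'k mpoly)" where
  "comp_map F G = (\<lambda>i. subst F (G i))"

definition Aut :: "nat \<Rightarrow> (nat \<Rightarrow> 'k::comm_ring_1 mpoly) set" where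
  "Aut n = {F \<in> endos n. \<exists>G \<in> endos n. comp_map F G = Var \<and> comp_map G F = Var}"

definition AutGrp :: "nat \<Rightarrow> (nat \<Rightarrow> 'k::comm_ring_1 mpoly) monoid" where
  "AutGrp n = \<lparr>carrier = Aut n, mult = comp_map, one = Var\<rparr>"

definition Aff :: "nat \<Rightarrow> (nat \<Rightarrow> 'k::field mpoly) set" where
  "Aff n = {F. (\<forall>i. i \<notin> {1..n} \<longrightarrow> F i = Var i) \<and>
     (\<exists>(A :: nat \<Rightarrow> nat \<Rightarrow> 'k) (B :: nat \<Rightarrow> nat \<Rightarrow> 'k) (b :: nat \<Rightarrow> 'k).
        (\<forall>i \<in> {1..n}. \<forall>j \<in> {1..n}. (\<Sum>l \<in> {1..n}. A i l * B l j) = (if i = j then 1 else 0)) \<and>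
        (\<forall>i \<in> {1..n}. F i = (\<Sum>j \<in> {1..n}. Const (A j i) * Var j) + Const (b i)))}"

definition BA :: "nat \<Rightarrow> (nat \<Rightarrow> 'k::field mpoly) set" where
  "BA n = {F. (\<forall>i. i \<notin> {1..n} \<longrightarrow> F i = Var i) \<and>
     (\<forall>i \<in> {1..n}. \<exists>a f. a \<noteq> 0 \<and> f \<in> polys (i - 1) \<and> F i = Const a * Var i + f)}"

definition TA :: "nat \<Rightarrow> (nat \<Rightarrow> 'k::field mpoly) set" where
  "TA n = generate (AutGrp n) (Aff n \<union> BA n)"

definition locally_nilpotent :: "nat \<Rightarrow> ('k::comm_ring_1 mpoly \<Rightarrow> 'k mpoly) \<Rightarrow> bool" where
  "locally_nilpotent n E \<longleftrightarrow> (\<forall>g \<in> polys n. \<exists>m. (E ^^ m) g = 0)"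

text \<open>exp E (g) = sum_i E^i(g)/i!  (a finite sum when E is locally nilpotent).\<close>
definition exp_der :: "('k::field_char_0 mpoly \<Rightarrow> 'k mpoly) \<Rightarrow> 'k mpoly \<Rightarrow> 'k mpoly" where
  "exp_der E g = (\<Sum>i < (LEAST m. (E ^^ m) g = 0). Const (1 / fact i) * (E ^^ i) g)"

definition exp_map :: "nat \<Rightarrow> ('k::field_char_0 mpoly \<Rightarrow> 'k mpoly) \<Rightarrow> (nat \<Rightarrow> 'k mpoly)" where
  "exp_map n E = (\<lambda>i. if i \<in> {1..n} then exp_der E (Var i) else Var i)"

definition derD :: "nat \<Rightarrow> 'k::comm_ring_1 mpoly \<Rightarrow> 'k mpoly" where
  "derD n g = (\<Sum>j \<in> {1..n-1}. Const (of_nat (n - j)) * Var (j + 1) * pdiff j g)"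

definition derD' :: "nat \<Rightarrow> 'k::comm_ring_1 mpoly \<Rightarrow> 'k mpoly" where
  "derD' n g = (\<Sum>j \<in> {2..n}. Const (of_nat (j - 1)) * Var (j - 1) * pdiff j g)"

definition f_odd :: "nat \<Rightarrow> 'k::field_char_0 mpoly" where
  "f_odd m = Const (1/2) * (\<Sum>i \<in> {1..2*m-1}.
      Const ((-1) ^ (i - 1) * of_nat ((2*m-2) choose (i-1))) * Var i * Var (2*m - i))"

definition f_n :: "nat \<Rightarrow> 'k::field_char_0 mpoly" where
  "f_n n = (if odd n then f_odd ((n + 1) div 2)
            else (let g = f_odd (n div 2) in
                  (derD n g)^2 - Const 2 * derD n (derD n g) * g))"

end

theory Submission
  imports Defs "Jordan_Normal_Form.Determinant"
begin

text \<open>Write \<open>E(q) = exp(q D)\<close> for \<open>q \<in> ker D\<close> and \<open>t = f^l\<close>, so that \<open>\<phi> = E(t) exp(D') E(-t)\<close>. Since \<open>D, D'\<close>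
  span a copy of \<open>sl\<^sub>2\<close> acting linearly and \<open>f\<close> is an invariant, the affine maps \<open>exp(s D)\<close> commute with \<open>E(t)\<close>;
  hence a word \<open>h\<close> in the \<open>exp(s D)\<close> and \<open>exp(\<plusminus>D')\<close> that represents an upper triangular matrix
  with \<open>h D h\<^sup>-\<^sup>1 = 4 D\<close> gives \<open>E(t) h E(-t) h\<^sup>-\<^sup>1 = E(-3t)\<close> in the group generated by \<open>\<phi>\<close> and the affine maps.
  Translations in \<open>x\<^sub>1\<close> commute with \<open>D\<close>, so taking differences in \<open>x\<^sub>1\<close> turns \<open>t\<close> into a multiple of \<open>x\<^sub>n^N\<close> with
  \<open>N \<ge> 1\<close>, and the commutator of \<open>exp(x\<^sub>n^N D)\<close> with \<open>x\<^sub>2 \<mapsto> x\<^sub>2 + x\<^sub>n\<close> is a shear \<open>x\<^sub>1 \<mapsto> x\<^sub>1 + c x\<^sub>n^(N+1)\<close>.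
  Conjugating this nonlinear shear by affine maps and by the shears already obtained, and extracting
  coefficients of polynomial families, produces all shears, hence all triangular automorphisms.\<close>

section \<open>Polynomials\<close>

text \<open>Conjugating \<open>exp(r D')\<close> by \<open>E(t)\<close> gives a power of
  \<open>\<phi>\<close> when \<open>r\<close> is an integer, whereas \<open>exp(s D)\<close> is
  affine and commutes with \<open>E(t)\<close> for every scalar \<open>s\<close>. The word
  \<open>h\<close> should therefore have integer exponents on \<open>D'\<close>. It must also
  normalise the line spanned by \<open>D\<close>: otherwise
  \<open>E(t) h E(-t) h\<^sup>-\<^sup>1\<close> would mix exponentials of non-commuting derivations.
  Among the words \<open>exp(D') exp(s D) exp(r D')\<close> that are upper triangular in SL_2,
  \<open>r = -1\<close> gives the identity and \<open>r = 1\<close> gives minus the identity,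
  neither of which changes \<open>D\<close>. The choice \<open>r = -2\<close>,
  \<open>s = -1/2\<close> scales \<open>D\<close> by 4, which leaves \<open>t - 4 t = - 3 t\<close>.
  The \<open>q\<close> for which \<open>exp(q D)\<close> lies in the group are only known to form an
  additive group, so coefficients of a family are reached there up to nonzero integers. Shears
  behave better: dilations of \<open>x_j\<close> make their polynomials a vector space, and
  characteristic zero removes the integers. The invariance of \<open>f\<close> is proved as well:
  \<open>D'\<close> is computed on the quadratic form, and the statements about \<open>D\<close>
  then come from weights.\<close>

lemma Const_0 [simp]: "Const 0 = 0"
  by (simp add: Const_def)

lemma Const_1 [simp]: "Const 1 = 1"
  by (simp add: Const_def)

lemma Const_add: "Const (a + b) = Const a + Const b"
  by (simp add: Const_def single_add)

lemma Const_uminus: "Const (- a) = - Const a"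
  by (simp add: Const_def single_uminus)

lemma Const_diff: "Const (a - b) = Const a - Const b"
  by (simp add: Const_def single_diff)

lemma Const_mult: "Const (a * b) = Const a * Const b"
  by (simp add: Const_def mult_single)

lemma Const_of_nat [simp]: "Const (of_nat k) = of_nat k"
  by (induction k) (simp_all add: Const_add)

lemma Const_of_int [simp]: "Const (of_int k) = of_int k"
  by (cases k) (simp_all add: Const_uminus Const_diff del: of_nat_Suc)

lemma Const_numeral [simp]: "Const (numeral k) = numeral k"
  using Const_of_nat[of "numeral k"] by simp

lemma Var_power: "Var i ^ k = Poly_Mapping.single (Poly_Mapping.single i k) 1"
  by (induction k) (simp_all add: Var_def mult_single single_add[symmetric])

definition monom_val :: "(nat \<Rightarrow> 'k::comm_ring_1 mpoly) \<Rightarrow> (nat \<Rightarrow>\<^sub>0 nat) \<Rightarrow> 'k mpoly" where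
  "monom_val F m = (\<Prod>i \<in> Poly_Mapping.keys m. F i ^ Poly_Mapping.lookup m i)"

lemma monom_val_superset:
  assumes "finite I" "Poly_Mapping.keys m \<subseteq> I"
  shows "monom_val F m = (\<Prod>i \<in> I. F i ^ Poly_Mapping.lookup m i)"
  unfolding monom_val_def
  by (rule prod.mono_neutral_left) (use assms in \<open>auto simp: in_keys_iff\<close>)

lemma monom_val_0 [simp]: "monom_val F 0 = 1"
  by (simp add: monom_val_def)

lemma monom_val_add: "monom_val F (m + m') = monom_val F m * monom_val F m'"
proof -
  let ?I = "Poly_Mapping.keys m \<union> Poly_Mapping.keys m'"
  have "Poly_Mapping.keys (m + m') \<subseteq> ?I"
    by (rule Poly_Mapping.keys_add)
  then show ?thesis
    by (simp add: monom_val_superset[of ?I] lookup_add power_add prod.distrib)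
qed

lemma prod_single:
  "(\<Prod>i\<in>A. Poly_Mapping.single (g i) 1) = Poly_Mapping.single (\<Sum>i\<in>A. g i) 1"
  by (induction A rule: infinite_finite_induct) (simp_all add: mult_single)

lemma poly_mapping_sum_single:
  "p = (\<Sum>m \<in> Poly_Mapping.keys p. Poly_Mapping.single m (Poly_Mapping.lookup p m))"
proof (rule poly_mapping_eqI)
  fix k
  have "Poly_Mapping.lookup (\<Sum>m \<in> Poly_Mapping.keys p. Poly_Mapping.single m (Poly_Mapping.lookup p m)) k
      = (\<Sum>m \<in> Poly_Mapping.keys p. if k = m then Poly_Mapping.lookup p m else 0)"
    unfolding lookup_sum by (rule sum.cong) (auto simp: lookup_single when_def)
  also have "\<dots> = Poly_Mapping.lookup p k"
    by (auto simp: in_keys_iff)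
  finally show "Poly_Mapping.lookup p k = Poly_Mapping.lookup
      (\<Sum>m \<in> Poly_Mapping.keys p. Poly_Mapping.single m (Poly_Mapping.lookup p m)) k" ..
qed

lemma monom_val_Var: "monom_val Var m = Poly_Mapping.single m 1"
  using poly_mapping_sum_single[of m] by (simp add: monom_val_def Var_power prod_single)

lemma mpoly_expansion:
  "p = (\<Sum>m \<in> Poly_Mapping.keys p. Const (Poly_Mapping.lookup p m) * monom_val Var m)"
  using poly_mapping_sum_single[of p] by (simp add: monom_val_Var Const_def mult_single)

text \<open>Arbitrary sets of variables are needed because a shear of \<open>x_j\<close> adds a
  polynomial in the variables other than \<open>x_j\<close>; \<open>polys n\<close> only covers
  initial segments.\<close>

definition polys_in :: "nat set \<Rightarrow> 'k::comm_ring_1 mpoly set" where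
  "polys_in I = {p. \<forall>m \<in> Poly_Mapping.keys p. Poly_Mapping.keys m \<subseteq> I}"

lemma polys_eq_polys_in: "polys n = polys_in {1..n}"
  by (simp add: polys_def polys_in_def)

lemma polys_in_mono: "I \<subseteq> J \<Longrightarrow> p \<in> polys_in I \<Longrightarrow> p \<in> polys_in J"
  by (auto simp: polys_in_def)

lemma polys_in_UNIV [simp]: "p \<in> polys_in UNIV"
  by (simp add: polys_in_def)

lemma polys_in_0 [simp]: "0 \<in> polys_in I"
  by (simp add: polys_in_def)

lemma polys_in_Const [simp]: "Const c \<in> polys_in I"
  by (simp add: polys_in_def Const_def)

lemma polys_in_of_nat [simp]: "of_nat k \<in> polys_in I"
  using polys_in_Const[of "of_nat k"] by simp

lemma polys_in_numeral [simp]: "numeral k \<in> polys_in I"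
  using polys_in_Const[of "numeral k"] by simp

lemma polys_in_1 [simp]: "1 \<in> polys_in I"
  using polys_in_Const[of 1] by simp

lemma polys_in_Var [simp]: "i \<in> I \<Longrightarrow> Var i \<in> polys_in I"
  by (auto simp: polys_in_def Var_def)

lemma polys_in_add: "p \<in> polys_in I \<Longrightarrow> q \<in> polys_in I \<Longrightarrow> p + q \<in> polys_in I"
  using Poly_Mapping.keys_add[of p q] by (auto simp: polys_in_def)

lemma polys_in_mult: 
  assumes "p \<in> polys_in I" "q \<in> polys_in I" shows "p * q \<in> polys_in I"
  unfolding polys_in_def
proof safe
  fix m i assume m: "m \<in> Poly_Mapping.keys (p * q)" and i: "i \<in> Poly_Mapping.keys m"
  from m keys_mult[of p q] obtain a b where "m = a + b" "a \<in> Poly_Mapping.keys p" "b \<in> Poly_Mapping.keys q"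
    by auto
  with i assms Poly_Mapping.keys_add[of a b] show "i \<in> I"
    by (fastforce simp: polys_in_def)
qed

lemma polys_in_uminus: "p \<in> polys_in I \<Longrightarrow> - p \<in> polys_in I"
  by (simp add: polys_in_def in_keys_iff)

lemma polys_in_diff: "p \<in> polys_in I \<Longrightarrow> q \<in> polys_in I \<Longrightarrow> p - q \<in> polys_in I"
  using polys_in_add[of p I "- q"] polys_in_uminus[of q I] by simp

lemma polys_in_sum: "(\<And>i. i \<in> A \<Longrightarrow> g i \<in> polys_in I) \<Longrightarrow> (\<Sum>i\<in>A. g i) \<in> polys_in I"
  by (induction A rule: infinite_finite_induct) (auto intro: polys_in_add)

lemma polys_in_power: "p \<in> polys_in I \<Longrightarrow> p ^ k \<in> polys_in I"
  by (induction k) (auto intro: polys_in_mult)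

lemma polys_in_prod: "(\<And>i. i \<in> A \<Longrightarrow> g i \<in> polys_in I) \<Longrightarrow> (\<Prod>i\<in>A. g i) \<in> polys_in I"
  by (induction A rule: infinite_finite_induct) (auto intro: polys_in_mult)

text \<open>Constants and variables generate the polynomials in the variables of \<open>I\<close> as
  a ring. Identities between homomorphisms or derivations can thereby be checked on generators,
  without touching monomials.\<close>

lemma mpoly_induct [consumes 1, case_names Const Var add mult]:
  assumes p: "p \<in> polys_in I"
    and C: "\<And>c. P (Const c)" and V: "\<And>i. i \<in> I \<Longrightarrow> P (Var i)"
    and A: "\<And>p q. P p \<Longrightarrow> P q \<Longrightarrow> P (p + q)" and M: "\<And>p q. P p \<Longrightarrow> P q \<Longrightarrow> P (p * q)"
  shows "P p"
proof -
  have sum: "P (\<Sum>i\<in>B. g i)" if "\<And>i. i \<in> B \<Longrightarrow> P (g i)" for B :: "(nat \<Rightarrow>\<^sub>0 nat) set" and g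
    using that by (induction B rule: infinite_finite_induct) (use C[of 0] A in auto)
  have prod: "P (\<Prod>i\<in>B. g i)" if "\<And>i. i \<in> B \<Longrightarrow> P (g i)" for B :: "nat set" and g
    using that by (induction B rule: infinite_finite_induct) (use C[of 1] M in auto)
  have pow: "P (x ^ k)" if "P x" for x k
    using that by (induction k) (use C[of 1] M in auto)
  have "P (\<Sum>m \<in> Poly_Mapping.keys p. Const (Poly_Mapping.lookup p m) * monom_val Var m)"
    unfolding monom_val_def using p
    by (intro sum prod pow M C V) (auto simp: polys_in_def)
  then show ?thesis
    using mpoly_expansion[of p] by simp
qed

lemma lookup_Const_0 [simp]: "Poly_Mapping.lookup (Const c) 0 = c"
  by (simp add: Const_def)

lemma Const_eq_iff [simp]: "Const a = Const b \<longleftrightarrow> a = b"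
  by (metis lookup_Const_0)

lemma lookup_Const_mult [simp]: "Poly_Mapping.lookup (Const c * p) m = c * Poly_Mapping.lookup p m"
proof -
  have "Const c * p = Poly_Mapping.map ((*) c) p"
    by (simp add: Const_def mult_map_scale_conv_mult)
  then show ?thesis
    by (simp add: Poly_Mapping.map.rep_eq when_def)
qed

lemma lookup_Var_single: "Poly_Mapping.lookup (Var i :: 'k::comm_ring_1 mpoly) (Poly_Mapping.single j 1) = (if i = j then 1 else 0)"
proof -
  have "Poly_Mapping.single i (1::nat) = Poly_Mapping.single j 1 \<longleftrightarrow> i = j"
    by (metis lookup_single_eq lookup_single_not_eq zero_neq_one)
  then show ?thesis
    by (simp add: Var_def lookup_single when_def)
qed

lemma lookup_Const_single: "Poly_Mapping.lookup (Const c) (Poly_Mapping.single j (1::nat)) = 0"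
proof -
  have "(0::nat \<Rightarrow>\<^sub>0 nat) \<noteq> Poly_Mapping.single j 1"
    by (metis lookup_single_eq lookup_zero zero_neq_one)
  then show ?thesis
    by (simp add: Const_def lookup_single when_def)
qed

subsection \<open>Algebra homomorphisms\<close>

text \<open>An endomorphism of \<open>k[x\<^sub>1,\<dots>,x\<^sub>n]\<close> is treated as an endomorphism of the polynomial ring in all variables
  that fixes the variables outside \<open>1..n\<close>, so that no carrier sets are needed.\<close>

definition alghom :: "('k::comm_ring_1 mpoly \<Rightarrow> 'k mpoly) \<Rightarrow> bool" where
  "alghom \<Phi> \<longleftrightarrow> (\<forall>p q. \<Phi> (p + q) = \<Phi> p + \<Phi> q) \<and> (\<forall>p q. \<Phi> (p * q) = \<Phi> p * \<Phi> q) \<and> (\<forall>c. \<Phi> (Const c) = Const c)"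

lemma alghom_add: "alghom \<Phi> \<Longrightarrow> \<Phi> (p + q) = \<Phi> p + \<Phi> q"
  and alghom_mult: "alghom \<Phi> \<Longrightarrow> \<Phi> (p * q) = \<Phi> p * \<Phi> q"
  and alghom_Const: "alghom \<Phi> \<Longrightarrow> \<Phi> (Const c) = Const c"
  by (simp_all add: alghom_def)

lemma alghom_0: "alghom \<Phi> \<Longrightarrow> \<Phi> 0 = 0"
  by (metis Const_0 alghom_Const)

lemma alghom_1: "alghom \<Phi> \<Longrightarrow> \<Phi> 1 = 1"
  by (metis Const_1 alghom_Const)

lemma alghom_of_nat: "alghom \<Phi> \<Longrightarrow> \<Phi> (of_nat k) = of_nat k"
  by (metis Const_of_nat alghom_Const)

lemma alghom_of_int: "alghom \<Phi> \<Longrightarrow> \<Phi> (of_int k) = of_int k"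
  by (metis Const_of_int alghom_Const)

lemma alghom_numeral: "alghom \<Phi> \<Longrightarrow> \<Phi> (numeral k) = numeral k"
  by (metis Const_numeral alghom_Const)

lemma alghom_uminus: "alghom \<Phi> \<Longrightarrow> \<Phi> (- p) = - \<Phi> p"
  by (metis add.right_inverse add_eq_0_iff alghom_0 alghom_add)

lemma alghom_diff: "alghom \<Phi> \<Longrightarrow> \<Phi> (p - q) = \<Phi> p - \<Phi> q"
  by (metis alghom_add alghom_uminus uminus_add_conv_diff add.commute)

lemma alghom_sum: "alghom \<Phi> \<Longrightarrow> \<Phi> (\<Sum>i\<in>A. g i) = (\<Sum>i\<in>A. \<Phi> (g i))"
  by (induction A rule: infinite_finite_induct) (auto simp: alghom_0 alghom_add)

lemma alghom_power: "alghom \<Phi> \<Longrightarrow> \<Phi> (p ^ k) = \<Phi> p ^ k"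
  by (induction k) (auto simp: alghom_1 alghom_mult)

lemmas alghom_simps = alghom_add alghom_mult alghom_Const alghom_0 alghom_1 alghom_of_nat alghom_of_int
  alghom_numeral alghom_uminus alghom_diff alghom_sum alghom_power

lemma alghom_id: "alghom (\<lambda>p. p)"
  by (simp add: alghom_def)

lemma alghom_comp: "alghom \<Phi> \<Longrightarrow> alghom \<Psi> \<Longrightarrow> alghom (\<lambda>p. \<Phi> (\<Psi> p))"
  by (simp add: alghom_def)

lemma alghom_eqI_on:
  assumes "alghom \<Phi>" "alghom \<Psi>" "\<And>i. i \<in> I \<Longrightarrow> \<Phi> (Var i) = \<Psi> (Var i)" "p \<in> polys_in I"
  shows "\<Phi> p = \<Psi> p"
  using assms(4) by (induction p rule: mpoly_induct) (use assms in \<open>simp_all add: alghom_simps\<close>)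

lemma alghom_eqI:
  assumes "alghom \<Phi>" "alghom \<Psi>" "\<And>i. \<Phi> (Var i) = \<Psi> (Var i)"
  shows "\<Phi> p = \<Psi> p"
  using alghom_eqI_on[OF assms(1,2), of UNIV] assms(3) by simp

lemma alghom_fixes:
  assumes "alghom \<Phi>" "\<And>i. i \<in> I \<Longrightarrow> \<Phi> (Var i) = Var i" "p \<in> polys_in I"
  shows "\<Phi> p = p"
  using alghom_eqI_on[OF assms(1) alghom_id assms(2,3)] .

lemma alghom_polys_in:
  assumes "alghom \<Phi>" "\<And>i. i \<in> I \<Longrightarrow> \<Phi> (Var i) \<in> polys_in J" "p \<in> polys_in I"
  shows "\<Phi> p \<in> polys_in J"
  using assms(3)
  by (induction p rule: mpoly_induct) (use assms in \<open>auto simp: alghom_simps intro: polys_in_add polys_in_mult\<close>)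

text \<open>Terms may cancel in \<open>p + q\<close>, so its support can be smaller than the union
  of the two supports. Over a common finite superset the additional coefficients are 0, and sums can
  be compared term by term.\<close>

lemma subst_superset:
  assumes "finite M" "Poly_Mapping.keys p \<subseteq> M"
  shows "subst F p = (\<Sum>m \<in> M. Const (Poly_Mapping.lookup p m) * monom_val F m)"
  unfolding subst_def monom_val_def[symmetric]
  by (rule sum.mono_neutral_left) (use assms in \<open>auto simp: in_keys_iff\<close>)

lemma subst_add: "subst F (p + q) = subst F p + subst F q"
proof -
  let ?M = "Poly_Mapping.keys p \<union> Poly_Mapping.keys q"
  have "Poly_Mapping.keys (p + q) \<subseteq> ?M"
    by (rule Poly_Mapping.keys_add)
  then show ?thesis
    by (simp add: subst_superset[of ?M] lookup_add Const_add ring_distribs sum.distrib)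
qed

lemma subst_single: "subst F (Poly_Mapping.single m c) = Const c * monom_val F m"
  by (subst subst_superset[of "{m}"]) auto

lemma subst_0: "subst F 0 = 0"
  by (simp add: subst_def)

lemma subst_sum: "subst F (\<Sum>i\<in>A. g i) = (\<Sum>i\<in>A. subst F (g i))"
  by (induction A rule: infinite_finite_induct) (auto simp: subst_0 subst_add)

lemma subst_mult: "subst F (p * q) = subst F p * subst F q"
proof -
  have s: "subst F (Poly_Mapping.single m c * Poly_Mapping.single m' c')
     = subst F (Poly_Mapping.single m c) * subst F (Poly_Mapping.single m' c')" for m m' c c'
    by (simp add: mult_single subst_single Const_mult monom_val_add ac_simps)
  let ?s = "\<lambda>p m. Poly_Mapping.single m (Poly_Mapping.lookup p m)"
  have "subst F ((\<Sum>m\<in>Poly_Mapping.keys p. ?s p m) * (\<Sum>m\<in>Poly_Mapping.keys q. ?s q m))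
     = subst F (\<Sum>m\<in>Poly_Mapping.keys p. ?s p m) * subst F (\<Sum>m\<in>Poly_Mapping.keys q. ?s q m)"
    by (simp add: sum_product subst_sum s)
  then show ?thesis
    by (simp flip: poly_mapping_sum_single)
qed

lemma alghom_subst: "alghom (subst F)"
  unfolding alghom_def by (auto simp: subst_add subst_mult Const_def subst_single)

lemma subst_Var [simp]: "subst F (Var i) = F i"
  by (simp add: Var_def subst_single monom_val_def)

text \<open>Passes between maps on the ring, in which the computations take place, and the tuples
  that represent automorphisms.\<close>

lemma subst_eq_alghom: "alghom \<Phi> \<Longrightarrow> subst (\<lambda>i. \<Phi> (Var i)) p = \<Phi> p"
  by (rule alghom_eqI) (auto intro: alghom_subst)

lemma subst_of_Var [simp]: "subst Var p = p"
  using subst_eq_alghom[OF alghom_id] .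

lemma subst_comp_map: "subst (comp_map F G) p = subst F (subst G p)"
  by (rule alghom_eqI) (auto intro: alghom_subst alghom_comp simp: comp_map_def)

subsection \<open>Derivations\<close>

definition derivation :: "('k::comm_ring_1 mpoly \<Rightarrow> 'k mpoly) \<Rightarrow> bool" where
  "derivation E \<longleftrightarrow> (\<forall>p q. E (p + q) = E p + E q) \<and> (\<forall>p q. E (p * q) = E p * q + p * E q) \<and> (\<forall>c. E (Const c) = 0)"

lemma derivation_add: "derivation E \<Longrightarrow> E (p + q) = E p + E q"
  and derivation_mult: "derivation E \<Longrightarrow> E (p * q) = E p * q + p * E q"
  and derivation_Const: "derivation E \<Longrightarrow> E (Const c) = 0"
  by (simp_all add: derivation_def)

lemma derivation_0: "derivation E \<Longrightarrow> E 0 = 0"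
  by (metis Const_0 derivation_Const)

lemma derivation_1: "derivation E \<Longrightarrow> E 1 = 0"
  by (metis Const_1 derivation_Const)

lemma derivation_of_nat: "derivation E \<Longrightarrow> E (of_nat k) = 0"
  by (metis Const_of_nat derivation_Const)

lemma derivation_of_int: "derivation E \<Longrightarrow> E (of_int k) = 0"
  by (metis Const_of_int derivation_Const)

lemma derivation_numeral: "derivation E \<Longrightarrow> E (numeral k) = 0"
  by (metis Const_numeral derivation_Const)

lemma derivation_uminus: "derivation E \<Longrightarrow> E (- p) = - E p"
  by (metis add.right_inverse add_eq_0_iff derivation_0 derivation_add)

lemma derivation_diff: "derivation E \<Longrightarrow> E (p - q) = E p - E q"
  by (metis derivation_add derivation_uminus uminus_add_conv_diff add.commute)

lemma derivation_sum: "derivation E \<Longrightarrow> E (\<Sum>i\<in>A. g i) = (\<Sum>i\<in>A. E (g i))"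
  by (induction A rule: infinite_finite_induct) (auto simp: derivation_0 derivation_add)

lemma derivation_Const_mult: "derivation E \<Longrightarrow> E (Const c * p) = Const c * E p"
  by (simp add: derivation_mult derivation_Const)

lemma derivation_power_eq_0: "derivation E \<Longrightarrow> E p = 0 \<Longrightarrow> E (p ^ k) = 0"
  by (induction k) (auto simp: derivation_1 derivation_mult)

lemmas derivation_simps = derivation_add derivation_mult derivation_Const derivation_0 derivation_1
  derivation_of_nat derivation_of_int derivation_numeral derivation_uminus derivation_diff derivation_sum

lemma derivation_smult: "derivation E \<Longrightarrow> derivation (\<lambda>g. q * E g)"
  by (simp add: derivation_def algebra_simps)

lemma derivation_plus: "derivation E \<Longrightarrow> derivation F \<Longrightarrow> derivation (\<lambda>g. E g + F g)"
  by (simp add: derivation_def algebra_simps)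

lemma derivation_linear_sum: "(\<And>j. j \<in> A \<Longrightarrow> derivation (E j)) \<Longrightarrow> derivation (\<lambda>g. \<Sum>j\<in>A. q j * E j g)"
proof (induction A rule: infinite_finite_induct)
  case (insert x F)
  then show ?case
    using derivation_plus[OF derivation_smult[of "E x" "q x"], of "\<lambda>g. \<Sum>j\<in>F. q j * E j g"] by simp
qed (auto simp: derivation_def)

lemma derivation_commutator: 
  "derivation E \<Longrightarrow> derivation F \<Longrightarrow> derivation (\<lambda>g. E (F g) - F (E g))"
  unfolding derivation_def[of "\<lambda>g. E (F g) - F (E g)"] by (simp add: derivation_simps algebra_simps)

text \<open>Both \<open>\<Phi> \<circ> E\<close> and \<open>F \<circ> \<Phi>\<close> are derivations
  along \<open>\<Phi>\<close>, so their values on the variables determine them. This covers equality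
  of derivations as well as conjugation of one derivation into another.\<close>

lemma derivation_eqI_twisted:
  assumes "alghom \<Phi>" "derivation E" "derivation F" "\<And>i. \<Phi> (E (Var i)) = F (\<Phi> (Var i))"
  shows "\<Phi> (E p) = F (\<Phi> p)"
proof -
  have "p \<in> polys_in UNIV" by simp
  then show ?thesis
    by (induction p rule: mpoly_induct) (use assms in \<open>simp_all add: alghom_simps derivation_simps\<close>)
qed

lemma derivation_eqI:
  assumes "derivation E" "derivation F" "\<And>i. E (Var i) = F (Var i)"
  shows "E p = F p"
  using derivation_eqI_twisted[OF alghom_id assms] .

lemma derivation_eq_0:
  assumes "derivation E" "\<And>i. i \<in> I \<Longrightarrow> E (Var i) = 0" "p \<in> polys_in I"
  shows "E p = 0"
  using assms(3) by (induction p rule: mpoly_induct) (use assms in \<open>simp_all add: derivation_simps\<close>)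

lemma derivation_polys_in:
  assumes "derivation E" "\<And>i. i \<in> I \<Longrightarrow> E (Var i) \<in> polys_in I" "p \<in> polys_in I"
  shows "E p \<in> polys_in I"
proof -
  \<comment> \<open>The Leibniz rule mentions the factors themselves, so membership of
    \<open>p\<close> is carried along in the induction.\<close>
  have "p \<in> polys_in I \<and> E p \<in> polys_in I"
    using assms(3) by (induction p rule: mpoly_induct) 
      (use assms in \<open>auto simp: derivation_simps intro!: polys_in_add polys_in_mult\<close>)
  then show ?thesis ..
qed

lemma pdiff_superset:
  assumes "finite M" "Poly_Mapping.keys p \<subseteq> M"
  shows "pdiff i p = (\<Sum>m \<in> M. Poly_Mapping.single (Poly_Mapping.update i (Poly_Mapping.lookup m i - 1) m)
        (of_nat (Poly_Mapping.lookup m i) * Poly_Mapping.lookup p m))"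
  unfolding pdiff_def
  by (rule sum.mono_neutral_left) (use assms in \<open>auto simp: in_keys_iff\<close>)

lemma pdiff_add: "pdiff i (p + q) = pdiff i p + pdiff i q"
proof -
  let ?M = "Poly_Mapping.keys p \<union> Poly_Mapping.keys q"
  have "Poly_Mapping.keys (p + q) \<subseteq> ?M"
    by (rule Poly_Mapping.keys_add)
  then show ?thesis
    by (simp add: pdiff_superset[of ?M] lookup_add single_add ring_distribs sum.distrib)
qed

lemma pdiff_single: "pdiff i (Poly_Mapping.single m c) =
    Poly_Mapping.single (Poly_Mapping.update i (Poly_Mapping.lookup m i - 1) m) (of_nat (Poly_Mapping.lookup m i) * c)"
  by (subst pdiff_superset[of "{m}"]) auto

lemma pdiff_0: "pdiff i 0 = 0"
  by (simp add: pdiff_def)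

lemma pdiff_sum: "pdiff i (\<Sum>j\<in>A. g j) = (\<Sum>j\<in>A. pdiff i (g j))"
  by (induction A rule: infinite_finite_induct) (auto simp: pdiff_0 pdiff_add)

text \<open>For a positive exponent the truncated subtraction is a true one. A monomial with
  exponent 0 is left unchanged by the update, but its coefficient in \<open>pdiff\<close>
  vanishes.\<close>

lemma update_lookup_pred_add:
  fixes m m' :: "nat \<Rightarrow>\<^sub>0 nat"
  assumes "Poly_Mapping.lookup m i > 0"
  shows "Poly_Mapping.update i (Poly_Mapping.lookup m i - 1) m + m' =
    Poly_Mapping.update i (Poly_Mapping.lookup (m + m') i - 1) (m + m')"
proof (rule poly_mapping_eqI)
  fix k
  show "Poly_Mapping.lookup (Poly_Mapping.update i (Poly_Mapping.lookup m i - 1) m + m') k =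
    Poly_Mapping.lookup (Poly_Mapping.update i (Poly_Mapping.lookup (m + m') i - 1) (m + m')) k"
    by (cases "k = i") (use assms in \<open>simp_all add: lookup_update lookup_add\<close>)
qed

lemma pdiff_single_mult:
  "pdiff i (Poly_Mapping.single m c * Poly_Mapping.single m' c') =
    pdiff i (Poly_Mapping.single m c) * Poly_Mapping.single m' c' +
    Poly_Mapping.single m c * pdiff i (Poly_Mapping.single m' c')"
proof -
  let ?u = "Poly_Mapping.update i (Poly_Mapping.lookup (m + m') i - 1) (m + m')"
  have 1: "pdiff i (Poly_Mapping.single m c) * Poly_Mapping.single m' c' =
      Poly_Mapping.single ?u (of_nat (Poly_Mapping.lookup m i) * c * c')"
    by (cases "Poly_Mapping.lookup m i = 0") 
       (simp_all add: pdiff_single mult_single update_lookup_pred_add del: One_nat_def)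
  have 2: "Poly_Mapping.single m c * pdiff i (Poly_Mapping.single m' c') =
      Poly_Mapping.single ?u (of_nat (Poly_Mapping.lookup m' i) * c * c')"
    using update_lookup_pred_add[of m' i m]
    by (cases "Poly_Mapping.lookup m' i = 0") 
       (simp_all add: pdiff_single mult_single ac_simps del: One_nat_def)
  show ?thesis
    unfolding 1 2 single_add[symmetric] unfolding mult_single pdiff_single
    by (simp add: lookup_add algebra_simps)
qed

lemma pdiff_mult: "pdiff i (p * q) = pdiff i p * q + p * pdiff i q"
proof -
  let ?s = "\<lambda>p m. Poly_Mapping.single m (Poly_Mapping.lookup p m)"
  let ?p = "\<Sum>m\<in>Poly_Mapping.keys p. ?s p m" and ?q = "\<Sum>m\<in>Poly_Mapping.keys q. ?s q m"
  have "pdiff i (?p * ?q) = pdiff i ?p * ?q + ?p * pdiff i ?q"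
    by (simp add: sum_product pdiff_sum pdiff_single_mult sum.distrib)
  then show ?thesis
    by (simp flip: poly_mapping_sum_single)
qed

lemma derivation_pdiff: "derivation (pdiff i)"
  unfolding derivation_def by (auto simp: pdiff_add pdiff_mult Const_def pdiff_single)

lemma pdiff_Var: "pdiff i (Var j) = (if i = j then 1 else 0)"
proof -
  have "Poly_Mapping.update i 0 (Poly_Mapping.single i (1::nat)) = 0"
    by (rule poly_mapping_eqI) (auto simp: lookup_update lookup_single when_def)
  then show ?thesis
    by (auto simp: Var_def pdiff_single lookup_single when_def)
qed

subsection \<open>Locally nilpotent derivations and exponentials\<close>

lemma funpow_eq_0_mono:
  assumes "derivation E" "(E ^^ m) g = 0" "m \<le> k"
  shows "(E ^^ k) g = 0"
proof -
  have "(E ^^ j) 0 = 0" for j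
    by (induction j) (simp_all add: derivation_0[OF assms(1)])
  moreover have "(E ^^ k) g = (E ^^ (k - m)) ((E ^^ m) g)"
    using assms(3) by (simp flip: funpow_add comp_apply[of "E ^^ (k - m)"])
  ultimately show ?thesis
    by (simp add: assms(2))
qed

text \<open>Divided powers: with the factorial absorbed, the Leibniz and binomial formulas become
  plain convolutions.\<close>

definition dpow :: "('k::field_char_0 mpoly \<Rightarrow> 'k mpoly) \<Rightarrow> nat \<Rightarrow> 'k mpoly \<Rightarrow> 'k mpoly" where
  "dpow E i g = Const (1 / fact i) * (E ^^ i) g"

lemma dpow_0 [simp]: "dpow E 0 g = g"
  by (simp add: dpow_def)

lemma derivation_dpow:
  assumes "derivation E"
  shows "E (dpow E i g) = of_nat (Suc i) * dpow E (Suc i) g"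
proof -
  have "of_nat (Suc i) * (1 / fact (Suc i)) = (1 / fact i :: 'a)"
    by (simp add: field_simps del: of_nat_Suc)
  then have "of_nat (Suc i) * Const (1 / fact (Suc i)) = Const (1 / fact i :: 'a)"
    by (metis Const_mult Const_of_nat)
  then show ?thesis
    by (simp add: dpow_def derivation_Const_mult[OF assms] mult.assoc[symmetric] del: of_nat_Suc fact_Suc)
qed

lemma Const_fact [simp]: "Const (fact k) = fact k"
  by (metis Const_of_nat of_nat_fact)

lemma fact_mult_dpow: "fact i * dpow E i g = (E ^^ i) g"
proof -
  have "fact i * Const (1 / fact i) = Const (of_nat (fact i) * (1 / fact i :: 'a))"
    by (simp only: Const_mult Const_fact of_nat_fact)
  also have "\<dots> = 1"
    by simp
  finally show ?thesis
    by (simp add: dpow_def mult.assoc[symmetric])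
qed

lemma dpow_eq_0: "derivation E \<Longrightarrow> (E ^^ m) g = 0 \<Longrightarrow> m \<le> i \<Longrightarrow> dpow E i g = 0"
  by (simp add: dpow_def funpow_eq_0_mono)

text \<open>The least exponent in \<open>exp_der\<close> differs between \<open>p\<close>,
  \<open>q\<close>, \<open>p + q\<close> and \<open>p * q\<close>; any exponent that kills the
  argument may replace it, so a common one can be used.\<close>

lemma exp_der_eq_sum:
  assumes "derivation E" "(E ^^ M) g = 0"
  shows "exp_der E g = (\<Sum>i<M. dpow E i g)"
proof -
  let ?L = "LEAST m. (E ^^ m) g = 0"
  have L: "?L \<le> M" "(E ^^ ?L) g = 0"
    using assms(2) by (auto intro: Least_le LeastI)
  have "exp_der E g = (\<Sum>i<?L. dpow E i g)"
    by (simp add: exp_der_def dpow_def)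
  also have "\<dots> = (\<Sum>i<M. dpow E i g)"
    by (rule sum.mono_neutral_left) (use L assms in \<open>auto simp: dpow_eq_0\<close>)
  finally show ?thesis .
qed

text \<open>Local nilpotency on the ring in all variables, which makes the exponential a
  homomorphism of that whole ring; \<open>locally_nilpotent n\<close> speaks of the first
  \<open>n\<close> variables only.\<close>

definition lnd :: "('k::comm_ring_1 mpoly \<Rightarrow> 'k mpoly) \<Rightarrow> bool" where
  "lnd E \<longleftrightarrow> derivation E \<and> (\<forall>g. \<exists>m. (E ^^ m) g = 0)"

lemma lnd_derivation: "lnd E \<Longrightarrow> derivation E"
  by (simp add: lnd_def)

lemma lnd_nilpotent: "lnd E \<Longrightarrow> \<exists>m. (E ^^ m) g = 0"
  by (simp add: lnd_def)

text \<open>The next two lemmas contain the Leibniz formula for powers (\<open>F i j = dpow E i p * dpow E j q\<close>),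
  the binomial formula for commuting operators (\<open>F i j = dpow A i (dpow B j g)\<close>) and the formula
  \<open>exp A \<circ> B = exp (ad A) B \<circ> exp A\<close> (\<open>F i j = (ad A)^i B / i! (dpow A j g)\<close>).\<close>

lemma funpow_double_sequence:
  assumes E: "derivation E"
    and F: "\<And>i j. E (F i j) = of_nat (Suc i) * F (Suc i) j + of_nat (Suc j) * F i (Suc j)"
  shows "(E ^^ m) (F 0 0) = fact m * (\<Sum>i\<le>m. F i (m - i))"
proof (induction m)
  case (Suc m)
  have "E (\<Sum>i\<le>m. F i (m - i)) = (\<Sum>i\<le>m. of_nat (Suc i) * F (Suc i) (m - i)) + 
      (\<Sum>i\<le>m. of_nat (Suc (m - i)) * F i (Suc (m - i)))"
    by (simp add: derivation_sum[OF E] F sum.distrib del: of_nat_Suc)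
  also have "(\<Sum>i\<le>m. of_nat (Suc i) * F (Suc i) (m - i)) = (\<Sum>i\<le>Suc m. of_nat i * F i (Suc m - i))"
    by (simp add: sum.atMost_Suc_shift del: of_nat_Suc sum.atMost_Suc)
  also have "(\<Sum>i\<le>m. of_nat (Suc (m - i)) * F i (Suc (m - i))) = 
      (\<Sum>i\<le>Suc m. of_nat (Suc m - i) * F i (Suc m - i))"
    by (simp only: sum.atMost_Suc diff_self_eq_0 of_nat_0 mult_zero_left add_0_right)
       (rule sum.cong, simp_all only: Suc_diff_le atMost_iff)
  also have "(\<Sum>i\<le>Suc m. of_nat i * F i (Suc m - i)) + (\<Sum>i\<le>Suc m. of_nat (Suc m - i) * F i (Suc m - i))
      = of_nat (Suc m) * (\<Sum>i\<le>Suc m. F i (Suc m - i))"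
    unfolding sum_distrib_left sum.distrib[symmetric] distrib_right[symmetric]
    by (rule sum.cong) (auto simp flip: of_nat_add simp del: of_nat_Suc)
  finally have *: "E (\<Sum>i\<le>m. F i (m - i)) = of_nat (Suc m) * (\<Sum>i\<le>Suc m. F i (Suc m - i))" .
  have "E (fact m) = 0"
    using derivation_of_nat[OF E, of "fact m"] by simp
  then have "(E ^^ Suc m) (F 0 0) = fact m * E (\<Sum>i\<le>m. F i (m - i))"
    by (simp add: Suc.IH derivation_mult[OF E])
  also have "\<dots> = fact (Suc m) * (\<Sum>i\<le>Suc m. F i (Suc m - i))"
    unfolding * by (simp add: algebra_simps)
  finally show ?case .
qed auto

lemma
  fixes E :: "'k::field_char_0 mpoly \<Rightarrow> 'k mpoly"
  assumes E: "derivation E"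
    and F: "\<And>i j. E (F i j) = of_nat (Suc i) * F (Suc i) j + of_nat (Suc j) * F i (Suc j)"
    and P: "\<And>i j. i \<ge> P \<Longrightarrow> F i j = 0" and Q: "\<And>i j. j \<ge> Q \<Longrightarrow> F i j = 0"
  shows funpow_double_sequence_eq_0: "(E ^^ (P + Q)) (F 0 0) = 0"
    and exp_der_double_sequence: "exp_der E (F 0 0) = (\<Sum>i<P. \<Sum>j<Q. F i j)"
proof -
  have "F i (P + Q - i) = 0" for i
    using P[of i] Q[of "P + Q - i" i] by (cases "i \<ge> P") auto
  then show 0: "(E ^^ (P + Q)) (F 0 0) = 0"
    by (simp add: funpow_double_sequence[OF E F])
  have d: "dpow E m (F 0 0) = (\<Sum>i\<le>m. F i (m - i))" for m
  proof -
    have "fact m * dpow E m (F 0 0) = fact m * (\<Sum>i\<le>m. F i (m - i))"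
      by (simp add: fact_mult_dpow funpow_double_sequence[OF E F])
    moreover have "(fact m :: 'k mpoly) \<noteq> 0"
      using of_nat_eq_0_iff[of "fact m", where 'a = "'k mpoly"] by simp
    ultimately show ?thesis by simp
  qed
  have "exp_der E (F 0 0) = (\<Sum>m<P+Q. \<Sum>i\<le>m. F i (m - i))"
    by (simp add: exp_der_eq_sum[OF E 0] d)
  also have "\<dots> = (\<Sum>(i,j)\<in>{(i,j). i + j < P + Q}. F i j)"
    by (simp add: sum.triangle_reindex)
  \<comment> \<open>The rectangle lies inside the triangle, and outside the rectangle one of the two
    vanishing hypotheses applies.\<close>
  also have "\<dots> = (\<Sum>(i,j)\<in>{..<P} \<times> {..<Q}. F i j)"
  proof (rule sum.mono_neutral_right)
    have "{(i,j). i + j < P + Q} \<subseteq> {..P+Q} \<times> {..P+Q}" by auto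
    then show "finite {(i,j). i + j < P + Q}"
      by (rule finite_subset) auto
  qed (auto simp: not_less intro: P Q)
  finally show "exp_der E (F 0 0) = (\<Sum>i<P. \<Sum>j<Q. F i j)"
    by (simp add: sum.cartesian_product)
qed

lemma
  fixes E :: "'k::field_char_0 mpoly \<Rightarrow> 'k mpoly"
  assumes E: "derivation E" and "(E ^^ P) p = 0" "(E ^^ Q) q = 0"
  shows funpow_mult_eq_0: "(E ^^ (P + Q)) (p * q) = 0"
    and exp_der_mult_aux: "exp_der E (p * q) = exp_der E p * exp_der E q"
proof -
  let ?F = "\<lambda>i j. dpow E i p * dpow E j q"
  have F: "E (?F i j) = of_nat (Suc i) * ?F (Suc i) j + of_nat (Suc j) * ?F i (Suc j)" for i j
    by (simp add: derivation_mult[OF E] derivation_dpow[OF E] algebra_simps del: of_nat_Suc)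
  have P: "i \<ge> P \<Longrightarrow> ?F i j = 0" and Q: "j \<ge> Q \<Longrightarrow> ?F i j = 0" for i j
    using assms by (simp_all add: dpow_eq_0)
  show "(E ^^ (P + Q)) (p * q) = 0"
    using funpow_double_sequence_eq_0[of E ?F, OF E F P Q] by simp
  show "exp_der E (p * q) = exp_der E p * exp_der E q"
    using exp_der_double_sequence[of E ?F, OF E F P Q] assms
    by (simp add: exp_der_eq_sum[of E P p] exp_der_eq_sum[of E Q q] sum_product)
qed

lemma funpow_derivation_add: "derivation E \<Longrightarrow> (E ^^ m) (p + q) = (E ^^ m) p + (E ^^ m) q"
  by (induction m) (simp_all add: derivation_add)

text \<open>The elements killed by some power of \<open>E\<close> form a subring, products being
  covered by the Leibniz formula, so the variables suffice.\<close>

lemma lndI: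
  fixes E :: "'k::field_char_0 mpoly \<Rightarrow> 'k mpoly"
  assumes E: "derivation E" and V: "\<And>i. \<exists>m. (E ^^ m) (Var i) = 0"
  shows "lnd E"
proof -
  have "\<exists>m. (E ^^ m) g = 0" for g
  proof -
    have "g \<in> polys_in UNIV" by simp
    then show ?thesis
    proof (induction g rule: mpoly_induct)
      case (Const c)
      have "(E ^^ 1) (Const c) = 0" by (simp add: derivation_Const[OF E])
      then show ?case ..
    next
      case (add p q)
      then obtain a b where "(E ^^ a) p = 0" "(E ^^ b) q = 0" by auto
      then have "(E ^^ max a b) (p + q) = 0"
        using funpow_eq_0_mono[OF E, of _ _ "max a b"] by (simp add: funpow_derivation_add[OF E])
      then show ?case ..
    next
      case (mult p q)
      then show ?case using funpow_mult_eq_0[OF E] by blast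
    qed (rule V)
  qed
  with E show ?thesis by (simp add: lnd_def)
qed

lemma exp_der_add:
  assumes "lnd E" shows "exp_der E (p + q) = exp_der E p + exp_der E q"
proof -
  note E = lnd_derivation[OF assms]
  obtain a b where "(E ^^ a) p = 0" "(E ^^ b) q = 0" 
    using lnd_nilpotent[OF assms] by blast
  then have M: "(E ^^ (max a b)) p = 0" "(E ^^ (max a b)) q = 0"
    by (auto intro: funpow_eq_0_mono[OF E])
  then have "(E ^^ (max a b)) (p + q) = 0"
    by (simp add: funpow_derivation_add[OF E])
  from exp_der_eq_sum[OF E this] exp_der_eq_sum[OF E M(1)] exp_der_eq_sum[OF E M(2)] show ?thesis
    by (simp add: dpow_def funpow_derivation_add[OF E] ring_distribs sum.distrib)
qed

lemma exp_der_eq_self: 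
  assumes "derivation E" "E g = 0" shows "exp_der E g = g"
proof -
  have "(E ^^ 1) g = 0" by (simp add: assms)
  from exp_der_eq_sum[OF assms(1) this] show ?thesis by simp
qed

lemma alghom_exp_der:
  assumes "lnd E" shows "alghom (exp_der E)"
  unfolding alghom_def
proof (intro conjI allI)
  fix p q
  show "exp_der E (p + q) = exp_der E p + exp_der E q"
    by (rule exp_der_add[OF assms])
  show "exp_der E (p * q) = exp_der E p * exp_der E q"
    using assms exp_der_mult_aux[of E] unfolding lnd_def by metis
next
  fix c show "exp_der E (Const c) = Const c"
    using lnd_derivation[OF assms] by (simp add: exp_der_eq_self derivation_Const)
qed

lemma exp_der_polys_in:
  assumes "lnd E" "\<And>i. i \<in> I \<Longrightarrow> E (Var i) \<in> polys_in I" "g \<in> polys_in I"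
  shows "exp_der E g \<in> polys_in I"
proof -
  note E = lnd_derivation[OF assms(1)]
  obtain m where "(E ^^ m) g = 0" using lnd_nilpotent[OF assms(1)] by blast
  moreover have "(E ^^ i) g \<in> polys_in I" for i
    by (induction i) (auto intro: derivation_polys_in[OF E assms(2)] assms(3))
  ultimately show ?thesis
    by (auto simp: exp_der_eq_sum[OF E] dpow_def intro!: polys_in_sum polys_in_mult)
qed

text \<open>The rule that conjugating an exponential conjugates the derivation, written without an
  inverse of \<open>\<Phi>\<close>.\<close>

lemma exp_der_twisted:
  assumes "alghom \<Phi>" "lnd A" "lnd B" "\<And>g. \<Phi> (A g) = B (\<Phi> g)"
  shows "\<Phi> (exp_der A g) = exp_der B (\<Phi> g)"
proof -
  have pow: "\<Phi> ((A ^^ i) g) = (B ^^ i) (\<Phi> g)" for i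
    by (induction i) (simp_all add: assms(4))
  obtain m where m: "(A ^^ m) g = 0" using lnd_nilpotent[OF assms(2)] by blast
  then have "(B ^^ m) (\<Phi> g) = 0"
    using pow[of m] by (simp add: alghom_0[OF assms(1)])
  with m show ?thesis
    by (simp add: exp_der_eq_sum[OF lnd_derivation] assms(2,3) alghom_simps[OF assms(1)] dpow_def pow)
qed

lemma dpow_commute:
  assumes A: "derivation A" and "\<And>g. A (B g) = B (A g)" and B: "derivation B"
  shows "B (dpow A i g) = dpow A i (B g)"
proof -
  have "B ((A ^^ i) g) = (A ^^ i) (B g)"
    by (induction i) (simp_all add: assms(2)[symmetric])
  then show ?thesis
    by (simp add: dpow_def derivation_Const_mult[OF B])
qed

lemma dpow_of_nat_mult:
  assumes A: "derivation A"
  shows "dpow A i (of_nat k * g) = of_nat k * dpow A i g"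
proof -
  have "(A ^^ i) (of_nat k * g) = of_nat k * (A ^^ i) g"
    by (induction i) (simp_all add: derivation_simps[OF A])
  then show ?thesis
    by (simp add: dpow_def)
qed

lemma
  fixes A B :: "'k::field_char_0 mpoly \<Rightarrow> 'k mpoly"
  assumes A: "lnd A" and B: "lnd B" and AB: "\<And>g. A (B g) = B (A g)"
  shows lnd_plus: "lnd (\<lambda>g. A g + B g)"
    and exp_der_plus: "exp_der (\<lambda>g. A g + B g) g = exp_der A (exp_der B g)"
proof -
  note dA = lnd_derivation[OF A] and dB = lnd_derivation[OF B]
  let ?E = "\<lambda>g. A g + B g"
  have E: "derivation ?E" using dA dB by (rule derivation_plus)
  have *: "\<exists>M. (?E ^^ M) g = 0 \<and> exp_der ?E g = exp_der A (exp_der B g)" for g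
  proof -
    obtain Q where Q: "(B ^^ Q) g = 0" using lnd_nilpotent[OF B] by blast
    obtain P where P: "(A ^^ P) g = 0" using lnd_nilpotent[OF A] by blast
    let ?F = "\<lambda>i j. dpow A i (dpow B j g)"
    \<comment> \<open>The exponent \<open>P\<close> kills \<open>g\<close> under \<open>A\<close>,
      but nothing is known yet about \<open>dpow B j g\<close>. Moving \<open>A\<close> inside makes
      \<open>P\<close> work for every \<open>j\<close>.\<close>
    have comm: "?F i j = dpow B j (dpow A i g)" for i j
    proof -
      have 1: "(A ^^ i) (dpow B j g) = dpow B j ((A ^^ i) g)"
        by (induction i) (simp_all add: dpow_commute[OF dB _ dA] AB)
      have 2: "(B ^^ j) (Const c * h) = Const c * (B ^^ j) h" for c h
        by (induction j) (simp_all add: derivation_Const_mult[OF dB])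
      have "?F i j = Const (1 / fact i) * dpow B j ((A ^^ i) g)"
        unfolding dpow_def[of A] 1 ..
      also have "\<dots> = dpow B j (dpow A i g)"
        unfolding dpow_def 2 by (rule mult.left_commute)
      finally show ?thesis .
    qed
    have F: "?E (?F i j) = of_nat (Suc i) * ?F (Suc i) j + of_nat (Suc j) * ?F i (Suc j)" for i j
      by (simp add: derivation_dpow[OF dA] dpow_commute[OF dA AB dB] derivation_dpow[OF dB] 
          dpow_of_nat_mult[OF dA] del: of_nat_Suc)
    have z: "dpow A i 0 = 0" "dpow B i 0 = 0" for i
      using funpow_eq_0_mono[OF dA, of 0 0 i] funpow_eq_0_mono[OF dB, of 0 0 i] by (simp_all add: dpow_def)
    have P': "i \<ge> P \<Longrightarrow> ?F i j = 0" for i j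
      unfolding comm by (simp add: dpow_eq_0[OF dA P] z)
    have Q': "j \<ge> Q \<Longrightarrow> ?F i j = 0" for i j
      by (simp add: dpow_eq_0[OF dB Q] z)
    have "exp_der ?E g = (\<Sum>i<P. \<Sum>j<Q. ?F i j)"
      using exp_der_double_sequence[of ?E ?F, OF E F P' Q'] by simp
    also have "\<dots> = (\<Sum>j<Q. exp_der A (dpow B j g))"
    proof (subst sum.swap, rule sum.cong)
      fix j
      have "(A ^^ P) (dpow B j g) = 0"
        using P'[of P j] fact_mult_dpow[of P A "dpow B j g"] by simp
      then show "(\<Sum>i<P. ?F i j) = exp_der A (dpow B j g)"
        by (simp add: exp_der_eq_sum[OF dA])
    qed simp
    also have "\<dots> = exp_der A (exp_der B g)"
      by (simp add: exp_der_eq_sum[OF dB Q] alghom_sum[OF alghom_exp_der[OF A]])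
    finally show ?thesis
      using funpow_double_sequence_eq_0[of ?E ?F, OF E F P' Q'] by auto
  qed
  show "lnd ?E" using E * by (auto simp: lnd_def)
  show "exp_der ?E g = exp_der A (exp_der B g)" using *[of g] by auto
qed

lemma exp_der_zero [simp]: "exp_der (\<lambda>_. 0) g = g"
  by (rule exp_der_eq_self) (simp_all add: derivation_def)

text \<open>An element of the kernel behaves like a scalar for \<open>E\<close>, so
  \<open>q E\<close> inherits local nilpotency from \<open>E\<close>.\<close>

lemma funpow_smult:
  assumes "derivation E" "E q = 0" shows "((\<lambda>g. q * E g) ^^ m) g = q ^ m * (E ^^ m) g"
  by (induction m) (simp_all add: derivation_mult[OF assms(1)] derivation_power_eq_0[OF assms] mult.assoc)

lemma lnd_smult:
  assumes "lnd E" "E q = 0" shows "lnd (\<lambda>g. q * E g)"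
  using assms unfolding lnd_def
  by (metis derivation_smult funpow_smult mult_zero_right)

lemma exp_der_smult_add:
  assumes E: "lnd E" and "E p = 0" "E q = 0"
  shows "exp_der (\<lambda>g. (p + q) * E g) g = exp_der (\<lambda>g. p * E g) (exp_der (\<lambda>g. q * E g) g)"
proof -
  note d = lnd_derivation[OF E]
  have "p * E (q * E g) = q * E (p * E g)" for g
    by (simp add: derivation_mult[OF d] assms mult.left_commute)
  from exp_der_plus[OF lnd_smult[OF E assms(2)] lnd_smult[OF E assms(3)] this] show ?thesis
    by (simp add: algebra_simps)
qed

text \<open>Here \<open>C = [A, B]\<close> and \<open>F = [A, [A, B]]\<close>, and the last
  hypothesis says that the next bracket is 0, so the series of \<open>exp (ad A) B\<close> stops
  after the quadratic term. In sl_2 the adjoint action of \<open>D\<close> and of \<open>D'\<close>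
  has cube zero, so this case is all that occurs.\<close>

lemma exp_der_conj_quadratic:
  fixes A B C F :: "'k::field_char_0 mpoly \<Rightarrow> 'k mpoly"
  assumes A: "lnd A" and dB: "derivation B" and dC: "derivation C" and dF: "derivation F"
    and AB: "\<And>g. A (B g) = B (A g) + C g" and AC: "\<And>g. A (C g) = C (A g) + F g"
    and AF: "\<And>g. A (F g) = F (A g)"
  shows "exp_der A (B g) = B (exp_der A g) + C (exp_der A g) + Const (1/2) * F (exp_der A g)"
proof -
  note dA = lnd_derivation[OF A]
  obtain Q where Q: "(A ^^ Q) g = 0" using lnd_nilpotent[OF A] by blast
  \<comment> \<open>\<open>ad i\<close> is the divided power \<open>(ad A)^i B / i!\<close>, hence
    the factor 1/2 at \<open>i = 2\<close>.\<close>
  define ad where "ad i = (if i = 0 then B else if i = 1 then C else if i = 2 then (\<lambda>g. Const (1/2) * F g) else (\<lambda>g. 0))" for i :: nat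
  have dad: "derivation (ad i)" for i
    unfolding ad_def using dB dC derivation_smult[OF dF] by (auto simp: derivation_def)
  have Aad: "A (ad i h) = of_nat (Suc i) * ad (Suc i) h + ad i (A h)" for i h
  proof -
    have "2 * Const (1/2) = (Const (2 * (1/2)) :: 'k mpoly)"
      by (simp only: Const_mult Const_numeral)
    then have h2: "2 * Const (1/2) = (1 :: 'k mpoly)"
      by simp
    consider "i = 0" | "i = 1" | "i = 2" | "i > 2" by linarith
    then show ?thesis
      by cases (simp_all add: ad_def AB AC AF derivation_Const_mult[OF dA] derivation_0[OF dA] distrib_right h2)
  qed
  let ?F = "\<lambda>i j. ad i (dpow A j g)"
  have F: "A (?F i j) = of_nat (Suc i) * ?F (Suc i) j + of_nat (Suc j) * ?F i (Suc j)" for i j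
    by (simp only: Aad derivation_dpow[OF dA] derivation_simps[OF dad]) simp
  have "exp_der A (?F 0 0) = (\<Sum>i<3. \<Sum>j<Q. ?F i j)"
  proof (rule exp_der_double_sequence[OF dA F])
    show "?F i j = 0" if "i \<ge> 3" for i j using that by (simp add: ad_def)
    show "?F i j = 0" if "j \<ge> Q" for i j by (simp add: dpow_eq_0[OF dA Q that] derivation_0[OF dad])
  qed
  also have "\<dots> = (\<Sum>i<3. ad i (exp_der A g))"
    by (simp add: exp_der_eq_sum[OF dA Q] derivation_sum[OF dad])
  finally show ?thesis
    by (simp add: ad_def numeral_3_eq_3 lessThan_Suc)
qed

section \<open>The invariant \<open>f_n\<close>\<close>

definition shear :: "nat \<Rightarrow> 'k::comm_ring_1 mpoly \<Rightarrow> 'k mpoly \<Rightarrow> 'k mpoly" where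
  "shear j p = subst (Var(j := Var j + p))"

lemma alghom_shear: "alghom (shear j p)"
  by (simp add: shear_def alghom_subst)

lemma shear_Var: "shear j p (Var i) = (if i = j then Var j + p else Var i)"
  by (simp add: shear_def)

lemma shear_fixes: "q \<in> polys_in I \<Longrightarrow> j \<notin> I \<Longrightarrow> shear j p q = q"
  by (rule alghom_fixes[OF alghom_shear]) (auto simp: shear_Var)

section \<open>The derivations \<open>D\<close> and \<open>D'\<close> and their sl_2-triple\<close>

lemma derivation_derD: "derivation (derD n)"
  unfolding derD_def by (intro derivation_linear_sum derivation_pdiff)

lemma derivation_derD': "derivation (derD' n)"
  unfolding derD'_def by (intro derivation_linear_sum derivation_pdiff)

lemma derD_Var: "derD n (Var i) = (if i \<in> {1..n} then of_nat (n - i) * Var (Suc i) else 0)"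
proof -
  have "derD n (Var i) = (\<Sum>j \<in> {1..n-1}. if j = i then of_nat (n - i) * Var (Suc i) else 0)"
    unfolding derD_def by (rule sum.cong) (auto simp: pdiff_Var simp del: of_nat_diff)
  also have "\<dots> = (if i \<in> {1..n-1} then of_nat (n - i) * Var (Suc i) else 0)"
    by simp
  \<comment> \<open>At \<open>i = n\<close> the factor \<open>n - i\<close> is 0, so this index may
    be included and one formula covers all variables of the ring.\<close>
  also have "\<dots> = (if i \<in> {1..n} then of_nat (n - i) * Var (Suc i) else 0)"
    by (cases "i = n") auto
  finally show ?thesis .
qed

lemma derD'_Var: "derD' n (Var i) = (if i \<in> {1..n} then of_nat (i - 1) * Var (i - 1) else 0)"
proof -
  have "derD' n (Var i) = (\<Sum>j \<in> {2..n}. if j = i then of_nat (i - 1) * Var (i - 1) else 0)"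
    unfolding derD'_def by (rule sum.cong) (auto simp: pdiff_Var simp del: of_nat_diff)
  also have "\<dots> = (if i \<in> {2..n} then of_nat (i - 1) * Var (i - 1) else 0)"
    by simp
  also have "\<dots> = (if i \<in> {1..n} then of_nat (i - 1) * Var (i - 1) else 0)"
    by (cases "i = 1") auto
  finally show ?thesis .
qed

lemma funpow_of_nat_mult: "derivation E \<Longrightarrow> (E ^^ m) (of_nat k * g) = of_nat k * (E ^^ m) g"
  by (induction m) (simp_all add: derivation_simps)

lemma lnd_derD: "lnd (derD n :: 'k::field_char_0 mpoly \<Rightarrow> 'k mpoly)"
proof (rule lndI[OF derivation_derD])
  fix i
  show "\<exists>m. (derD n ^^ m) (Var i :: 'k mpoly) = 0"
  proof (cases "i \<in> {1..n}")
    case True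
    then show ?thesis
    proof (induction "n - i" arbitrary: i)
      case 0
      then have "(derD n ^^ 1) (Var i :: 'k mpoly) = 0" by (simp add: derD_Var)
      then show ?case ..
    next
      case (Suc k)
      then have "k = n - Suc i" "Suc i \<in> {1..n}" by auto
      from Suc.hyps(1)[OF this] obtain m where "(derD n ^^ m) (Var (Suc i) :: 'k mpoly) = 0" ..
      then have "(derD n ^^ Suc m) (Var i :: 'k mpoly) = 0"
        using Suc.prems by (simp add: funpow_Suc_right derD_Var funpow_of_nat_mult[OF derivation_derD] del: funpow.simps of_nat_diff)
      then show ?case ..
    qed
  next
    case False
    then have "(derD n ^^ 1) (Var i :: 'k mpoly) = 0" by (auto simp: derD_Var)
    then show ?thesis ..
  qed
qed

lemma lnd_derD': "lnd (derD' n :: 'k::field_char_0 mpoly \<Rightarrow> 'k mpoly)"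
proof (rule lndI[OF derivation_derD'])
  fix i
  show "\<exists>m. (derD' n ^^ m) (Var i :: 'k mpoly) = 0"
  proof (cases "i \<in> {1..n}")
    case True
    then show ?thesis
    proof (induction i)
      case (Suc k)
      show ?case
      proof (cases "k = 0")
        case True
        then have "(derD' n ^^ 1) (Var (Suc k) :: 'k mpoly) = 0" by (simp add: derD'_Var)
        then show ?thesis ..
      next
        case False
        with Suc obtain m where "(derD' n ^^ m) (Var k :: 'k mpoly) = 0" by auto
        then have "(derD' n ^^ Suc m) (Var (Suc k) :: 'k mpoly) = 0"
          using Suc.prems by (simp add: funpow_Suc_right derD'_Var funpow_of_nat_mult[OF derivation_derD'] del: funpow.simps of_nat_diff)
        then show ?thesis ..
      qed
    qed simp
  next
    case False
    then have "(derD' n ^^ 1) (Var i :: 'k mpoly) = 0" by (auto simp: derD'_Var)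
    then show ?thesis ..
  qed
qed

text \<open>The weight operator \<open>H = [D', D]\<close>. Here \<open>D'\<close> raises weights by
  2 and \<open>D\<close> lowers them by 2; the span of \<open>x_1, ..., x_n\<close> is the
  irreducible module of dimension \<open>n\<close>, with highest weight vector
  \<open>x_1\<close>.\<close>

definition derH :: "nat \<Rightarrow> 'k::comm_ring_1 mpoly \<Rightarrow> 'k mpoly" where
  "derH n g = derD' n (derD n g) - derD n (derD' n g)"

lemma derivation_derH: "derivation (derH n)"
  unfolding derH_def by (intro derivation_commutator derivation_derD derivation_derD')

lemma derH_Var: "derH n (Var i) = (if i \<in> {1..n} then of_int (int n + 1 - 2 * int i) * Var i else 0)"
proof (cases "i \<in> {1..n}")
  case True
  \<comment> \<open>With these numbers \<open>D' D\<close> and \<open>D D'\<close> act on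
    \<open>x_i\<close> as \<open>b (a + 1)\<close> and \<open>a (b + 1)\<close>; the difference is
    \<open>b - a\<close>, and truncated subtraction is avoided.\<close>
  define a b where "a = i - 1" and "b = n - i"
  have i: "i = Suc a" and n: "n = Suc a + b"
    using True by (auto simp: a_def b_def)
  have 1: "derD' n (derD n (Var i)) = of_nat b * (of_nat (Suc a) * Var i :: 'a mpoly)"
    by (cases "b = 0") (auto simp: derD_Var derD'_Var i n derivation_simps[OF derivation_derD'] simp del: of_nat_Suc)
  have 2: "derD n (derD' n (Var i)) = of_nat a * (of_nat (Suc b) * Var i :: 'a mpoly)"
    by (cases "a = 0") (auto simp: derD_Var derD'_Var i n derivation_simps[OF derivation_derD] simp del: of_nat_Suc)
  show ?thesis
    using True unfolding derH_def 1 2 by (simp add: i n algebra_simps)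
qed (auto simp: derH_def derD_Var derD'_Var derivation_simps[OF derivation_derD] derivation_simps[OF derivation_derD'])

lemma derH_derD: "derH n (derD n g) = derD n (derH n g) - 2 * derD n g"
proof -
  have "derH n (derD n g) - derD n (derH n g) = (- 2) * derD n g"
  proof (rule derivation_eqI[of "\<lambda>g. derH n (derD n g) - derD n (derH n g)" "\<lambda>g. (- 2) * derD n g"])
    show "derivation (\<lambda>g. derH n (derD n g) - derD n (derH n g))"
      by (intro derivation_commutator derivation_derD derivation_derH)
    show "derivation (\<lambda>g. (- 2) * derD n g)"
      by (intro derivation_smult derivation_derD)
    fix i
    consider "i \<notin> {1..n}" | "i = n" "i \<ge> 1" | "i \<in> {1..n}" "Suc i \<in> {1..n}" by force
    then show "derH n (derD n (Var i)) - derD n (derH n (Var i)) = (- 2) * derD n (Var i)"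
    proof cases
      case 3
      then show ?thesis
        by (simp add: derD_Var derH_Var derivation_simps[OF derivation_derH] derivation_simps[OF derivation_derD])
           (simp add: algebra_simps)
    qed (auto simp: derD_Var derH_Var derivation_simps[OF derivation_derH] derivation_simps[OF derivation_derD])
  qed
  then show ?thesis by (simp add: algebra_simps)
qed

lemma derH_derD': "derH n (derD' n g) = derD' n (derH n g) + 2 * derD' n g"
proof -
  have "derH n (derD' n g) - derD' n (derH n g) = 2 * derD' n g"
  proof (rule derivation_eqI[of "\<lambda>g. derH n (derD' n g) - derD' n (derH n g)" "\<lambda>g. 2 * derD' n g"])
    show "derivation (\<lambda>g. derH n (derD' n g) - derD' n (derH n g))"
      by (intro derivation_commutator derivation_derD' derivation_derH)
    show "derivation (\<lambda>g. 2 * derD' n g)"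
      by (intro derivation_smult derivation_derD')
    fix i
    consider "i \<notin> {1..n}" | "i = 1" "i \<le> n" | j where "i = Suc j" "j \<in> {1..n}" "i \<in> {1..n}" 
      by (cases i) force+
    then show "derH n (derD' n (Var i)) - derD' n (derH n (Var i)) = 2 * derD' n (Var i)"
    proof cases
      case 3
      then show ?thesis
        by (simp add: derD'_Var derH_Var derivation_simps[OF derivation_derH] derivation_simps[OF derivation_derD'])
           (simp add: algebra_simps)
    qed (auto simp: derD'_Var derH_Var derivation_simps[OF derivation_derH] derivation_simps[OF derivation_derD'])
  qed
  then show ?thesis by (simp add: algebra_simps)
qed

lemma of_int_mult_derivation: "derivation E \<Longrightarrow> E (of_int c * g) = of_int c * E g"
  by (simp add: derivation_mult derivation_of_int)

text \<open>The standard computation with a highest weight vector \<open>v\<close>. The scalar in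
  the second formula is the sum of the weights \<open>w\<close>, \<open>w - 2\<close>, ...,
  \<open>w - 2 k\<close>, picked up each time \<open>D'\<close> passes a \<open>D\<close>.\<close>

lemma highest_weight_funpow:
  assumes v: "derD' n v = 0" "derH n v = of_int w * v"
  shows "derH n ((derD n ^^ k) v) = of_int (w - 2 * int k) * (derD n ^^ k) v"
    and "derD' n ((derD n ^^ Suc k) v) = of_int (int (Suc k) * (w - int k)) * (derD n ^^ k) v"
proof -
  show H: "derH n ((derD n ^^ k) v) = of_int (w - 2 * int k) * (derD n ^^ k) v" for k
  proof (induction k)
    case (Suc k)
    then show ?case
      by (simp only: funpow.simps comp_apply derH_derD of_int_mult_derivation[OF derivation_derD])
         (simp add: algebra_simps)
  qed (use v in simp)
  have D': "derD' n (derD n g) = derH n g + derD n (derD' n g)" for g :: "'a mpoly"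
    by (simp add: derH_def)
  show "derD' n ((derD n ^^ Suc k) v) = of_int (int (Suc k) * (w - int k)) * (derD n ^^ k) v"
  proof (induction k)
    case 0
    then show ?case by (simp add: D' v derivation_0[OF derivation_derD])
  next
    case (Suc k)
    have "derD' n ((derD n ^^ Suc (Suc k)) v) = derD' n (derD n ((derD n ^^ Suc k) v))" by simp
    also have "\<dots> = derH n ((derD n ^^ Suc k) v) + derD n (derD' n ((derD n ^^ Suc k) v))"
      by (rule D')
    also have "\<dots> = of_int (w - 2 * int (Suc k)) * (derD n ^^ Suc k) v 
        + of_int (int (Suc k) * (w - int k)) * (derD n ^^ Suc k) v"
      unfolding H Suc.IH of_int_mult_derivation[OF derivation_derD] by simp
    also have "\<dots> = of_int (int (Suc (Suc k)) * (w - int (Suc k))) * (derD n ^^ Suc k) v"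
      unfolding distrib_right[symmetric] of_int_add[symmetric] by (simp add: algebra_simps)
    finally show ?case .
  qed
qed

text \<open>Local nilpotency of \<open>D\<close> takes the place of finite dimension: for negative
  \<open>w\<close> the scalar \<open>(k + 1) (w - k)\<close> never vanishes, so
  \<open>D^(k+1) v = 0\<close> implies \<open>D^k v = 0\<close>, down to
  \<open>k = 0\<close>.\<close>

lemma negative_highest_weight_eq_0:
  fixes v :: "'k::field_char_0 mpoly"
  assumes v: "derD' n v = 0" "derH n v = of_int w * v" and "w < 0"
  shows "v = 0"
proof -
  obtain N where "(derD n ^^ N) v = 0"
    using lnd_nilpotent[OF lnd_derD] by blast
  then show ?thesis
  proof (induction N)
    case (Suc k)
    have "of_int (int (Suc k) * (w - int k)) * (derD n ^^ k) v = 0"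
      using highest_weight_funpow(2)[OF v, of k] by (simp only: Suc.prems derivation_0[OF derivation_derD'])
    moreover have "(of_int (int (Suc k) * (w - int k)) :: 'k mpoly) \<noteq> 0"
      using \<open>w < 0\<close> by (simp only: of_int_eq_0_iff) simp
    ultimately show ?case
      using Suc.IH by simp
  qed simp
qed

text \<open>\<open>D^(w+1) v\<close> is again killed by \<open>D'\<close> and has weight
  \<open>-w - 2 < 0\<close>. Thus facts about \<open>D\<close> follow from \<open>D' v = 0\<close>
  and the weight alone.\<close>

lemma highest_weight_funpow_eq_0:
  fixes v :: "'k::field_char_0 mpoly"
  assumes v: "derD' n v = 0" "derH n v = of_nat w * v"
  shows "(derD n ^^ Suc w) v = 0"
proof (rule negative_highest_weight_eq_0)
  have v': "derH n v = of_int (int w) * v" using v by simp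
  show "derD' n ((derD n ^^ Suc w) v) = 0"
    using highest_weight_funpow(2)[OF v(1) v', of w] by simp
  show "derH n ((derD n ^^ Suc w) v) = of_int (int w - 2 * int (Suc w)) * (derD n ^^ Suc w) v"
    by (rule highest_weight_funpow(1)[OF v(1) v'])
qed simp

section \<open>The quadratic form \<open>f_odd\<close>\<close>

lemma f_odd_altdef:
  assumes "m \<ge> 1" "N = 2 * m - 2"
  shows "(f_odd m :: 'k::field_char_0 mpoly) = Const (1/2) * (\<Sum>a\<le>N. of_int ((- 1) ^ a * int (N choose a)) * (Var (Suc a) * Var (Suc (N - a))))"
proof -
  have "(f_odd m :: 'k mpoly) = Const (1/2) * (\<Sum>a\<le>N. Const ((-1) ^ a * of_nat (N choose a)) * Var (Suc a) * Var (2*m - Suc a))"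
    unfolding f_odd_def
    by (rule arg_cong[where f = "\<lambda>x. _ * x"], rule sum.reindex_bij_witness[of _ Suc "\<lambda>i. i - 1"])
       (use assms in auto)
  also have "\<dots> = Const (1/2) * (\<Sum>a\<le>N. of_int ((- 1) ^ a * int (N choose a)) * (Var (Suc a) * Var (Suc (N - a))))"
  proof (rule arg_cong[where f = "\<lambda>x. _ * x"], rule sum.cong)
    fix a assume "a \<in> {..N}"
    then have "2 * m - Suc a = Suc (N - a)" using assms by auto
    moreover have "Const ((-1) ^ a * of_nat (N choose a)) = (of_int ((- 1) ^ a * int (N choose a)) :: 'k mpoly)"
      using Const_of_int[of "(- 1) ^ a * int (N choose a)"] by simp
    ultimately show "Const ((-1) ^ a * of_nat (N choose a)) * Var (Suc a) * Var (2*m - Suc a) = 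
      (
        of_int ((- 1) ^ a * int (N choose a)) * (Var (Suc a) * Var (Suc (N - a))) :: 'k mpoly)"
      by (simp only: mult.assoc)
  qed simp
  finally show ?thesis .
qed

text \<open>This explains the alternating binomial coefficients: \<open>x_(a+1) x_(N-a)\<close>
  arises from the terms \<open>a\<close> and \<open>a + 1\<close> with factors \<open>N - a\<close>
  and \<open>a + 1\<close>, and the two contributions cancel. Larger \<open>n\<close> are allowed,
  since \<open>D'\<close> acts on \<open>x_i\<close> by a formula free of \<open>n\<close>; even
  dimension needs this.\<close>

lemma derD'_f_odd:
  assumes "m \<ge> 1" "2 * m - 1 \<le> n"
  shows "derD' n (f_odd m :: 'k::field_char_0 mpoly) = 0"
proof -
  define N where "N = 2 * m - 2"
  define c where "c a = (- 1) ^ a * int (N choose a)" for a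
  have c: "c (Suc a) * int (Suc a) + c a * int (N - a) = 0" for a
  proof -
    have "(N choose Suc a) * Suc a = (N choose a) * (N - a)"
      by (metis binomial_absorb_comp binomial_absorption mult.commute)
    then have "int (N choose Suc a) * int (Suc a) = int (N choose a) * int (N - a)"
      by (metis of_nat_mult)
    then show ?thesis by (simp add: c_def mult.assoc del: of_nat_Suc)
  qed
  let ?p = "\<lambda>a. Var (Suc a) * Var (N - a) :: 'k mpoly"
  have "derD' n (\<Sum>a\<le>N. of_int (c a) * (Var (Suc a) * Var (Suc (N - a)))) = 
      (\<Sum>a\<le>N. of_int (c a * int a) * (Var a * Var (Suc (N - a))) + of_int (c a * int (N - a)) * ?p a)"
    unfolding derivation_sum[OF derivation_derD']
    by (rule sum.cong) 
      (use assms in \<open>auto simp: N_def derivation_mult[OF derivation_derD'] derivation_of_int[OF derivation_derD'] derD'_Var algebra_simps\<close>)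
  also have "\<dots> = (\<Sum>a\<le>N. of_int (c a * int a) * (Var a * Var (Suc (N - a)))) + (\<Sum>a\<le>N. of_int (c a * int (N - a)) * ?p a)"
    by (rule sum.distrib)
  also have "(\<Sum>a\<le>N. of_int (c a * int a) * (Var a * Var (Suc (N - a)))) = 
      (\<Sum>a<N. of_int (c (Suc a) * int (Suc a)) * ?p a)"
    unfolding lessThan_Suc_atMost[symmetric] sum.lessThan_Suc_shift
    by (simp del: of_nat_Suc of_int_mult) (rule sum.cong, auto simp: Suc_diff_Suc)
  also have "(\<Sum>a\<le>N. of_int (c a * int (N - a)) * ?p a) = (\<Sum>a<N. of_int (c a * int (N - a)) * ?p a)"
    unfolding lessThan_Suc_atMost[symmetric] by simp
  also have "(\<Sum>a<N. of_int (c (Suc a) * int (Suc a)) * ?p a) + \<dots> = 0"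
    unfolding sum.distrib[symmetric] distrib_right[symmetric] of_int_add[symmetric] c by simp
  finally show ?thesis
    by (simp add: f_odd_altdef[OF assms(1) N_def] derivation_Const_mult[OF derivation_derD'] c_def)
qed

text \<open>The two indices in each monomial add up to \<open>2 m\<close>, so all monomials have the
  same weight \<open>2 (n + 1) - 4 m = 2 r\<close>. Odd dimension is the case \<open>r = 0\<close>,
  even dimension the case \<open>r = 1\<close>.\<close>

lemma derH_f_odd:
  assumes "m \<ge> 1" "n = 2 * m - 1 + r"
  shows "derH n (f_odd m :: 'k::field_char_0 mpoly) = of_nat (2 * r) * f_odd m"
proof -
  define N where "N = 2 * m - 2"
  define c where "c a = (- 1) ^ a * int (N choose a)" for a
  let ?p = "\<lambda>a. Var (Suc a) * Var (Suc (N - a)) :: 'k mpoly"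
  have p: "derH n (?p a) = of_nat (2 * r) * ?p a" if "a \<le> N" for a
  proof -
    have "derH n (?p a) = of_int ((int n + 1 - 2 * int (Suc a)) + (int n + 1 - 2 * int (Suc (N - a)))) * ?p a"
    proof -
      have "Suc a \<in> {1..n}" "Suc (N - a) \<in> {1..n}"
        using that assms by (auto simp: N_def)
      then show ?thesis
        by (simp only: derivation_mult[OF derivation_derH] derH_Var if_True) (simp add: algebra_simps)
    qed
    also have "(int n + 1 - 2 * int (Suc a)) + (int n + 1 - 2 * int (Suc (N - a))) = int (2 * r)"
      using that assms by (simp add: N_def algebra_simps)
    finally show ?thesis by simp
  qed
  have "derH n (\<Sum>a\<le>N. of_int (c a) * ?p a) =
      (\<Sum>a\<le>N. of_int (c a) * (of_nat (2 * r) * ?p a))"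
    unfolding derivation_sum[OF derivation_derH]
    by (rule sum.cong) (use p in \<open>auto simp: of_int_mult_derivation[OF derivation_derH]\<close>)
  also have "\<dots> = of_nat (2 * r) * (\<Sum>a\<le>N. of_int (c a) * ?p a)"
    by (simp add: sum_distrib_left algebra_simps)
  finally show ?thesis
    by (simp add: f_odd_altdef[OF assms(1) N_def] derivation_Const_mult[OF derivation_derH] c_def algebra_simps)
qed

text \<open>The first and the last term coincide, with equal signs because \<open>N\<close> is even,
  which absorbs the factor 1/2. No other term contains \<open>x_1\<close>, so the form is linear in
  \<open>x_1\<close>.\<close>

lemma f_odd_split:
  assumes "m \<ge> 2"
  shows "\<exists>r \<in> polys_in {2..2*m-2}. (f_odd m :: 'k::field_char_0 mpoly) = Var 1 * Var (2 * m - 1) + r"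
proof -
  define M where "M = 2 * m - 4"
  define c where "c a = (- 1) ^ a * int (M + 2 choose a)" for a
  let ?p = "\<lambda>a. Var (Suc a) * Var (Suc (M + 2 - a)) :: 'k mpoly"
  define r where "r = Const (1/2) * (\<Sum>a\<le>M. of_int (c (Suc a)) * ?p (Suc a))"
  have N: "M + 2 = 2 * m - 2" and e: "even M" using assms by (auto simp: M_def)
  have "{..M + 2} = {..Suc (Suc M)}" by simp
  moreover have "(f_odd m :: 'k mpoly) = Const (1/2) * (\<Sum>a\<le>M + 2. of_int (c a) * ?p a)"
    unfolding c_def using assms N by (intro f_odd_altdef) auto
  ultimately have "(f_odd m :: 'k mpoly) = Const (1/2) * (\<Sum>a\<le>Suc (Suc M). of_int (c a) * ?p a)"
    by (simp only:)
  also have "(\<Sum>a\<le>Suc (Suc M). of_int (c a) * ?p a) = 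
      2 * (Var 1 * Var (2 * m - 1)) + (\<Sum>a\<le>M. of_int (c (Suc a)) * ?p (Suc a))"
  proof -
    have "2 * m - 1 = Suc (Suc (Suc M))" using N by simp
    then show ?thesis
      using e by (subst sum.atMost_Suc, subst sum.atMost_Suc_shift) (simp add: c_def)
  qed
  also have "Const (1/2) * \<dots> = Const (1/2) * 2 * (Var 1 * Var (2 * m - 1)) + r"
    by (simp add: r_def algebra_simps)
  also have "Const (1/2) * 2 = (Const ((1/2) * 2) :: 'k mpoly)"
    by (simp only: Const_mult Const_numeral)
  finally have "(f_odd m :: 'k mpoly) = Var 1 * Var (2 * m - 1) + r" by simp
  moreover have "r \<in> polys_in {2..2*m-2}"
  proof -
    have "of_int z \<in> polys_in {2..2*m-2}" for z
      using polys_in_Const[of "of_int z"] by simp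
    then show ?thesis
      unfolding r_def by (intro polys_in_mult polys_in_sum polys_in_Const polys_in_Var) (use N in auto)
  qed
  ultimately show ?thesis by blast
qed

lemma derD_polys_in: "g \<in> polys_in {1..n} \<Longrightarrow> derD n g \<in> polys_in {1..n}"
proof (rule derivation_polys_in[OF derivation_derD])
  fix i assume "i \<in> {1..n}"
  then show "derD n (Var i) \<in> polys_in {1..n}"
    by (cases "i = n") (auto simp: derD_Var simp del: of_nat_diff intro!: polys_in_mult)
qed

text \<open>No \<open>D(x_i)\<close> contains \<open>x_1\<close>, since \<open>D\<close> raises
  indices.\<close>

lemma shear_Const_derD:
  "shear 1 (Const b) (derD n g) = derD n (shear 1 (Const b) g)"
  by (rule derivation_eqI_twisted[OF alghom_shear derivation_derD derivation_derD])
     (auto simp: derD_Var shear_Var alghom_simps[OF alghom_shear] derivation_simps[OF derivation_derD])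

lemma f_odd_polys_in:
  assumes "m \<ge> 2" "2 * m - 1 \<le> n"
  shows "(f_odd m :: 'k::field_char_0 mpoly) \<in> polys_in {1..n}"
proof -
  obtain r where "r \<in> polys_in {2..2*m-2}" and r: "(f_odd m :: 'k mpoly) = Var 1 * Var (2 * m - 1) + r"
    using f_odd_split[OF assms(1)] by blast
  then have "r \<in> polys_in {1..n}" 
    using assms by (elim polys_in_mono[rotated]) auto
  then show ?thesis
    unfolding r using assms by (auto intro!: polys_in_add polys_in_mult)
qed

lemma shear_f_odd:
  assumes "m \<ge> 2"
  shows "shear 1 (Const b) (f_odd m :: 'k::field_char_0 mpoly) = f_odd m + Const b * Var (2 * m - 1)"
proof -
  obtain r where "r \<in> polys_in {2..2*m-2}" and r: "(f_odd m :: 'k mpoly) = Var 1 * Var (2 * m - 1) + r"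
    using f_odd_split[OF assms] by blast
  then have "shear 1 (Const b) r = r" by (auto intro: shear_fixes)
  then show ?thesis
    using assms by (simp add: r alghom_simps[OF alghom_shear] shear_Var algebra_simps)
qed

text \<open>For even \<open>n\<close>, \<open>f_odd\<close> is a highest weight vector of weight 2 for the \<open>sl\<^sub>2\<close>-action on \<open>k[x\<^sub>1,\<dots>,x\<^sub>n]\<close>,
  and \<open>f_n\<close> is the discriminant of the quadratic form attached to the 3-dimensional submodule it generates.\<close>

lemma f_n_invariant:
  fixes n :: nat
  assumes "n \<ge> 3"
  defines "f \<equiv> f_n n :: 'k::field_char_0 mpoly"
  shows "derD n f = 0" "derD' n f = 0" "f \<in> polys_in {1..n}"
    and "\<exists>(P :: 'k mpoly poly) e. e \<ge> 1 \<and> degree P \<le> e \<and> coeff P e = Var n ^ e \<and>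
      (\<forall>b. shear 1 (Const b) f = poly P (Const b))"
proof -
  have "derD n f = 0 \<and> derD' n f = 0 \<and> f \<in> polys_in {1..n} \<and>
    (\<exists>(P :: 'k mpoly poly) e. e \<ge> 1 \<and> degree P \<le> e \<and> coeff P e = Var n ^ e \<and>
      (\<forall>b. shear 1 (Const b) f = poly P (Const b)))"
  proof (cases "odd n")
    case True
    define m where "m = (n + 1) div 2"
    have m: "n = 2 * m - 1" "m \<ge> 2" using True assms by (auto simp: m_def)
    have f: "f = f_odd m" using True by (simp add: f_def f_n_def m_def)
    have D': "derD' n f = 0" unfolding f using m by (intro derD'_f_odd) auto
    have H: "derH n f = of_nat 0 * f" unfolding f using derH_f_odd[of m n 0] m by simp
    have D: "derD n f = 0" using highest_weight_funpow_eq_0[OF D' H] by simp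
    have P: "shear 1 (Const b) f = poly [:f, Var n:] (Const b)" for b
      using shear_f_odd[OF m(2), of b] m by (simp add: f)
    have "\<exists>(P :: 'k mpoly poly) e. e \<ge> 1 \<and> degree P \<le> e \<and> coeff P e = Var n ^ e \<and>
      (\<forall>b. shear 1 (Const b) f = poly P (Const b))"
      by (rule exI[of _ "[:f, Var n:]"], rule exI[of _ 1]) (use P in auto)
    moreover have "f \<in> polys_in {1..n}" unfolding f using m by (intro f_odd_polys_in) auto
    ultimately show ?thesis using D D' by blast
  next
    case False
    define m where "m = n div 2"
    have m: "n = 2 * m" "m \<ge> 2" using False assms by (auto simp: m_def)
    define g where "g = (f_odd m :: 'k mpoly)"
    let ?D = "derD n :: 'k mpoly \<Rightarrow> 'k mpoly"
    have f: "f = ?D g ^ 2 - 2 * ?D (?D g) * g" 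
      using False by (simp add: f_def f_n_def m_def g_def Let_def)
    have D'g: "derD' n g = 0" unfolding g_def using m by (intro derD'_f_odd) auto
    have Hg: "derH n g = of_nat 2 * g" unfolding g_def using derH_f_odd[of m n 1] m by simp
    have D3: "?D (?D (?D g)) = 0" 
      using highest_weight_funpow_eq_0[OF D'g Hg] by (simp add: numeral_2_eq_2)
    have D: "?D f = 0"
      by (simp add: f derivation_simps[OF derivation_derD] power2_eq_square D3 algebra_simps)
    have Hg': "derH n g = of_int 2 * g" using Hg by simp
    have D'D: "derD' n (?D g) = 2 * g" 
      using highest_weight_funpow(2)[OF D'g Hg', of 0] by simp
    have D'D2: "derD' n (?D (?D g)) = 2 * ?D g" 
      using highest_weight_funpow(2)[OF D'g Hg', of 1] by simp
    have D': "derD' n f = 0"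
      by (simp add: f derivation_simps[OF derivation_derD'] power2_eq_square D'g D'D D'D2 algebra_simps)
    have "g \<in> polys_in {1..n}" unfolding g_def using m by (intro f_odd_polys_in) auto
    then have pf: "f \<in> polys_in {1..n}"
      unfolding f by (intro polys_in_diff polys_in_power polys_in_mult derD_polys_in polys_in_numeral)
    \<comment> \<open>Translation sends \<open>g\<close>, \<open>D g\<close>, \<open>D (D g)\<close>
      to \<open>g + b x_(n-1)\<close>, \<open>D g + b x_n\<close>, \<open>D (D g)\<close>; expanding
      the discriminant in \<open>b\<close> gives these coefficients, with top coefficient
      \<open>x_n^2\<close>.\<close>
    let ?P = "[:f, 2 * Var n * ?D g - 2 * ?D (?D g) * Var (n - 1), Var n ^ 2:]"
    have "shear 1 (Const b) f = poly ?P (Const b)" for b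
    proof -
      let ?\<tau> = "shear 1 (Const b) :: 'k mpoly \<Rightarrow> 'k mpoly"
      have tg: "?\<tau> g = g + Const b * Var (n - 1)"
        using shear_f_odd[OF m(2), of b] m by (simp add: g_def)
      have "?D (Var (n - 1)) = Var n"
        using assms by (simp add: derD_Var)
      then have tDg: "?\<tau> (?D g) = ?D g + Const b * Var n"
        unfolding shear_Const_derD tg by (simp add: derivation_simps[OF derivation_derD])
      have "?D (Var n) = 0"
        by (simp add: derD_Var)
      then have tD2g: "?\<tau> (?D (?D g)) = ?D (?D g)"
        unfolding shear_Const_derD[of b n "?D g"] tDg by (simp add: derivation_simps[OF derivation_derD])
      show ?thesis
        unfolding f by (simp add: alghom_simps[OF alghom_shear] tg tDg tD2g del: One_nat_def)
          (simp add: power2_eq_square algebra_simps)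
    qed
    then have "\<exists>(P :: 'k mpoly poly) e. e \<ge> 1 \<and> degree P \<le> e \<and> coeff P e = Var n ^ e \<and>
      (\<forall>b. shear 1 (Const b) f = poly P (Const b))"
      by (intro exI[of _ ?P] exI[of _ 2]) (auto simp: numeral_2_eq_2)
    then show ?thesis using D D' pf by blast
  qed
  then show "derD n f = 0" "derD' n f = 0" "f \<in> polys_in {1..n}"
    and "\<exists>(P :: 'k mpoly poly) e. e \<ge> 1 \<and> degree P \<le> e \<and> coeff P e = Var n ^ e \<and>
      (\<forall>b. shear 1 (Const b) f = poly P (Const b))" by blast+
qed

section \<open>Subgroups containing the affine group\<close>

lemma diff_closed_of_nat_mult:
  fixes V :: "'a::comm_ring_1 set"
  assumes "\<And>p q. p \<in> V \<Longrightarrow> q \<in> V \<Longrightarrow> p - q \<in> V" "p \<in> V"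
  shows "of_nat k * p \<in> V"
proof (induction k)
  case 0
  then show ?case using assms(1)[OF assms(2,2)] by simp
next
  case (Suc k)
  \<comment> \<open>\<open>p - p - p\<close> is \<open>- p\<close>, so subtracting it adds
    \<open>p\<close>.\<close>
  have "of_nat k * p - (p - p - p) \<in> V"
    by (intro assms(1) Suc.IH assms(2))
  then show ?case by (simp add: algebra_simps)
qed

text \<open>Passing from \<open>P b\<close> to \<open>P (2 b) - 2^i P b\<close> removes the coefficient of \<open>b^i\<close> and multiplies the
  other ones by nonzero integers.\<close>

lemma coefficient_multiple_mem:
  fixes V :: "'a::comm_ring_1 set"
  assumes V: "\<And>p q. p \<in> V \<Longrightarrow> q \<in> V \<Longrightarrow> p - q \<in> V"
    and "finite J" "j \<notin> J" "\<And>b. (\<Sum>i\<in>insert j J. of_nat b ^ i * p i) \<in> V"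
  shows "\<exists>K::int. K \<noteq> 0 \<and> of_int K * p j \<in> V"
  using assms(2-)
proof (induction J arbitrary: p rule: finite_induct)
  case empty
  have "p j \<in> V" using empty.prems(2)[of 1] by simp
  then show ?case by (intro exI[of _ 1]) simp
next
  case (insert i J)
  have "(\<Sum>i'\<in>insert j J. of_nat b ^ i' * (of_int (2 ^ i' - 2 ^ i) * p i')) \<in> V" for b
  proof -
    let ?P = "\<lambda>b. \<Sum>i'\<in>insert j (insert i J). of_nat b ^ i' * p i'"
    have "?P (2 * b) - of_nat (2 ^ i) * ?P b \<in> V"
      by (intro V diff_closed_of_nat_mult insert.prems)
    also have "?P (2 * b) - of_nat (2 ^ i) * ?P b =
        (\<Sum>i'\<in>insert j (insert i J). of_nat b ^ i' * (of_int (2 ^ i' - 2 ^ i) * p i'))"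
      unfolding sum_distrib_left sum_subtractf[symmetric]
      by (rule sum.cong) (simp_all add: power_mult_distrib algebra_simps)
    also have "insert j (insert i J) = insert i (insert j J)" by auto
    also have "(\<Sum>i'\<in>\<dots>. of_nat b ^ i' * (of_int (2 ^ i' - 2 ^ i) * p i')) =
        (\<Sum>i'\<in>insert j J. of_nat b ^ i' * (of_int (2 ^ i' - 2 ^ i) * p i'))"
      using insert by (subst sum.insert) auto
    finally show ?thesis .
  qed
  with insert.IH[of "\<lambda>i'. of_int (2 ^ i' - 2 ^ i) * p i'"] insert.prems(1)
  obtain K :: int where "K \<noteq> 0" "of_int K * (of_int (2 ^ j - 2 ^ i) * p j) \<in> V" by auto
  moreover have "(2 ^ j - 2 ^ i :: int) \<noteq> 0"
    using insert.prems(1) by auto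
  ultimately show ?case
    by (intro exI[of _ "K * (2 ^ j - 2 ^ i)"]) (simp add: mult.assoc)
qed

text \<open>Inverting a Vandermonde matrix would need \<open>V\<close> to be a vector space; for an
  additive group a nonzero integer factor remains.\<close>

lemma coeff_multiple_mem:
  fixes V :: "'a::comm_ring_1 set"
  assumes V: "\<And>p q. p \<in> V \<Longrightarrow> q \<in> V \<Longrightarrow> p - q \<in> V" and P: "\<And>b. poly P (of_nat b) \<in> V"
  shows "\<exists>K::int. K \<noteq> 0 \<and> of_int K * coeff P j \<in> V"
proof (cases "j \<le> degree P")
  case True
  then have I: "{..degree P} = insert j ({..degree P} - {j})" by auto
  show ?thesis
  proof (rule coefficient_multiple_mem[OF V])
    fix b
    show "(\<Sum>i\<in>insert j ({..degree P} - {j}). of_nat b ^ i * coeff P i) \<in> V"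
      using P[of b] unfolding poly_altdef I[symmetric] by (simp add: mult.commute)
  qed auto
next
  case False
  then show ?thesis
    using V[OF P P, of 0 0] by (intro exI[of _ 1]) (simp add: coeff_eq_0)
qed

section \<open>Affine forms, affine maps and composition of shears\<close>

definition affine_forms :: "nat \<Rightarrow> 'k::comm_ring_1 mpoly set" where
  "affine_forms n = {p. \<exists>a b. p = (\<Sum>j\<in>{1..n}. Const (a j) * Var j) + Const b}"

lemma affine_forms_Var: 
  assumes "i \<in> {1..n}" shows "(Var i :: 'k::comm_ring_1 mpoly) \<in> affine_forms n"
proof -
  have "(\<Sum>j\<in>{1..n}. Const (if j = i then 1 else 0) * Var j) = (\<Sum>j\<in>{1..n}. if j = i then Var i else 0 :: 'k mpoly)"
    by (rule sum.cong) auto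
  also have "\<dots> = Var i" using assms by simp
  finally have "(Var i :: 'k mpoly) = (\<Sum>j\<in>{1..n}. Const (if j = i then 1 else 0) * Var j) + Const 0"
    by simp
  then show ?thesis
    unfolding affine_forms_def mem_Collect_eq by (intro exI)
qed

lemma affine_forms_Const: "Const b \<in> affine_forms n"
  unfolding affine_forms_def by (auto intro!: exI[of _ "\<lambda>_. 0"])

lemma affine_forms_add: "p \<in> affine_forms n \<Longrightarrow> q \<in> affine_forms n \<Longrightarrow> p + q \<in> affine_forms n"
proof -
  assume "p \<in> affine_forms n" "q \<in> affine_forms n"
  then obtain a b a' b' where p: "p = (\<Sum>j\<in>{1..n}. Const (a j) * Var j) + Const b" 
    and q: "q = (\<Sum>j\<in>{1..n}. Const (a' j) * Var j) + Const b'"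
    unfolding affine_forms_def by auto
  have "p + q = (\<Sum>j\<in>{1..n}. Const (a j + a' j) * Var j) + Const (b + b')"
    unfolding p q by (simp add: Const_add sum.distrib algebra_simps)
  then show ?thesis
    unfolding affine_forms_def mem_Collect_eq by (intro exI)
qed

lemma affine_forms_Const_mult: "p \<in> affine_forms n \<Longrightarrow> Const c * p \<in> affine_forms n"
proof -
  assume "p \<in> affine_forms n"
  then obtain a b where p: "p = (\<Sum>j\<in>{1..n}. Const (a j) * Var j) + Const b" 
    unfolding affine_forms_def by auto
  have "Const c * p = (\<Sum>j\<in>{1..n}. Const (c * a j) * Var j) + Const (c * b)"
    unfolding p by (simp add: Const_mult sum_distrib_left algebra_simps)
  then show ?thesis
    unfolding affine_forms_def mem_Collect_eq by (intro exI)
qed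

lemma affine_forms_uminus: "p \<in> affine_forms n \<Longrightarrow> - p \<in> affine_forms n"
  using affine_forms_Const_mult[of p n "- 1"] by (simp add: Const_uminus)

lemma affine_forms_sum: "(\<And>i. i \<in> A \<Longrightarrow> g i \<in> affine_forms n) \<Longrightarrow> (\<Sum>i\<in>A. g i) \<in> affine_forms n"
  by (induction A rule: infinite_finite_induct) (use affine_forms_Const[of 0 n] in \<open>auto intro: affine_forms_add\<close>)

definition affine_map :: "nat \<Rightarrow> ('k::comm_ring_1 mpoly \<Rightarrow> 'k mpoly) \<Rightarrow> bool" where
  "affine_map n \<Phi> \<longleftrightarrow> alghom \<Phi> \<and> (\<forall>i. \<Phi> (Var i) \<in> (if i \<in> {1..n} then affine_forms n else {Var i}))"

lemma affine_mapI:
  assumes "alghom \<Phi>" "\<And>i. i \<in> {1..n} \<Longrightarrow> \<Phi> (Var i) \<in> affine_forms n" "\<And>i. i \<notin> {1..n} \<Longrightarrow> \<Phi> (Var i) = Var i"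
  shows "affine_map n \<Phi>"
  unfolding affine_map_def using assms by simp

lemma alghom_comp3: "alghom \<Phi> \<Longrightarrow> alghom \<Psi> \<Longrightarrow> alghom \<Theta> \<Longrightarrow> alghom (\<lambda>p. \<Phi> (\<Psi> (\<Theta> p)))"
  by (simp add: alghom_def)

lemma shear_shear:
  assumes "q \<in> polys_in I" "j \<notin> I"
  shows "shear j p (shear j q g) = shear j (p + q) g"
  by (rule alghom_eqI[OF alghom_comp[OF alghom_shear alghom_shear] alghom_shear])
     (auto simp: shear_Var alghom_simps[OF alghom_shear] shear_fixes[OF assms])

lemma shear_0: "shear j 0 = (\<lambda>p. p)"
  by (rule ext, rule alghom_eqI) (auto intro: alghom_id alghom_shear simp: shear_Var)

text \<open>Models the subgroup generated by \<open>\<phi>\<close> and the affine maps, as maps on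
  the ring. Right inverses are enough in \<open>inv_mem\<close> and \<open>affine_mem\<close>: in a
  group they are the inverses, and a square matrix with a right inverse is invertible.\<close>

locale affine_overgroup =
  fixes n :: nat and S :: "('k::field_char_0 mpoly \<Rightarrow> 'k mpoly) set"
  assumes n_ge_3: "n \<ge> 3"
    and alghom: "\<Phi> \<in> S \<Longrightarrow> alghom \<Phi>"
    and comp_mem: "\<Phi> \<in> S \<Longrightarrow> \<Psi> \<in> S \<Longrightarrow> (\<lambda>p. \<Phi> (\<Psi> p)) \<in> S"
    and inv_mem: "\<Phi> \<in> S \<Longrightarrow> alghom \<Psi> \<Longrightarrow> (\<And>p. \<Phi> (\<Psi> p) = p) \<Longrightarrow> \<Psi> \<in> S"
    and affine_mem: "affine_map n \<Phi> \<Longrightarrow> affine_map n \<Psi> \<Longrightarrow> (\<And>p. \<Phi> (\<Psi> p) = p) \<Longrightarrow> \<Phi> \<in> S"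
begin

lemma comp_mem3: "\<Phi> \<in> S \<Longrightarrow> \<Psi> \<in> S \<Longrightarrow> \<Theta> \<in> S \<Longrightarrow> (\<lambda>p. \<Phi> (\<Psi> (\<Theta> p))) \<in> S"
  using comp_mem[of \<Phi> "\<lambda>p. \<Psi> (\<Theta> p)"] comp_mem[of \<Psi> \<Theta>] by simp

text \<open>Since these polynomials are free of \<open>x_j\<close>, composing shears of
  \<open>x_j\<close> adds them; the set is to become as large as possible.\<close>

definition shears :: "nat \<Rightarrow> 'k mpoly set" where
  "shears j = {p \<in> polys_in ({1..n} - {j}). shear j p \<in> S}"

lemma shearsD: "p \<in> shears j \<Longrightarrow> p \<in> polys_in ({1..n} - {j})" "p \<in> shears j \<Longrightarrow> shear j p \<in> S"
  by (simp_all add: shears_def)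

lemma shears_affine:
  assumes "p \<in> affine_forms n" "p \<in> polys_in ({1..n} - {j})" "j \<in> {1..n}"
  shows "p \<in> shears j"
proof -
  have af: "affine_map n (shear j p)" if "p \<in> affine_forms n" for p
    using affine_forms_add[OF affine_forms_Var[OF assms(3)] that] assms(3)
    by (intro affine_mapI alghom_shear) (auto simp: shear_Var affine_forms_Var)
  have inv: "shear j p (shear j (- p) g) = g" for g
    using shear_shear[OF polys_in_uminus[OF assms(2)], of j p g] by (simp add: shear_0)
  have "shear j p \<in> S"
    by (rule affine_mem[OF af[OF assms(1)] af[OF affine_forms_uminus[OF assms(1)]] inv])
  then show ?thesis using assms by (simp add: shears_def)
qed

lemma shears_add: "p \<in> shears j \<Longrightarrow> q \<in> shears j \<Longrightarrow> p + q \<in> shears j"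
proof -
  assume p: "p \<in> shears j" and q: "q \<in> shears j"
  have "shear j (p + q) = (\<lambda>g. shear j p (shear j q g))"
    using shear_shear[OF shearsD(1)[OF q], of j p] by auto
  also have "\<dots> \<in> S"
    by (rule comp_mem[OF shearsD(2)[OF p] shearsD(2)[OF q]])
  finally show ?thesis
    using shearsD(1)[OF p] shearsD(1)[OF q] by (simp add: shears_def polys_in_add)
qed

lemma shears_uminus: 
  assumes "p \<in> shears j" shows "- p \<in> shears j"
proof -
  have "shear j p (shear j (- p) g) = g" for g
    using shear_shear[OF polys_in_uminus[OF shearsD(1)[OF assms]], of j p g] by (simp add: shear_0)
  then have "shear j (- p) \<in> S"
    by (rule inv_mem[OF shearsD(2)[OF assms] alghom_shear])
  then show ?thesis
    using assms by (simp add: shears_def polys_in_uminus)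
qed

lemma shears_diff: "p \<in> shears j \<Longrightarrow> q \<in> shears j \<Longrightarrow> p - q \<in> shears j"
  using shears_add[of p j "- q"] shears_uminus[of q j] by simp

lemma scale_mem:
  assumes "c \<noteq> 0" "j \<in> {1..n}"
  shows "subst (Var(j := Const c * Var j)) \<in> S"
proof -
  let ?s = "\<lambda>c. subst (Var(j := Const c * Var j))"
  have af: "affine_map n (?s c)" for c
    using assms(2) by (intro affine_mapI alghom_subst) (auto simp: affine_forms_Const_mult affine_forms_Var)
  have "?s c (?s (1 / c) g) = g" for g
  proof (rule alghom_eqI[OF alghom_comp[OF alghom_subst alghom_subst] alghom_id])
    fix i
    show "?s c (?s (1 / c) (Var i)) = Var i"
      using assms(1) by (auto simp: alghom_simps[OF alghom_subst] mult.assoc[symmetric] simp flip: Const_mult)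
  qed
  then show ?thesis by (rule affine_mem[OF af af])
qed

text \<open>Conjugation by the dilation \<open>x_j \<mapsto> c x_j\<close> scales \<open>p\<close>,
  because \<open>p\<close> is free of \<open>x_j\<close>. This makes \<open>shears j\<close> a
  vector space, so integer factors can be divided out.\<close>

lemma shears_Const_mult:
  assumes p: "p \<in> shears j" and j: "j \<in> {1..n}"
  shows "Const c * p \<in> shears j"
proof (cases "c = 0")
  case True
  have "Const 0 \<in> shears j" using j by (intro shears_affine affine_forms_Const polys_in_Const)
  then show ?thesis using True by simp
next
  case False
  let ?s = "\<lambda>c. subst (Var(j := Const c * Var j))"
  have fx: "?s c p = p" for c
    using shearsD(1)[OF p] by (rule alghom_fixes[OF alghom_subst, rotated]) auto
  have "shear j (Const c * p) g = ?s (1 / c) (shear j p (?s c g))" for g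
  proof (rule alghom_eqI[OF alghom_shear alghom_comp3[OF alghom_subst alghom_shear alghom_subst]])
    fix i
    have "Const c * (Const (1 / c) * Var j) = (Var j :: 'k mpoly)"
      using False by (simp add: mult.assoc[symmetric] flip: Const_mult)
    then show "shear j (Const c * p) (Var i) = ?s (1 / c) (shear j p (?s c (Var i)))"
      by (auto simp: shear_Var alghom_simps[OF alghom_shear] alghom_simps[OF alghom_subst] fx distrib_left)
  qed
  then have "shear j (Const c * p) = (\<lambda>g. ?s (1 / c) (shear j p (?s c g)))" ..
  also have "\<dots> \<in> S"
    using False j by (intro comp_mem3[OF scale_mem shearsD(2)[OF p] scale_mem]) auto
  finally show ?thesis
    using shearsD(1)[OF p] by (simp add: shears_def polys_in_mult)
qed

lemma shears_of_int_mult_cancel: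
  assumes "of_int K * p \<in> shears j" "K \<noteq> 0" "j \<in> {1..n}"
  shows "p \<in> shears j"
proof -
  have "Const (1 / of_int K) * of_int K = (Const (1 / of_int K * of_int K) :: 'k mpoly)"
    by (simp only: Const_mult Const_of_int)
  then have "Const (1 / of_int K) * (of_int K * p) = p"
    using assms(2) by (simp add: mult.assoc[symmetric])
  then show ?thesis
    using shears_Const_mult[OF assms(1,3), of "1 / of_int K"] by (simp only:)
qed

lemma shears_coeff:
  assumes "\<And>b. poly P (of_nat b) \<in> shears j" "j \<in> {1..n}"
  shows "coeff P i \<in> shears j"
  using coeff_multiple_mem[OF shears_diff assms(1)] shears_of_int_mult_cancel[OF _ _ assms(2)] by blast

text \<open>Polarisation: \<open>d choose i\<close> times the claimed product is the coefficient of
  the \<open>i\<close>-th power of the parameter, and the binomial is nonzero.\<close>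

lemma shears_linear_power_coeff:
  assumes "\<And>b. (x + of_nat b * y) ^ d \<in> shears j" "j \<in> {1..n}" "i \<le> d"
  shows "y ^ i * x ^ (d - i) \<in> shears j"
proof -
  have "coeff ([:x, y:] ^ d) i \<in> shears j"
    using assms(1,2) by (intro shears_coeff) (simp_all add: poly_power)
  then have "of_int (int (d choose i)) * (y ^ i * x ^ (d - i)) \<in> shears j"
    using assms(3) by (simp add: coeff_linear_poly_power mult.assoc)
  then show ?thesis
    by (rule shears_of_int_mult_cancel) (use assms in auto)
qed

text \<open>Conjugation by the shear of \<open>x_c\<close> acts on the added polynomial by
  substitution. That \<open>q\<close> avoids \<open>x_j\<close> keeps it fixed under the shear of
  \<open>x_j\<close>; that it avoids \<open>x_c\<close> makes \<open>- q\<close> give the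
  inverse.\<close>

lemma shears_conj:
  assumes S: "shear c q \<in> S" and q: "q \<in> polys_in ({1..n} - {j, c})" and c: "c \<in> {1..n}" "c \<noteq> j"
    and p: "p \<in> shears j"
  shows "shear c q p \<in> shears j"
proof -
  have qc: "q \<in> polys_in ({1..n} - {c})"
    using q by (rule polys_in_mono[rotated]) auto
  then have qs: "q \<in> shears c" using S by (simp add: shears_def)
  have fj: "shear j p' q = q" "shear j p' (- q) = - q" for p'
    using shear_fixes[OF q] shear_fixes[OF polys_in_uminus[OF q]] by auto
  have fc: "shear c q' q = q" "shear c q' (- q) = - q" for q'
    using shear_fixes[OF q] shear_fixes[OF polys_in_uminus[OF q]] by auto
  have "shear j (shear c q p) g = shear c q (shear j p (shear c (- q) g))" for g
  proof (rule alghom_eqI[OF alghom_shear alghom_comp3[OF alghom_shear alghom_shear alghom_shear]])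
    fix i
    show "shear j (shear c q p) (Var i) = shear c q (shear j p (shear c (- q) (Var i)))"
      using c by (auto simp: shear_Var alghom_simps[OF alghom_shear] fj fc)
  qed
  then have "shear j (shear c q p) = (\<lambda>g. shear c q (shear j p (shear c (- q) g)))" ..
  also have "\<dots> \<in> S"
    by (rule comp_mem3[OF S shearsD(2)[OF p] shearsD(2)[OF shears_uminus[OF qs]]])
  finally have "shear j (shear c q p) \<in> S" .
  moreover have "shear c q p \<in> polys_in ({1..n} - {j})"
  proof (rule alghom_polys_in[OF alghom_shear _ shearsD(1)[OF p]])
    have "q \<in> polys_in ({1..n} - {j})"
      using q by (rule polys_in_mono[rotated]) auto
    then show "shear c q (Var i) \<in> polys_in ({1..n} - {j})" if "i \<in> {1..n} - {j}" for i
      using that by (auto simp: shear_Var intro!: polys_in_add)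
  qed
  ultimately show ?thesis by (simp add: shears_def)
qed

text \<open>Transpositions of variables are affine, and conjugation by one relabels both the target
  and the added polynomial.\<close>

lemma shears_transpose:
  assumes ab: "a \<in> {1..n}" "b \<in> {1..n}" and p: "p \<in> shears j" and j: "j \<in> {1..n}"
  defines "\<sigma> \<equiv> \<lambda>i. if i = a then b else if i = b then a else i"
  shows "subst (\<lambda>i. Var (\<sigma> i)) p \<in> shears (\<sigma> j)"
proof -
  let ?s = "subst (\<lambda>i. Var (\<sigma> i) :: 'k mpoly)"
  have \<sigma>: "\<sigma> (\<sigma> i) = i" "\<sigma> i \<in> {1..n} \<longleftrightarrow> i \<in> {1..n}" for i
    using ab by (auto simp: \<sigma>_def)
  then have inj: "\<sigma> i = \<sigma> i' \<longleftrightarrow> i = i'" for i i' by metis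
  have s: "?s (?s g) = g" for g
    by (rule alghom_eqI[OF alghom_comp[OF alghom_subst alghom_subst] alghom_id]) (simp add: \<sigma>)
  have af: "affine_map n ?s"
  proof (rule affine_mapI[OF alghom_subst])
    fix i assume "i \<in> {1..n}"
    then have "\<sigma> i \<in> {1..n}" using \<sigma>(2) by blast
    then show "?s (Var i) \<in> affine_forms n" by (simp only: subst_Var affine_forms_Var)
  next
    fix i assume "i \<notin> {1..n}"
    then have "\<sigma> i = i" using ab by (auto simp: \<sigma>_def)
    then show "?s (Var i) = Var i" by simp
  qed
  have sS: "?s \<in> S" by (rule affine_mem[OF af af s])
  have "shear (\<sigma> j) (?s p) g = ?s (shear j p (?s g))" for g
  proof (rule alghom_eqI[OF alghom_shear alghom_comp3[OF alghom_subst alghom_shear alghom_subst]])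
    fix i
    show "shear (\<sigma> j) (?s p) (Var i) = ?s (shear j p (?s (Var i)))"
      using \<sigma>(1)[of i] by (auto simp: shear_Var alghom_simps[OF alghom_subst] \<sigma>)
  qed
  then have "shear (\<sigma> j) (?s p) = (\<lambda>g. ?s (shear j p (?s g)))" ..
  also have "\<dots> \<in> S"
    by (rule comp_mem3[OF sS shearsD(2)[OF p] sS])
  finally have "shear (\<sigma> j) (?s p) \<in> S" .
  moreover have "?s p \<in> polys_in ({1..n} - {\<sigma> j})"
  proof (rule alghom_polys_in[OF alghom_subst _ shearsD(1)[OF p]])
    fix i assume "i \<in> {1..n} - {j}"
    then have "\<sigma> i \<in> {1..n} - {\<sigma> j}" using \<sigma>(2)[of i] inj by auto
    then show "?s (Var i) \<in> polys_in ({1..n} - {\<sigma> j})" by simp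
  qed
  ultimately show ?thesis by (simp add: shears_def)
qed

section \<open>From one power of \<open>x_n\<close> to all polynomials\<close>

context
  fixes M :: nat
  assumes M: "M \<ge> 2" and start: "Var n ^ M \<in> shears 1"
begin

lemma Var_power_M_shears:
  assumes "a \<in> {1..n}" "j \<in> {1..n}" "a \<noteq> j"
  shows "Var a ^ M \<in> shears j"
proof -
  have n: "1 \<in> {1..n}" "n \<in> {1..n}" "n \<noteq> 1" using n_ge_3 by auto
  \<comment> \<open>Transposing 1 and \<open>j\<close> moves the target to \<open>j\<close>; a
    second transposition, of two indices other than \<open>j\<close>, then moves the variable of the
    power to \<open>a\<close>.\<close>
  have "Var (if n = 1 then j else if n = j then 1 else n) ^ M \<in> shears j"
    using shears_transpose[OF n(1) assms(2) start n(1)] by (simp add: alghom_power[OF alghom_subst])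
  then obtain a' where a': "a' \<in> {1..n}" "a' \<noteq> j" "Var a' ^ M \<in> shears j"
    using n by (intro that[of "if n = j then 1 else n"]) auto
  show ?thesis
    using shears_transpose[OF a'(1) assms(1) a'(3) assms(2)] a' assms
    by (auto simp: alghom_simps[OF alghom_subst])
qed

text \<open>Translating \<open>x_a\<close> by integers and taking the coefficient of
  \<open>b^(M-2)\<close> in \<open>(x_a + b)^M\<close> lowers the degree to 2.\<close>

lemma Var_square_shears:
  assumes "a \<in> {1..n}" "j \<in> {1..n}" "a \<noteq> j"
  shows "Var a ^ 2 \<in> shears j"
proof -
  have "(Var a + of_nat b * 1) ^ M \<in> shears j" for b
  proof -
    have "of_nat b \<in> shears a"
      using shears_affine[OF affine_forms_Const polys_in_Const assms(1), of "of_nat b"] by simp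
    then have "shear a (of_nat b) (Var a ^ M) \<in> shears j"
      using assms by (intro shears_conj Var_power_M_shears) (auto simp: shears_def)
    then show ?thesis by (simp add: alghom_simps[OF alghom_shear] shear_Var)
  qed
  then have "1 ^ (M - 2) * Var a ^ (M - (M - 2)) \<in> shears j"
    using assms by (intro shears_linear_power_coeff) auto
  then show ?thesis using M by simp
qed

lemma Var_mult_Var_shears:
  assumes "a \<in> {1..n}" "c \<in> {1..n}" "j \<in> {1..n}" "a \<noteq> j" "c \<noteq> j" "a \<noteq> c"
  shows "Var c * Var a \<in> shears j"
proof -
  have "(Var a + of_nat b * Var c) ^ 2 \<in> shears j" for b
  proof -
    have "of_nat b * Var c \<in> affine_forms n"
      using affine_forms_Const_mult[OF affine_forms_Var[OF assms(2)], of "of_nat b"] by simp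
    then have "of_nat b * Var c \<in> shears a"
      using assms by (intro shears_affine) (auto intro!: polys_in_mult)
    then have "shear a (of_nat b * Var c) (Var a ^ 2) \<in> shears j"
      using assms by (intro shears_conj Var_square_shears) (auto simp: shears_def intro!: polys_in_mult)
    then show ?thesis by (simp add: alghom_simps[OF alghom_shear] shear_Var)
  qed
  then have "Var c ^ 1 * Var a ^ (2 - 1) \<in> shears j"
    using assms by (intro shears_linear_power_coeff) auto
  then show ?thesis by simp
qed

text \<open>Raises the degree through a third variable \<open>c\<close>, which exists because
  \<open>n \<ge> 3\<close>: conjugating the shear by \<open>x_c x_a\<close> with
  \<open>x_c \<mapsto> x_c + x_a^(d+1)\<close> and subtracting \<open>x_c x_a\<close> leaves
  \<open>x_a^(d+2)\<close>. The conjugating shear has target \<open>c\<close>, so the induction runs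
  over all pairs \<open>a\<close>, \<open>j\<close>.\<close>

lemma Var_power_shears:
  assumes "a \<in> {1..n}" "j \<in> {1..n}" "a \<noteq> j"
  shows "Var a ^ Suc d \<in> shears j"
  using assms
proof (induction d arbitrary: a j)
  case 0
  then show ?case by (auto intro!: shears_affine affine_forms_Var)
next
  case (Suc d)
  have "\<exists>c\<in>{1, 2, 3}. c \<noteq> a \<and> c \<noteq> j" by simp arith
  then obtain c where c: "c \<in> {1, 2, 3}" "c \<noteq> a" "c \<noteq> j" by blast
  with n_ge_3 have "c \<in> {1..n}" by auto
  note c = this c(2,3)
  have "shear c (Var a ^ Suc d) (Var c * Var a) \<in> shears j"
    using Suc.prems c Suc.IH[of a c]
    by (intro shears_conj Var_mult_Var_shears) (auto simp: shears_def simp del: power_Suc intro!: polys_in_power)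
  then have "(Var c + Var a ^ Suc d) * Var a \<in> shears j"
    using c by (simp add: alghom_simps[OF alghom_shear] shear_Var)
  from shears_diff[OF this Var_mult_Var_shears[of a c j]] Suc.prems c show ?case
    by (simp add: algebra_simps)
qed

text \<open>Variables are adjoined one at a time: in \<open>(x_c + b q)^(d+1)\<close> with
  \<open>q\<close> in the earlier variables, the coefficient of \<open>b\<close> is
  \<open>(d + 1) q x_c^d\<close>, and such products span. The conjugating shear has target
  \<open>c\<close>, so \<open>j\<close> stays arbitrary in the induction.\<close>

lemma shears_eq_polys_in:
  assumes "j \<in> {1..n}"
  shows "shears j = polys_in ({1..n} - {j})"
proof -
  have "p \<in> shears j" if "finite I" "I \<subseteq> {1..n}" "j \<in> {1..n} - I" "p \<in> polys_in I" for I p j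
    using that
  proof (induction I arbitrary: p j rule: finite_induct)
    case empty
    have "\<exists>c. p = Const c"
      using empty.prems(3)
      by (induction p rule: mpoly_induct) (auto simp flip: Const_add Const_mult)
    then show ?case using empty.prems by (auto intro!: shears_affine affine_forms_Const)
  next
    case (insert c I)
    have c: "c \<in> {1..n}" "c \<noteq> j" and j: "j \<in> {1..n}" using insert.prems by auto
    have *: "q ^ 1 * Var c ^ (Suc d - 1) \<in> shears j" if q: "q \<in> polys_in I" for q d
    proof (rule shears_linear_power_coeff)
      fix b
      have qb: "of_nat b * q \<in> polys_in I" using q by (intro polys_in_mult) auto
      then have "of_nat b * q \<in> shears c"
        using insert by (intro insert.IH) auto
      moreover have "of_nat b * q \<in> polys_in ({1..n} - {j, c})"
        using qb by (rule polys_in_mono[rotated]) (use insert in auto)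
      ultimately have "shear c (of_nat b * q) (Var c ^ Suc d) \<in> shears j"
        using c j by (intro shears_conj Var_power_shears) (auto simp: shears_def)
      then show "(Var c + of_nat b * q) ^ Suc d \<in> shears j"
        by (simp add: alghom_power[OF alghom_shear] shear_Var del: power_Suc)
    qed (use insert in auto)
    have monom: "Const x * monom_val Var m \<in> shears j" if m: "m \<in> Poly_Mapping.keys p" for m x
    proof -
      have "Poly_Mapping.keys m \<subseteq> insert c I"
        using m insert.prems(3) by (auto simp: polys_in_def)
      then have "monom_val Var m = Var c ^ Poly_Mapping.lookup m c * (\<Prod>i\<in>I. Var i ^ Poly_Mapping.lookup m i :: 'k mpoly)"
        using insert by (subst monom_val_superset[of "insert c I"]) auto
      moreover have "(\<Prod>i\<in>I. Var i ^ Poly_Mapping.lookup m i) \<in> polys_in I"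
        by (intro polys_in_prod polys_in_power polys_in_Var)
      ultimately have "monom_val Var m \<in> shears j"
        using *[of "\<Prod>i\<in>I. Var i ^ Poly_Mapping.lookup m i" "Poly_Mapping.lookup m c"] by (simp add: mult.commute)
      then show ?thesis using j by (rule shears_Const_mult)
    qed
    have sums: "(\<Sum>m\<in>A. g m) \<in> shears j" if "\<And>m. m \<in> A \<Longrightarrow> g m \<in> shears j" 
      for A :: "(nat \<Rightarrow>\<^sub>0 nat) set" and g
    proof -
      have "Const 0 \<in> shears j" using j by (intro shears_affine affine_forms_Const polys_in_Const)
      then show ?thesis
        using that by (induction A rule: infinite_finite_induct) (auto intro: shears_add)
    qed
    have "(\<Sum>m\<in>Poly_Mapping.keys p. Const (Poly_Mapping.lookup p m) * monom_val Var m) \<in> shears j"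
      by (rule sums, rule monom)
    then show ?case by (simp flip: mpoly_expansion)
  qed
  from this[of "{1..n} - {j}" j] assms have "polys_in ({1..n} - {j}) \<subseteq> shears j"
    by (intro subsetI) simp
  moreover have "shears j \<subseteq> polys_in ({1..n} - {j})"
    by (intro subsetI) (rule shearsD(1))
  ultimately show ?thesis
    by (intro subset_antisym)
qed

end

end

section \<open>From the conjugate of \<open>exp D'\<close> to a nonlinear shear\<close>

lemma commuting_derivations:
  assumes "derivation A" "derivation B" "\<And>i. A (B (Var i)) = B (A (Var i))"
  shows "A (B g) = B (A g)"
proof -
  have "A (B g) - B (A g) = 0"
    using derivation_eqI[OF derivation_commutator[OF assms(1,2)], of "\<lambda>_. 0" g] assms(3)
    by (simp add: derivation_def)
  then show ?thesis by simp
qed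

lemma lnd_Const_mult: "lnd E \<Longrightarrow> lnd (\<lambda>g. Const c * E g)"
  by (simp add: lnd_smult derivation_Const lnd_derivation)

lemma affine_map_exp_der:
  fixes E :: "'k::field_char_0 mpoly \<Rightarrow> 'k mpoly"
  assumes E: "lnd E" and in_n: "\<And>i. i \<in> {1..n} \<Longrightarrow> E (Var i) \<in> affine_forms n"
    and out: "\<And>i. i \<notin> {1..n} \<Longrightarrow> E (Var i) = 0"
  shows "affine_map n (exp_der E)"
proof (rule affine_mapI[OF alghom_exp_der[OF E]])
  note d = lnd_derivation[OF E]
  have step: "E p \<in> affine_forms n" if p: "p \<in> affine_forms n" for p
  proof -
    obtain a b where "p = (\<Sum>j\<in>{1..n}. Const (a j) * Var j) + Const b"
      using p unfolding affine_forms_def by blast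
    then have "E p = (\<Sum>j\<in>{1..n}. Const (a j) * E (Var j))"
      by (simp add: derivation_add[OF d] derivation_sum[OF d] derivation_Const[OF d] derivation_Const_mult[OF d])
    also have "\<dots> \<in> affine_forms n"
      by (intro affine_forms_sum affine_forms_Const_mult in_n)
    finally show ?thesis .
  qed
  fix i assume i: "i \<in> {1..n}"
  have pow: "(E ^^ m) (Var i) \<in> affine_forms n" for m
    by (induction m) (simp_all only: funpow.simps comp_apply id_apply affine_forms_Var[OF i] step)
  obtain m where "(E ^^ m) (Var i) = 0" using lnd_nilpotent[OF E] by blast
  then have "exp_der E (Var i) = (\<Sum>j<m. Const (1 / fact j) * (E ^^ j) (Var i))"
    by (simp add: exp_der_eq_sum[OF d] dpow_def)
  also have "\<dots> \<in> affine_forms n"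
    by (intro affine_forms_sum affine_forms_Const_mult pow)
  finally show "exp_der E (Var i) \<in> affine_forms n" .
qed (use out in \<open>simp add: exp_der_eq_self[OF lnd_derivation[OF E]]\<close>)

lemma affine_forms_of_nat_mult: "p \<in> affine_forms n \<Longrightarrow> of_nat k * p \<in> affine_forms n"
  using affine_forms_Const_mult[of p n "of_nat k"] by simp

text \<open>Polynomial coefficients are allowed for \<open>D\<close>, only constants for
  \<open>D'\<close>: all nonlinearity sits in \<open>exp_D n q\<close> with \<open>q\<close> in the
  kernel of \<open>D\<close>, while \<open>exp_D'\<close> stays affine.\<close>

definition exp_D :: "nat \<Rightarrow> 'k::field_char_0 mpoly \<Rightarrow> 'k mpoly \<Rightarrow> 'k mpoly" where
  "exp_D n q = exp_der (\<lambda>g. q * derD n g)"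

definition exp_D' :: "nat \<Rightarrow> 'k::field_char_0 \<Rightarrow> 'k mpoly \<Rightarrow> 'k mpoly" where
  "exp_D' n r = exp_der (\<lambda>g. Const r * derD' n g)"

lemma exp_D_add:
  "derD n p = 0 \<Longrightarrow> derD n q = 0 \<Longrightarrow> exp_D n p (exp_D n q g) = exp_D n (p + q) g"
  by (simp add: exp_D_def exp_der_smult_add lnd_derD)

lemma exp_D_0 [simp]: "exp_D n 0 g = g"
  by (simp add: exp_D_def)

lemma exp_D'_add: "exp_D' n r (exp_D' n s g) = exp_D' n (r + s) g"
  using exp_der_smult_add[OF lnd_derD', of n "Const r" "Const s" g]
  by (simp add: exp_D'_def derivation_Const[OF derivation_derD'] Const_add)

lemma exp_D'_0 [simp]: "exp_D' n 0 g = g"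
  by (simp add: exp_D'_def)

lemma alghom_exp_D: "derD n q = 0 \<Longrightarrow> alghom (exp_D n q)"
  unfolding exp_D_def by (intro alghom_exp_der lnd_smult lnd_derD)

lemma alghom_exp_D': "alghom (exp_D' n r)"
  unfolding exp_D'_def by (intro alghom_exp_der lnd_Const_mult lnd_derD')

lemma affine_map_exp_D: "affine_map n (exp_D n (Const s))"
  unfolding exp_D_def
proof (rule affine_map_exp_der[OF lnd_Const_mult[OF lnd_derD]])
  fix i assume i: "i \<in> {1..n}"
  show "Const s * derD n (Var i) \<in> affine_forms n"
  proof (cases "i = n")
    case True
    then have "Const s * derD n (Var i) = Const 0" by (simp add: derD_Var)
    then show ?thesis by (simp only: affine_forms_Const)
  next
    case False
    then have "Suc i \<in> {1..n}" using i by auto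
    then have "Const s * (of_nat (n - i) * Var (Suc i)) \<in> affine_forms n"
      by (intro affine_forms_Const_mult affine_forms_of_nat_mult affine_forms_Var)
    then show ?thesis
      using i by (simp only: derD_Var if_True)
  qed
next
  fix i assume "i \<notin> {1..n}" then show "Const s * derD n (Var i) = 0" by (simp only: derD_Var if_False mult_zero_right)
qed

lemma affine_map_exp_D': "affine_map n (exp_D' n r)"
  unfolding exp_D'_def
proof (rule affine_map_exp_der[OF lnd_Const_mult[OF lnd_derD']])
  fix i assume i: "i \<in> {1..n}"
  show "Const r * derD' n (Var i) \<in> affine_forms n"
  proof (cases "i = 1")
    case True
    then have "Const r * derD' n (Var i) = Const 0" by (simp add: derD'_Var)
    then show ?thesis by (simp only: affine_forms_Const)
  next
    case False
    then have "i - 1 \<in> {1..n}" using i by auto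
    then have "Const r * (of_nat (i - 1) * Var (i - 1)) \<in> affine_forms n"
      by (intro affine_forms_Const_mult affine_forms_of_nat_mult affine_forms_Var)
    then show ?thesis
      using i by (simp only: derD'_Var if_True)
  qed
next
  fix i assume "i \<notin> {1..n}" then show "Const r * derD' n (Var i) = 0" by (simp only: derD'_Var if_False mult_zero_right)
qed

section \<open>Adjoint action of \<open>exp(s D)\<close> and \<open>exp(r D')\<close> on the
  sl_2-triple\<close>

lemma Const_half_mult_2:
  fixes c :: "'k::field_char_0"
  shows "Const (1/2) * (Const (2 * c) * x) = Const c * x"
proof -
  have "Const (1/2) * (Const (2 * c) * x) = Const (1/2 * (2 * c)) * x"
    by (simp only: Const_mult mult.assoc)
  then show ?thesis by simp
qed

lemma derD'_derD: "derD' n (derD n g) = derD n (derD' n g) + derH n g"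
  by (simp add: derH_def)

lemma exp_D_derH: "exp_D n (Const s) (derH n g) = 
    derH n (exp_D n (Const s) g) + Const (2 * s) * derD n (exp_D n (Const s) g)"
proof -
  have "exp_D n (Const s) (derH n g) = derH n (exp_D n (Const s) g) + 
      Const (2 * s) * derD n (exp_D n (Const s) g) + Const (1/2) * (0 * derD n (exp_D n (Const s) g))"
    unfolding exp_D_def
    by (rule exp_der_conj_quadratic[OF lnd_Const_mult[OF lnd_derD] derivation_derH
          derivation_smult[OF derivation_derD] derivation_smult[OF derivation_derD]])
       (simp_all add: derivation_simps[OF derivation_derH] derivation_simps[OF derivation_derD] derH_derD Const_mult algebra_simps)
  then show ?thesis by simp
qed

lemma exp_D_derD': "exp_D n (Const s) (derD' n g) = 
    derD' n (exp_D n (Const s) g) - Const s * derH n (exp_D n (Const s) g)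
    - Const (s * s) * derD n (exp_D n (Const s) g)"
proof -
  \<comment> \<open>For \<open>A = s D\<close> the brackets are \<open>[A, D'] = - s H\<close> and
    \<open>[A, [A, D']] = - 2 s^2 D\<close>.\<close>
  have "exp_D n (Const s) (derD' n g) = derD' n (exp_D n (Const s) g) + 
      (- Const s) * derH n (exp_D n (Const s) g) + Const (1/2) * (Const (2 * (- s * s)) * derD n (exp_D n (Const s) g))"
    unfolding exp_D_def
    by (rule exp_der_conj_quadratic[OF lnd_Const_mult[OF lnd_derD] derivation_derD'
          derivation_smult[OF derivation_derH] derivation_smult[OF derivation_derD]])
       (simp_all add: derivation_simps[OF derivation_derH] derivation_simps[OF derivation_derD]
          derivation_simps[OF derivation_derD'] derH_derD derD'_derD Const_mult Const_uminus algebra_simps)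
  then show ?thesis by (simp add: Const_half_mult_2 Const_uminus del: mult_minus_left minus_mult_left mult_minus_right)
       (simp add: Const_uminus)
qed

lemma exp_D'_derH: "exp_D' n r (derH n g) = 
    derH n (exp_D' n r g) - Const (2 * r) * derD' n (exp_D' n r g)"
proof -
  have "exp_D' n r (derH n g) = derH n (exp_D' n r g) + 
      (- Const (2 * r)) * derD' n (exp_D' n r g) + Const (1/2) * (0 * derD' n (exp_D' n r g))"
    unfolding exp_D'_def
    by (rule exp_der_conj_quadratic[OF lnd_Const_mult[OF lnd_derD'] derivation_derH
          derivation_smult[OF derivation_derD'] derivation_smult[OF derivation_derD']])
       (simp_all add: derivation_simps[OF derivation_derH] derivation_simps[OF derivation_derD'] derH_derD' Const_mult algebra_simps)
  then show ?thesis by simp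
qed

lemma exp_D'_derD: "exp_D' n r (derD n g) = 
    derD n (exp_D' n r g) + Const r * derH n (exp_D' n r g)
    - Const (r * r) * derD' n (exp_D' n r g)"
proof -
  have "exp_D' n r (derD n g) = derD n (exp_D' n r g) + 
      Const r * derH n (exp_D' n r g) + Const (1/2) * (Const (2 * (- r * r)) * derD' n (exp_D' n r g))"
    unfolding exp_D'_def
    by (rule exp_der_conj_quadratic[OF lnd_Const_mult[OF lnd_derD'] derivation_derD
          derivation_smult[OF derivation_derH] derivation_smult[OF derivation_derD']])
       (simp_all add: derivation_simps[OF derivation_derH] derivation_simps[OF derivation_derD]
          derivation_simps[OF derivation_derD'] derH_derD' derD'_derD Const_mult Const_uminus algebra_simps)
  then show ?thesis by (simp add: Const_half_mult_2 Const_uminus del: mult_minus_left minus_mult_left mult_minus_right)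
       (simp add: Const_uminus)
qed

lemma exp_D_derD: "exp_D n (Const s) (derD n g) = derD n (exp_D n (Const s) g)"
proof -
  have l: "lnd (\<lambda>g. Const s * derD n g)" by (rule lnd_Const_mult[OF lnd_derD])
  have "exp_D n (Const s) (derD n g) = derD n (exp_D n (Const s) g) + 0 + Const (1/2) * 0"
    unfolding exp_D_def
    by (rule exp_der_conj_quadratic[OF l derivation_derD, of "\<lambda>_. 0" "\<lambda>_. 0"])
       (simp_all add: derivation_def derivation_Const_mult[OF derivation_derD] derivation_0[OF derivation_derD])
  then show ?thesis by simp
qed

lemma exp_D'_derD': "exp_D' n r (derD' n g) = derD' n (exp_D' n r g)"
proof -
  have l: "lnd (\<lambda>g. Const r * derD' n g)" by (rule lnd_Const_mult[OF lnd_derD'])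
  have "exp_D' n r (derD' n g) = derD' n (exp_D' n r g) + 0 + Const (1/2) * 0"
    unfolding exp_D'_def
    by (rule exp_der_conj_quadratic[OF l derivation_derD', of "\<lambda>_. 0" "\<lambda>_. 0"])
       (simp_all add: derivation_def derivation_Const_mult[OF derivation_derD'] derivation_0[OF derivation_derD'])
  then show ?thesis by simp
qed

text \<open>In \<open>SL\<^sub>2\<close> this word is the upper triangular matrix with diagonal \<open>(2, 1/2)\<close>:
  \<open>(1,0;1,1) (1,-1/2;0,1) (1,0;-2,1) = (2,-1/2;0,1/2)\<close>.\<close>

definition borel_word :: "nat \<Rightarrow> 'k::field_char_0 mpoly \<Rightarrow> 'k mpoly" where
  "borel_word n g = exp_D' n 1 (exp_D n (Const (- (1/2))) (exp_D' n (- 2) g))"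

text \<open>The upper triangular matrix scales the root vector \<open>D\<close> by the quotient of
  its diagonal entries, 2 / (1/2) = 4. The proof applies the three letters in turn: \<open>D\<close>
  becomes \<open>D - 2 H - 4 D'\<close>, then \<open>4 D - 4 H - 4 D'\<close>, then
  \<open>4 D\<close>.\<close>

lemma borel_word_derD: "borel_word n (derD n g) = 4 * derD n (borel_word n g)"
proof -
  let ?U = "exp_D n (Const (- (1/2))) :: 'a mpoly \<Rightarrow> 'a mpoly" and ?L = "exp_D' n :: 'a \<Rightarrow> 'a mpoly \<Rightarrow> 'a mpoly"
  define y where "y = ?L (- 2) g"
  define z where "z = ?U y"
  \<comment> \<open>A name for the constant 1/2, so that ring arithmetic only needs
    \<open>2 * c = 1\<close>.\<close>
  define c where "c = (Const (1/2) :: 'a mpoly)"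
  have c: "2 * c = 1"
    unfolding c_def by (subst Const_numeral[symmetric], subst Const_mult[symmetric]) simp
  have c': "Const (- (1/2)) = - c" "Const (- (1/2) * - (1/2)) = c * c" "Const (2 * - (1/2)) = (- 1 :: 'a mpoly)"
    unfolding c_def Const_mult[symmetric] by (simp_all add: Const_uminus)
  have 4: "4 * (c * x) = 2 * x" "4 * (c * c * x) = x" for x
  proof -
    have "4 * (c * x) = 2 * ((2 * c) * x)" "4 * (c * c * x) = (2 * c) * ((2 * c) * x)"
      by (simp_all add: algebra_simps)
    then show "4 * (c * x) = 2 * x" "4 * (c * c * x) = x"
      unfolding c by simp_all
  qed
  have U: "alghom ?U" by (intro alghom_exp_D derivation_Const derivation_derD)
  have L: "alghom (?L r)" for r by (rule alghom_exp_D')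
  have UD: "?U (derD n y) = derD n z"
    by (simp only: exp_D_derD z_def)
  have UH: "?U (derH n y) = derH n z - derD n z"
    unfolding exp_D_derH c'(3) z_def by simp
  have UD': "?U (derD' n y) = derD' n z + c * derH n z - c * c * derD n z"
    unfolding exp_D_derD' z_def unfolding c' by simp
  have "?L (- 2) (derD n g) = derD n y - 2 * derH n y - 4 * derD' n y"
    by (simp add: exp_D'_derD y_def Const_uminus)
  then have "?U (?L (- 2) (derD n g)) = derD n z - 2 * (derH n z - derD n z)
      - 4 * (derD' n z + c * derH n z - c * c * derD n z)"
    by (simp add: alghom_simps[OF U] UH UD' UD)
  also have "\<dots> = 4 * derD n z - 4 * derH n z - 4 * derD' n z"
    by (simp add: right_diff_distrib distrib_left 4)
  finally have "borel_word n (derD n g) = ?L 1 (4 * derD n z - 4 * derH n z - 4 * derD' n z)"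
    by (simp add: borel_word_def)
  also have "\<dots> = 4 * derD n (?L 1 z)"
    by (simp add: alghom_simps[OF L] exp_D'_derD exp_D'_derH exp_D'_derD' algebra_simps)
  finally show ?thesis
    by (simp add: borel_word_def z_def y_def)
qed

section \<open>Multiples of \<open>D\<close> whose exponentials lie in the group\<close>

context affine_overgroup
begin

lemma exp_D_Const_mem: "exp_D n (Const s) \<in> S"
proof (rule affine_mem[OF affine_map_exp_D affine_map_exp_D])
  fix p
  show "exp_D n (Const s) (exp_D n (Const (- s)) p) = p"
    by (simp add: exp_D_add derivation_Const[OF derivation_derD] Const_uminus derivation_uminus[OF derivation_derD])
qed

lemma exp_D'_mem: "exp_D' n r \<in> S"
  by (rule affine_mem[OF affine_map_exp_D' affine_map_exp_D'[of n "- r"]]) (simp add: exp_D'_add)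

lemma exp_D_mem_of_conjugate:
  assumes t: "derD n t = 0" "derD' n t = 0"
    and \<phi>: "(\<lambda>g. exp_D n t (exp_D' n 1 (exp_D n (- t) g))) \<in> S"
  shows "exp_D n (- 3 * t) \<in> S"
proof -
  let ?E = "exp_D n" and ?L = "exp_D' n"
  note dD = derivation_simps[OF derivation_derD]
  have add: "?E p (?E q g) = ?E (p + q) g" if "derD n p = 0" "derD n q = 0" for p q g
    using that by (rule exp_D_add)
  have E: "alghom (?E q)" if "derD n q = 0" for q
    using that by (rule alghom_exp_D)
  have t': "derD n (- t) = 0" "derD n (c * t) = 0" if "derD n c = 0" for c
    using t that by (simp_all add: dD)
  have cst: "derD n (Const s) = 0" for s by (rule derivation_Const[OF derivation_derD])
  let ?\<phi> = "\<lambda>r g. ?E t (?L r (?E (- t) g))"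
  have \<phi>': "?\<phi> (- 1) \<in> S"
  proof (rule inv_mem[OF \<phi>])
    show "alghom (?\<phi> (- 1))"
      by (rule alghom_comp3[OF E alghom_exp_D' E]) (simp_all add: t dD)
    show "?\<phi> 1 (?\<phi> (- 1) p) = p" for p
      by (simp add: add exp_D'_add t dD)
  qed
  let ?v = "Const (- (1/2)) :: 'k mpoly"
  \<comment> \<open>Each letter is conjugated by \<open>E(t)\<close>: \<open>exp(D')\<close> becomes
    \<open>\<phi>\<close>, \<open>exp(-2 D')\<close> becomes the square of its inverse, and
    \<open>exp(-D/2)\<close> is unchanged because \<open>t\<close> and constants lie in the kernel
    of \<open>D\<close>.\<close>
  have "(\<lambda>g. ?E t (borel_word n (?E (- t) g))) = (\<lambda>g. ?\<phi> 1 (?E ?v (?\<phi> (- 1) (?\<phi> (- 1) g))))"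
    by (rule ext) (simp add: borel_word_def add exp_D'_add t dD cst)
  also have "\<dots> \<in> S"
    by (rule comp_mem3[OF \<phi> exp_D_Const_mem comp_mem[OF \<phi>' \<phi>']])
  finally have conj: "(\<lambda>g. ?E t (borel_word n (?E (- t) g))) \<in> S" .
  let ?w = "\<lambda>g. ?L 2 (?E (Const (1/2)) (?L (- 1) g))"
  have w: "?w \<in> S"
    by (rule comp_mem3[OF exp_D'_mem exp_D_Const_mem exp_D'_mem])
  have bw: "borel_word n (?w g) = g" for g
    by (simp add: borel_word_def exp_D'_add add cst flip: Const_add)
  have bhom: "alghom (borel_word n)"
    unfolding borel_word_def by (rule alghom_comp3[OF alghom_exp_D' E alghom_exp_D']) (rule cst)
  \<comment> \<open>Both \<open>D\<close> and \<open>D'\<close> kill \<open>t\<close>, so every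
    letter fixes it.\<close>
  have bt: "borel_word n t = t"
    using t by (simp add: borel_word_def exp_D_def exp_D'_def exp_der_eq_self
        derivation_smult derivation_derD derivation_derD')
  have "borel_word n (?E (- t) g) = ?E (- 4 * t) (borel_word n g)" for g
    unfolding exp_D_def
  proof (rule exp_der_twisted[OF bhom])
    show "lnd (\<lambda>g. - t * derD n g)" "lnd (\<lambda>g. - 4 * t * derD n g)"
      by (intro lnd_smult lnd_derD; simp add: t dD)+
    show "borel_word n (- t * derD n g) = - 4 * t * derD n (borel_word n g)" for g
      by (simp add: alghom_simps[OF bhom] bt borel_word_derD)
  qed
  then have "?E (- 3 * t) = (\<lambda>g. ?E t (borel_word n (?E (- t) (?w g))))"
    by (intro ext) (simp add: bw add t dD)
  also have "\<dots> \<in> S"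
    by (rule comp_mem[OF conj w])
  finally show ?thesis .
qed

text \<open>Closed under differences, as \<open>exp(q D)\<close> is additive in \<open>q\<close> on
  the kernel; this is the additive group for which coefficients are extracted up to
  integers.\<close>

definition exp_D_ker :: "'k mpoly set" where
  "exp_D_ker = {q. derD n q = 0 \<and> exp_D n q \<in> S}"

lemma exp_D_ker_diff:
  assumes "p \<in> exp_D_ker" "q \<in> exp_D_ker"
  shows "p - q \<in> exp_D_ker"
proof -
  note dD = derivation_simps[OF derivation_derD]
  have pq: "derD n p = 0" "derD n q = 0" "exp_D n p \<in> S" "exp_D n q \<in> S"
    using assms by (simp_all add: exp_D_ker_def)
  have "exp_D n (- q) \<in> S"
    by (rule inv_mem[OF pq(4) alghom_exp_D]) (simp_all add: exp_D_add pq dD)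
  have "exp_D n (p - q) = (\<lambda>g. exp_D n p (exp_D n (- q) g))"
    by (rule ext) (simp add: exp_D_add pq dD)
  also have "\<dots> \<in> S" by (rule comp_mem) fact+
  finally show ?thesis by (simp add: exp_D_ker_def pq dD)
qed

lemma one_in_range: "1 \<in> {1..n}" and two_in_range: "2 \<in> {1..n}" and n_in_range: "n \<in> {1..n}"
  using n_ge_3 by auto

lemma exp_D_ker_translate:
  assumes "q \<in> exp_D_ker"
  shows "shear 1 (Const b) q \<in> exp_D_ker"
proof -
  let ?\<tau> = "\<lambda>b. shear 1 (Const b :: 'k mpoly)"
  have q: "derD n q = 0" "exp_D n q \<in> S" using assms by (simp_all add: exp_D_ker_def)
  have \<tau>: "?\<tau> b \<in> S" for b
    by (intro shearsD(2) shears_affine affine_forms_Const polys_in_Const one_in_range)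
  have k: "derD n (?\<tau> b q) = 0"
    unfolding shear_Const_derD[symmetric] q by (rule alghom_0[OF alghom_shear])
  have inv: "?\<tau> b (?\<tau> (- b) g) = g" for g
    using shear_shear[OF polys_in_Const[of "- b" "{}"], of 1 "Const b" g] by (simp add: Const_uminus shear_0)
  have "?\<tau> b (exp_D n q g) = exp_D n (?\<tau> b q) (?\<tau> b g)" for g
    unfolding exp_D_def
    by (rule exp_der_twisted[OF alghom_shear lnd_smult[OF lnd_derD q(1)] lnd_smult[OF lnd_derD k]])
       (simp only: alghom_mult[OF alghom_shear] shear_Const_derD)
  from this[of "?\<tau> (- b) g" for g] have "exp_D n (?\<tau> b q) = (\<lambda>g. ?\<tau> b (exp_D n q (?\<tau> (- b) g)))"
    unfolding inv by (intro ext) (rule sym)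
  also have "\<dots> \<in> S" by (rule comp_mem3[OF \<tau> q(2) \<tau>])
  finally show ?thesis using k by (simp add: exp_D_ker_def)
qed

text \<open>Conjugating \<open>A = u D\<close> by \<open>x_2 \<mapsto> x_2 + x_n\<close> gives
  \<open>A + B\<close>, where \<open>B\<close> is \<open>w\<close> times the partial derivative in
  \<open>x_1\<close>. As \<open>A\<close> and \<open>B\<close> commute, cancelling
  \<open>exp A\<close> leaves \<open>exp B\<close>, a shear since \<open>w\<close> is free of
  \<open>x_1\<close>. The integer factors \<open>K\<close> and \<open>n - 1\<close> are divided out
  at the end.\<close>

lemma shear_mem_of_exp_D:
  assumes K: "K \<noteq> 0" and u: "of_int K * Var n ^ N \<in> exp_D_ker"
  shows "Var n ^ Suc N \<in> shears 1"
proof -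
  define u :: "'k mpoly" where "u = of_int K * Var n ^ N"
  define w :: "'k mpoly" where "w = of_nat (n - 1) * u * Var n"
  let ?A = "\<lambda>g. u * derD n g" and ?B = "\<lambda>g. w * pdiff 1 g"
  let ?s = "\<lambda>c. shear 2 (Const c * Var n :: 'k mpoly)"
  note dD = derivation_simps[OF derivation_derD] and dp = derivation_simps[OF derivation_pdiff]
  have n: "n \<noteq> 1" "n \<noteq> 2" "n \<ge> 3" using n_ge_3 by auto
  have u': "derD n u = 0" "exp_D n u \<in> S" using u by (simp_all add: exp_D_ker_def u_def)
  have Dn: "derD n (Var n) = 0" by (simp add: derD_Var)
  have w': "derD n w = 0" by (simp add: w_def dD u' Dn del: of_nat_diff)
  have uI: "u \<in> polys_in {n}" 
    unfolding u_def using polys_in_Const[of "of_int K"] by (intro polys_in_mult polys_in_power polys_in_Var) auto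
  then have wI: "w \<in> polys_in {n}"
    unfolding w_def by (intro polys_in_mult polys_in_Var) auto
  have pu: "pdiff 1 u = 0" and pw: "pdiff 1 w = 0"
    by (rule derivation_eq_0[OF derivation_pdiff _ uI], use n in \<open>simp add: pdiff_Var\<close>)
       (rule derivation_eq_0[OF derivation_pdiff _ wI], use n in \<open>simp add: pdiff_Var\<close>)
  have su: "?s c u = u" for c using n by (intro shear_fixes[OF uI]) auto
  have lA: "lnd ?A" by (intro lnd_smult lnd_derD u')
  have "lnd (pdiff 1 :: 'k mpoly \<Rightarrow> 'k mpoly)"
  proof (rule lndI[OF derivation_pdiff])
    fix i
    have "(pdiff 1 ^^ 2) (Var i :: 'k mpoly) = 0"
      by (simp add: numeral_2_eq_2 pdiff_Var dp)
    then show "\<exists>m. (pdiff 1 ^^ m) (Var i :: 'k mpoly) = 0" ..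
  qed
  then have lB: "lnd ?B" by (intro lnd_smult pw)
  have pD: "pdiff 1 (derD n g) = derD n (pdiff 1 g)" for g :: "'k mpoly"
    by (rule commuting_derivations[OF derivation_pdiff derivation_derD])
       (auto simp: derD_Var pdiff_Var dD dp)
  have AB: "?A (?B g) = ?B (?A g)" for g
    by (simp add: dD dp w' pu pD algebra_simps del: One_nat_def)
  have expB: "exp_der ?B g = shear 1 w g" for g
  proof (rule alghom_eqI[OF alghom_exp_der[OF lB] alghom_shear])
    fix i
    show "exp_der ?B (Var i) = shear 1 w (Var i)"
    proof (cases "i = 1")
      case True
      have "(?B ^^ 2) (Var 1) = 0"
        by (simp add: numeral_2_eq_2 pdiff_Var dp pw del: One_nat_def)
      from exp_der_eq_sum[OF lnd_derivation[OF lB] this] True show ?thesis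
        by (simp add: numeral_2_eq_2 dpow_def pdiff_Var shear_Var)
    next
      case False
      then show ?thesis
        by (simp add: shear_Var exp_der_eq_self[OF lnd_derivation[OF lB]] pdiff_Var del: One_nat_def)
    qed
  qed
  \<comment> \<open>Only \<open>D(x_1) = (n - 1) x_2\<close> contains \<open>x_2\<close>, and adding
    \<open>x_n\<close> to \<open>x_2\<close> does not change its image because
    \<open>D(x_n) = 0\<close>. The whole excess therefore sits at \<open>x_1\<close>.\<close>
  have "?s 1 (?A g) = ?A (?s 1 g) + ?B (?s 1 g)" for g
  proof (rule derivation_eqI_twisted[OF alghom_shear lnd_derivation[OF lA] 
        derivation_plus[OF lnd_derivation[OF lA] lnd_derivation[OF lB]]])
    fix i :: nat
    consider "i = 1" | "i = 2" | "i \<noteq> 1" "i \<noteq> 2" by blast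
    then show "?s 1 (?A (Var i)) = ?A (?s 1 (Var i)) + ?B (?s 1 (Var i))"
    proof cases
      case 1
      have "derD n (Var 1) = (of_nat (n - 1) * Var 2 :: 'k mpoly)"
        using n by (simp add: derD_Var numeral_2_eq_2 del: of_nat_diff)
      then show ?thesis
        using 1 su[of 1] by (simp add: alghom_simps[OF alghom_shear] shear_Var pdiff_Var w_def algebra_simps del: of_nat_diff One_nat_def)
    next
      case 2
      have "derD n (Var 2) = (of_nat (n - 2) * Var 3 :: 'k mpoly)"
        using n by (simp add: derD_Var numeral_3_eq_3 numeral_2_eq_2 del: of_nat_diff)
      then show ?thesis
        using 2 su[of 1] n by (simp add: alghom_simps[OF alghom_shear] shear_Var pdiff_Var dD dp Dn del: of_nat_diff One_nat_def)
    next
      case 3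
      then have "?s 1 (derD n (Var i)) = derD n (Var i)"
        by (auto simp: derD_Var alghom_simps[OF alghom_shear] shear_Var simp del: of_nat_diff)
      then show ?thesis
        using 3 su[of 1] by (simp add: alghom_simps[OF alghom_shear] shear_Var pdiff_Var del: One_nat_def)
    qed
  qed
  then have "?s 1 (exp_der ?A g) = exp_der (\<lambda>g. ?A g + ?B g) (?s 1 g)" for g
    by (rule exp_der_twisted[OF alghom_shear lA lnd_plus[OF lA lB AB]])
  also have "exp_der (\<lambda>g. ?A g + ?B g) (?s 1 g) = exp_D n u (shear 1 w (?s 1 g))" for g
    unfolding exp_der_plus[OF lA lB AB] expB exp_D_def ..
  finally have conj: "?s 1 (exp_D n u g) = exp_D n u (shear 1 w (?s 1 g))" for g
    unfolding exp_D_def .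
  have sS: "?s c \<in> S" for c
  proof (rule shearsD(2), rule shears_affine)
    show "Const c * Var n \<in> affine_forms n"
      by (intro affine_forms_Const_mult affine_forms_Var n_in_range)
    show "Const c * Var n \<in> polys_in ({1..n} - {2})"
      using n n_in_range by (intro polys_in_mult polys_in_Const polys_in_Var) auto
    show "2 \<in> {1..n}" by (rule two_in_range)
  qed
  have inv: "?s 1 (?s (- 1) g) = g" for g
  proof -
    have "Const (- 1) * Var n \<in> polys_in {n}" by (intro polys_in_mult polys_in_Const polys_in_Var) simp
    from shear_shear[OF this, of 2 "Const 1 * Var n" g] n show ?thesis
      by (simp add: Const_uminus shear_0)
  qed
  have neg: "exp_D n (- u) \<in> S"
    by (rule inv_mem[OF u'(2) alghom_exp_D]) (simp_all add: exp_D_add u' dD)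
  have "shear 1 w = (\<lambda>g. exp_D n (- u) (?s 1 (exp_D n u (?s (- 1) g))))"
    unfolding conj inv by (rule ext) (simp add: exp_D_add u' dD)
  also have "\<dots> \<in> S"
    by (rule comp_mem[OF neg comp_mem3[OF sS u'(2) sS]])
  finally have "shear 1 w \<in> S" .
  moreover have "w \<in> polys_in ({1..n} - {1})"
    using n by (intro polys_in_mono[OF _ wI]) auto
  moreover have "w = of_int (int (n - 1) * K) * Var n ^ Suc N"
    by (simp add: w_def u_def mult.assoc mult.commute del: of_nat_diff)
  ultimately have "of_int (int (n - 1) * K) * Var n ^ Suc N \<in> shears 1"
    by (simp add: shears_def del: of_nat_diff)
  then show ?thesis
    by (rule shears_of_int_mult_cancel) (use K n one_in_range in auto)
qed

lemma shears_all:
  fixes f :: "'k mpoly"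
  assumes "l \<ge> 1" and "f = f_n n"
    and \<phi>: "(\<lambda>g. exp_D n (f ^ l) (exp_D' n 1 (exp_D n (- (f ^ l)) g))) \<in> S"
    and j: "j \<in> {1..n}"
  shows "shears j = polys_in ({1..n} - {j})"
proof -
  note inv = f_n_invariant[OF n_ge_3, where 'k = 'k, folded assms(2)]
  note dD = derivation_simps[OF derivation_derD]
  from inv(4) obtain P :: "'k mpoly poly" and e where e: "e \<ge> 1" and P: "degree P \<le> e" "coeff P e = Var n ^ e"
    and tr: "\<And>b. shear 1 (Const b) f = poly P (Const b)" by blast
  have t: "derD n (f ^ l) = 0" "derD' n (f ^ l) = 0"
    by (rule derivation_power_eq_0[OF derivation_derD inv(1)], rule derivation_power_eq_0[OF derivation_derD' inv(2)])
  have "- 3 * f ^ l \<in> exp_D_ker"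
    using exp_D_mem_of_conjugate[OF t \<phi>] by (simp add: exp_D_ker_def dD t)
  then have "poly (smult (- 3) (P ^ l)) (of_nat b) \<in> exp_D_ker" for b
    using exp_D_ker_translate[of "- 3 * f ^ l" "of_nat b"] tr[of "of_nat b"] by (simp add: alghom_simps[OF alghom_shear] poly_power)
  from coeff_multiple_mem[OF exp_D_ker_diff this, of "e * l"] obtain K :: int
    where K: "K \<noteq> 0" "of_int K * coeff (smult (- 3) (P ^ l)) (e * l) \<in> exp_D_ker" by blast
  \<comment> \<open>A nonzero coefficient at \<open>e\<close> makes the degree of \<open>P\<close>
    exactly \<open>e\<close>, so the coefficient of \<open>P ^ l\<close> at \<open>e * l\<close> is
    the power of the leading one.\<close>
  have nz: "(Var n ^ e :: 'k mpoly) \<noteq> 0"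
    by (metis Const_0 Const_eq_iff Var_power lookup_single_eq lookup_zero zero_neq_one)
  then have deg: "degree P = e"
    using P by (intro antisym le_degree) auto
  have "P \<noteq> 0" using P(2) nz by auto
  then have "coeff (P ^ l) (e * l) = (Var n ^ e) ^ l"
    using lead_coeff_power[of P l] degree_power_eq[of P l] P(2) deg by (simp add: mult.commute)
  then have "of_int (- 3 * K) * Var n ^ (e * l) \<in> exp_D_ker"
    using K(2) by (simp add: power_mult mult.assoc mult.left_commute)
  then have "Var n ^ Suc (e * l) \<in> shears 1"
    by (rule shear_mem_of_exp_D[rotated]) (use K in simp)
  \<comment> \<open>This is where the shear is seen to be nonlinear; an exponent of 1 would give an
    affine map.\<close>
  moreover have "Suc (e * l) \<ge> 2" using e assms(1) by simp
  ultimately show ?thesis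
    using j by (intro shears_eq_polys_in)
qed

end

section \<open>The automorphism group\<close>

lemma comp_map_apply: "comp_map F G i = subst F (G i)"
  by (simp add: comp_map_def)

lemma comp_map_assoc: "comp_map (comp_map F G) H = comp_map F (comp_map G H)"
  by (rule ext) (simp only: comp_map_apply subst_comp_map)

lemma comp_map_Var [simp]: "comp_map Var F = F" "comp_map F Var = F"
  by (simp_all add: comp_map_def)

lemma comp_map_alghom:
  "alghom \<Phi> \<Longrightarrow> comp_map (\<lambda>i. \<Phi> (Var i)) (\<lambda>i. \<Psi> (Var i)) = (\<lambda>i. \<Phi> (\<Psi> (Var i)))"
  by (simp add: comp_map_def subst_eq_alghom)

lemma endosI:
  "(\<And>i. i \<in> {1..n} \<Longrightarrow> F i \<in> polys_in {1..n}) \<Longrightarrow> (\<And>i. i \<notin> {1..n} \<Longrightarrow> F i = Var i) \<Longrightarrow> F \<in> endos n"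
  by (simp add: endos_def polys_eq_polys_in)

lemma endosD:
  assumes "F \<in> endos n"
  shows "i \<in> {1..n} \<Longrightarrow> F i \<in> polys_in {1..n}" "i \<notin> {1..n} \<Longrightarrow> F i = Var i"
  using assms by (simp_all add: endos_def polys_eq_polys_in)

lemma comp_map_endos:
  assumes "F \<in> endos n" "G \<in> endos n" shows "comp_map F G \<in> endos n"
proof (rule endosI)
  fix i assume "i \<in> {1..n}"
  then have "G i \<in> polys_in {1..n}" by (rule endosD(1)[OF assms(2)])
  from alghom_polys_in[OF alghom_subst _ this] show "comp_map F G i \<in> polys_in {1..n}"
    by (simp only: comp_map_apply subst_Var endosD(1)[OF assms(1)])
next
  fix i assume "i \<notin> {1..n}"
  then show "comp_map F G i = Var i"
    using endosD(2)[OF assms(2)] endosD(2)[OF assms(1)] by (metis comp_map_apply subst_Var)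
qed

lemma Var_endos: "Var \<in> endos n"
  by (simp add: endos_def polys_eq_polys_in)

lemma group_AutGrp: "group (AutGrp n :: (nat \<Rightarrow> 'k::comm_ring_1 mpoly) monoid)"
proof (rule groupI)
  fix F G :: "nat \<Rightarrow> 'k mpoly"
  assume "F \<in> carrier (AutGrp n)" "G \<in> carrier (AutGrp n)"
  then have "F \<in> Aut n" "G \<in> Aut n" by (simp_all add: AutGrp_def)
  then obtain F' G' where F': "F' \<in> endos n" "comp_map F F' = Var" "comp_map F' F = Var" "F \<in> endos n"
    and G': "G' \<in> endos n" "comp_map G G' = Var" "comp_map G' G = Var" "G \<in> endos n"
    unfolding Aut_def by blast
  have "comp_map (comp_map F G) (comp_map G' F') = Var"
    using F' G' by (metis comp_map_assoc comp_map_Var(1))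
  moreover have "comp_map (comp_map G' F') (comp_map F G) = Var"
    using F' G' by (metis comp_map_assoc comp_map_Var(1))
  ultimately have "comp_map F G \<in> Aut n"
    unfolding Aut_def using F' G' comp_map_endos by blast
  then show "F \<otimes>\<^bsub>AutGrp n\<^esub> G \<in> carrier (AutGrp n)"
    by (simp add: AutGrp_def)
next
  have "Var \<in> Aut n"
    unfolding Aut_def using Var_endos comp_map_Var(1) by blast
  then show "\<one>\<^bsub>AutGrp n\<^esub> \<in> carrier (AutGrp n :: (nat \<Rightarrow> 'k mpoly) monoid)"
    by (simp add: AutGrp_def)
next
  fix F assume "F \<in> carrier (AutGrp n :: (nat \<Rightarrow> 'k mpoly) monoid)"
  then have "F \<in> Aut n" by (simp add: AutGrp_def)
  then obtain F' where F': "F' \<in> endos n" "comp_map F F' = Var" "comp_map F' F = Var" "F \<in> endos n"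
    unfolding Aut_def by blast
  then have "F' \<in> Aut n" unfolding Aut_def by blast
  with F'(3) show "\<exists>F'\<in>carrier (AutGrp n). F' \<otimes>\<^bsub>AutGrp n\<^esub> F = \<one>\<^bsub>AutGrp n\<^esub>"
    by (auto simp: AutGrp_def)
qed (simp_all add: AutGrp_def comp_map_assoc)

lemma AutI:
  assumes "alghom \<Phi>" "alghom \<Psi>" "\<And>g. \<Phi> (\<Psi> g) = g" "\<And>g. \<Psi> (\<Phi> g) = g"
    and "\<And>i. i \<in> {1..n} \<Longrightarrow> \<Phi> (Var i) \<in> polys_in {1..n}" "\<And>i. i \<in> {1..n} \<Longrightarrow> \<Psi> (Var i) \<in> polys_in {1..n}"
    and "\<And>i. i \<notin> {1..n} \<Longrightarrow> \<Phi> (Var i) = Var i" "\<And>i. i \<notin> {1..n} \<Longrightarrow> \<Psi> (Var i) = Var i"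
  shows "(\<lambda>i. \<Phi> (Var i)) \<in> Aut n"
proof -
  have e: "(\<lambda>i. \<Phi> (Var i)) \<in> endos n" "(\<lambda>i. \<Psi> (Var i)) \<in> endos n"
    using assms by (auto intro: endosI simp del: atLeastAtMost_iff)
  have "comp_map (\<lambda>i. \<Phi> (Var i)) (\<lambda>i. \<Psi> (Var i)) = Var" "comp_map (\<lambda>i. \<Psi> (Var i)) (\<lambda>i. \<Phi> (Var i)) = Var"
    using assms by (simp_all add: comp_map_alghom)
  with e show ?thesis unfolding Aut_def by blast
qed

section \<open>Affine automorphisms in terms of matrices\<close>

lemma matrix_mult_eq_one_commute:
  fixes A B :: "nat \<Rightarrow> nat \<Rightarrow> 'k::field"
  assumes "\<forall>i \<in> {1..n}. \<forall>j \<in> {1..n}. (\<Sum>l \<in> {1..n}. A i l * B l j) = (if i = j then 1 else 0)"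
    and "i \<in> {1..n}" "j \<in> {1..n}"
  shows "(\<Sum>l \<in> {1..n}. B i l * A l j) = (if i = j then 1 else 0)"
proof -
  \<comment> \<open>Matrices are indexed from 0 and variables from 1, hence the shift.\<close>
  define mat_of where "mat_of A = mat n n (\<lambda>(i, j). A (Suc i) (Suc j))" for A :: "nat \<Rightarrow> nat \<Rightarrow> 'k"
  have c: "mat_of A \<in> carrier_mat n n" for A by (simp add: mat_of_def)
  have p: "(mat_of A * mat_of B) $$ (i, j) = (\<Sum>l \<in> {1..n}. A (Suc i) l * B l (Suc j))"
    if "i < n" "j < n" for A B i j
  proof -
    have "(mat_of A * mat_of B) $$ (i, j) = (\<Sum>l<n. A (Suc i) (Suc l) * B (Suc l) (Suc j))"
      using that by (simp add: mat_of_def scalar_prod_def lessThan_atLeast0)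
    also have "\<dots> = (\<Sum>l \<in> {1..n}. A (Suc i) l * B l (Suc j))"
      by (rule sum.reindex_bij_witness[of _ "\<lambda>l. l - 1" Suc]) auto
    finally show ?thesis .
  qed
  have "mat_of A * mat_of B = 1\<^sub>m n"
  proof (rule eq_matI)
    fix i j assume "i < dim_row (1\<^sub>m n :: 'k mat)" "j < dim_col (1\<^sub>m n :: 'k mat)"
    then show "(mat_of A * mat_of B) $$ (i, j) = 1\<^sub>m n $$ (i, j)"
      using assms(1) by (simp add: p)
  qed (simp_all add: mat_of_def)
  then have "mat_of B * mat_of A = 1\<^sub>m n"
    by (rule mat_mult_left_right_inverse[OF c c])
  then have "(mat_of B * mat_of A) $$ (i - 1, j - 1) = (if i = j then 1 else 0)"
    using assms(2,3) by auto
  then show ?thesis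
    using assms(2,3) p[of "i - 1" "j - 1" B A] by auto
qed

text \<open>Column \<open>i\<close> of the matrix holds the image of \<open>x_i\<close>, so
  substitution multiplies in the order \<open>A B\<close> and turns the translation part into
  \<open>b B + c\<close>.\<close>

lemma subst_affine_form:
  assumes F: "\<And>i. i \<in> {1..n} \<Longrightarrow> F i = (\<Sum>j \<in> {1..n}. Const (A j i) * Var j) + Const (b i)"
  shows "subst F ((\<Sum>j \<in> {1..n}. Const (B j i) * Var j) + Const (c i)) =
    (\<Sum>l \<in> {1..n}. Const (\<Sum>j \<in> {1..n}. A l j * B j i) * Var l) + Const ((\<Sum>j \<in> {1..n}. b j * B j i) + c i)"
proof -
  have Const_sum: "Const (sum g I) = (\<Sum>i\<in>I. Const (g i))" for g :: "nat \<Rightarrow> 'a" and I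
    by (induction I rule: infinite_finite_induct) (simp_all add: Const_add)
  have "subst F ((\<Sum>j \<in> {1..n}. Const (B j i) * Var j) + Const (c i)) = 
      (\<Sum>j \<in> {1..n}. Const (B j i) * ((\<Sum>l \<in> {1..n}. Const (A l j) * Var l) + Const (b j))) + Const (c i)"
    by (simp add: alghom_simps[OF alghom_subst] F)
  also have "\<dots> = (\<Sum>j \<in> {1..n}. \<Sum>l \<in> {1..n}. Const (A l j * B j i) * Var l) + Const ((\<Sum>j \<in> {1..n}. b j * B j i) + c i)"
    by (simp add: Const_sum Const_add Const_mult distrib_left sum.distrib sum_distrib_left mult_ac)
  also have "(\<Sum>j \<in> {1..n}. \<Sum>l \<in> {1..n}. Const (A l j * B j i) * Var l) = 
      (\<Sum>l \<in> {1..n}. Const (\<Sum>j \<in> {1..n}. A l j * B j i) * Var l)"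
    by (subst sum.swap) (simp add: Const_sum sum_distrib_right)
  finally show ?thesis .
qed

lemma sum_delta_Var:
  assumes "i \<in> {1..n}" "\<And>l. l \<in> {1..n} \<Longrightarrow> d l = (if l = i then 1 else 0)"
  shows "(\<Sum>l \<in> {1..n}. Const (d l) * Var l) = (Var i :: 'k::comm_ring_1 mpoly)"
proof -
  have "(\<Sum>l \<in> {1..n}. Const (d l) * Var l) = (\<Sum>l \<in> {1..n}. if l = i then Var i else 0 :: 'k mpoly)"
    by (rule sum.cong) (auto simp: assms(2))
  then show ?thesis using assms(1) by simp
qed

lemma affine_form_polys_in: "(\<Sum>j \<in> {1..n}. Const (a j) * Var j) + Const b \<in> polys_in {1..n}"
  by (intro polys_in_add polys_in_sum polys_in_mult polys_in_Const polys_in_Var)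

lemma Aff_subset_Aut: "Aff n \<subseteq> (Aut n :: (nat \<Rightarrow> 'k::field mpoly) set)"
proof
  fix F :: "nat \<Rightarrow> 'k mpoly" assume "F \<in> Aff n"
  then obtain A B b where out: "\<forall>i. i \<notin> {1..n} \<longrightarrow> F i = Var i"
    and AB: "\<forall>i \<in> {1..n}. \<forall>j \<in> {1..n}. (\<Sum>l \<in> {1..n}. A i l * B l j) = (if i = j then 1 else 0 :: 'k)"
    and F: "\<forall>i \<in> {1..n}. F i = (\<Sum>j \<in> {1..n}. Const (A j i) * Var j) + Const (b i)"
    unfolding Aff_def by blast
  note BA = matrix_mult_eq_one_commute[OF AB]
  \<comment> \<open>The inverse of \<open>x A + b\<close> is \<open>x B - b B\<close>.\<close>
  define c where "c i = - (\<Sum>j \<in> {1..n}. b j * B j i)" for i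
  define G where "G i = (if i \<in> {1..n} then (\<Sum>j \<in> {1..n}. Const (B j i) * Var j) + Const (c i) else Var i)" for i
  have c: "(\<Sum>j \<in> {1..n}. c j * A j i) + b i = 0" if i: "i \<in> {1..n}" for i
  proof -
    have "(\<Sum>j \<in> {1..n}. c j * A j i) = - (\<Sum>j \<in> {1..n}. \<Sum>l \<in> {1..n}. b l * (B l j * A j i))"
      by (simp add: c_def sum_distrib_right sum_negf mult.assoc)
    also have "\<dots> = - (\<Sum>l \<in> {1..n}. b l * (\<Sum>j \<in> {1..n}. B l j * A j i))"
      by (subst sum.swap) (simp add: sum_distrib_left)
    also have "(\<Sum>l \<in> {1..n}. b l * (\<Sum>j \<in> {1..n}. B l j * A j i)) = (\<Sum>l \<in> {1..n}. if l = i then b i else 0)"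
      using i by (intro sum.cong) (simp_all only: BA, auto)
    also have "\<dots> = b i" using i by simp
    finally show ?thesis by simp
  qed
  have F_endos: "F \<in> endos n"
    by (rule endosI) (simp_all only: F[rule_format] out[rule_format] affine_form_polys_in simp_thms)
  have G_endos: "G \<in> endos n"
    by (rule endosI) (simp_all only: G_def affine_form_polys_in if_True if_False)
  have "comp_map F G = Var"
  proof
    fix i
    show "comp_map F G i = Var i"
    proof (cases "i \<in> {1..n}")
      case True
      have "comp_map F G i = (\<Sum>l \<in> {1..n}. Const (\<Sum>j \<in> {1..n}. A l j * B j i) * Var l) + Const ((\<Sum>j \<in> {1..n}. b j * B j i) + c i)"
        using True unfolding comp_map_def G_def by (simp only: if_True) (rule subst_affine_form[OF F[rule_format]])
      also have "(\<Sum>l \<in> {1..n}. Const (\<Sum>j \<in> {1..n}. A l j * B j i) * Var l) = Var i"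
        using True AB by (intro sum_delta_Var) auto
      finally show ?thesis by (simp add: c_def)
    next
      case False
      then have "F i = Var i" using out by blast
      then show ?thesis using False by (simp only: comp_map_apply G_def if_False subst_Var)
    qed
  qed
  moreover have "comp_map G F = Var"
  proof
    fix i
    show "comp_map G F i = Var i"
    proof (cases "i \<in> {1..n}")
      case True
      have G: "G i = (\<Sum>j \<in> {1..n}. Const (B j i) * Var j) + Const (c i)" if "i \<in> {1..n}" for i
        unfolding G_def using that by (simp only: if_True)
      have "comp_map G F i = (\<Sum>l \<in> {1..n}. Const (\<Sum>j \<in> {1..n}. B l j * A j i) * Var l) + Const ((\<Sum>j \<in> {1..n}. c j * A j i) + b i)"
        unfolding comp_map_def F[rule_format, OF True] by (rule subst_affine_form[OF G])
      also have "(\<Sum>l \<in> {1..n}. Const (\<Sum>j \<in> {1..n}. B l j * A j i) * Var l) = Var i"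
        using True BA by (intro sum_delta_Var) auto
      finally show ?thesis by (simp only: c[OF True] Const_0 add_0_right)
    next
      case False
      then have "F i = Var i" using out by blast
      then show ?thesis using False by (simp only: comp_map_apply G_def if_False subst_Var)
    qed
  qed
  ultimately show "F \<in> Aut n"
    unfolding Aut_def using F_endos G_endos by blast
qed

text \<open>The coefficients of an affine form are determined by the polynomial, which turns an
  identity of affine maps into one of matrices.\<close>

lemma lookup_affine_form:
  assumes "i \<in> {1..n}"
  shows "Poly_Mapping.lookup ((\<Sum>j \<in> {1..n}. Const (a j) * Var j) + Const b) (Poly_Mapping.single i 1) = a i"
proof -
  have "Poly_Mapping.lookup ((\<Sum>j \<in> {1..n}. Const (a j) * Var j) + Const b) (Poly_Mapping.single i 1) =
      (\<Sum>j \<in> {1..n}. if j = i then a i else 0)"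
    unfolding lookup_add lookup_sum lookup_Const_mult lookup_Var_single lookup_Const_single add_0_right
    by (rule sum.cong) auto
  then show ?thesis using assms by simp
qed

lemma affine_map_Aff:
  fixes \<Phi> :: "'k::field mpoly \<Rightarrow> 'k mpoly"
  assumes \<Phi>: "affine_map n \<Phi>" and \<Psi>: "affine_map n \<Psi>" and inv: "\<And>p. \<Phi> (\<Psi> p) = p"
  shows "(\<lambda>i. \<Phi> (Var i)) \<in> Aff n"
proof -
  have "\<exists>A b. \<forall>i\<in>{1..n}. \<Phi> (Var i) = (\<Sum>j \<in> {1..n}. Const (A j i) * Var j) + Const (b i)"
    if "affine_map n \<Phi>" for \<Phi> :: "'k mpoly \<Rightarrow> 'k mpoly"
  proof -
    have "\<forall>i\<in>{1..n}. \<exists>ab. \<Phi> (Var i) = (\<Sum>j \<in> {1..n}. Const (fst ab j) * Var j) + Const (snd ab)"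
    proof
      fix i assume "i \<in> {1..n}"
      then have "\<Phi> (Var i) \<in> affine_forms n"
        using that unfolding affine_map_def by metis
      then obtain a b where "\<Phi> (Var i) = (\<Sum>j \<in> {1..n}. Const (a j) * Var j) + Const b"
        unfolding affine_forms_def by auto
      then show "\<exists>ab. \<Phi> (Var i) = (\<Sum>j \<in> {1..n}. Const (fst ab j) * Var j) + Const (snd ab)"
        by (intro exI[of _ "(a, b)"]) simp
    qed
    from bchoice[OF this] obtain ab where "\<forall>i\<in>{1..n}. \<Phi> (Var i) = (\<Sum>j \<in> {1..n}. Const (fst (ab i) j) * Var j) + Const (snd (ab i))" ..
    then show ?thesis
      by (intro exI[of _ "\<lambda>j i. fst (ab i) j"] exI[of _ "\<lambda>i. snd (ab i)"])
  qed
  from this[OF \<Phi>] this[OF \<Psi>] obtain A b B c where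
    A: "\<forall>i\<in>{1..n}. \<Phi> (Var i) = (\<Sum>j \<in> {1..n}. Const (A j i) * Var j) + Const (b i)" and
    B: "\<forall>i\<in>{1..n}. \<Psi> (Var i) = (\<Sum>j \<in> {1..n}. Const (B j i) * Var j) + Const (c i)" by blast
  have hom: "alghom \<Phi>" using \<Phi> by (simp add: affine_map_def)
  have "(\<Sum>l \<in> {1..n}. A i l * B l j) = (if i = j then 1 else 0)" if "i \<in> {1..n}" "j \<in> {1..n}" for i j
  proof -
    have "Var j = subst (\<lambda>i. \<Phi> (Var i)) (\<Psi> (Var j))"
      by (simp add: subst_eq_alghom[OF hom] inv)
    also have "\<dots> = (\<Sum>l \<in> {1..n}. Const (\<Sum>k \<in> {1..n}. A l k * B k j) * Var l) + Const ((\<Sum>k \<in> {1..n}. b k * B k j) + c j)"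
      unfolding B[rule_format, OF that(2)] by (rule subst_affine_form[OF A[rule_format]])
    finally show ?thesis
      using lookup_affine_form[OF that(1), of "\<lambda>l. \<Sum>k \<in> {1..n}. A l k * B k j" "(\<Sum>k \<in> {1..n}. b k * B k j) + c j"]
        lookup_Var_single[of j i, where 'k = 'k] by (simp only: eq_commute[of i j])
  qed
  moreover have "\<Phi> (Var i) = Var i" if "i \<notin> {1..n}" for i
    using \<Phi> that unfolding affine_map_def by (metis singletonD)
  ultimately show ?thesis
    unfolding Aff_def using A by blast
qed

section \<open>Triangular automorphisms as products of shears and dilations\<close>

context affine_overgroup
begin

lemma triangular_mem:
  assumes shears: "\<And>j. j \<in> {1..n} \<Longrightarrow> shears j = polys_in ({1..n} - {j})"
    and F: "F \<in> BA n"
  shows "subst F \<in> S"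
proof -
  have out: "F i = Var i" if "i \<notin> {1..n}" for i
    using F that unfolding BA_def by blast
  \<comment> \<open>\<open>F\<close> is built up one component at a time, starting from the identity
    \<open>G 0\<close>.\<close>
  define G where "G k i = (if i \<in> {1..k} then F i else Var i)" for k i
  have "subst (G k) \<in> S" if "k \<le> n" for k
    using that
  proof (induction k)
    case 0
    have "0 \<in> shears 1" using shears[OF one_in_range] by simp
    from shearsD(2)[OF this] have "(\<lambda>p. p) \<in> S" by (simp add: shear_0)
    moreover have "subst (G 0) = (\<lambda>p. p)"
      by (rule ext, rule alghom_eqI[OF alghom_subst alghom_id]) (simp add: G_def)
    ultimately show ?case by simp
  next
    case (Suc k)
    let ?j = "Suc k"
    have j: "?j \<in> {1..n}" using Suc.prems by simp
    then obtain a g where a: "a \<noteq> 0" and g: "g \<in> polys (?j - 1)" and Fj: "F ?j = Const a * Var ?j + g"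
      using F unfolding BA_def by blast
    let ?s = "subst (Var(?j := Const a * Var ?j))"
    have gI: "g \<in> polys_in {1..k}" using g by (simp add: polys_eq_polys_in)
    then have "g \<in> polys_in ({1..n} - {?j})"
      by (rule polys_in_mono[rotated]) (use j in auto)
    then have shear: "shear ?j g \<in> S"
      using shears[OF j] shearsD(2) by blast
    have sg: "?s g = g"
      using gI by (rule alghom_fixes[OF alghom_subst, rotated]) auto
    \<comment> \<open>By triangularity the components up to \<open>k\<close> only involve
      \<open>x_1, ..., x_k\<close>, which the new shear and dilation fix.\<close>
    have "subst (G ?j) p = ?s (shear ?j g (subst (G k) p))" for p
    proof (rule alghom_eqI[OF alghom_subst alghom_comp3[OF alghom_subst alghom_shear alghom_subst]])
      fix i
      consider "i = ?j" | "i \<in> {1..k}" | "i \<notin> {1..?j}" by force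
      then show "subst (G ?j) (Var i) = ?s (shear ?j g (subst (G k) (Var i)))"
      proof cases
        case 1
        then show ?thesis
          by (simp add: G_def Fj shear_Var alghom_simps[OF alghom_subst] sg)
      next
        case 2
        then have "i \<in> {1..n}" using j by auto
        then obtain b h where h: "h \<in> polys (i - 1)" "F i = Const b * Var i + h"
          using F unfolding BA_def by blast
        have "h \<in> polys_in {1..k}"
          using h(1)[unfolded polys_eq_polys_in] by (rule polys_in_mono[rotated]) (use 2 in auto)
        then have Fi: "F i \<in> polys_in {1..k}"
          unfolding h(2) using 2 by (intro polys_in_add polys_in_mult polys_in_Const polys_in_Var)
        have "?s (F i) = F i"
          using Fi by (rule alghom_fixes[OF alghom_subst, rotated]) auto
        moreover have "shear ?j g (F i) = F i"
          by (rule shear_fixes[OF Fi]) simp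
        ultimately show ?thesis
          using 2 by (simp add: G_def)
      next
        case 3
        then have "i \<notin> {1..k}" "i \<noteq> ?j" using 3 by auto
        then show ?thesis using 3 by (simp only: G_def if_False subst_Var shear_Var fun_upd_other not_False_eq_True)
      qed
    qed
    then have "subst (G ?j) = (\<lambda>p. ?s (shear ?j g (subst (G k) p)))" ..
    also have "\<dots> \<in> S"
      using Suc by (intro comp_mem3[OF scale_mem[OF a j] shear]) simp
    finally show ?case .
  qed
  moreover have "G n = F" using out by (auto simp: G_def)
  ultimately show ?thesis by force
qed

end

lemma lnd_locally_nilpotent: "lnd E \<Longrightarrow> locally_nilpotent n E"
  by (simp add: lnd_def locally_nilpotent_def)

lemma exp_map_eq:
  assumes "derivation E" "\<And>i. i \<notin> {1..n} \<Longrightarrow> E (Var i) = 0"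
  shows "exp_map n E = (\<lambda>i. exp_der E (Var i))"
proof
  fix i
  show "exp_map n E i = exp_der E (Var i)"
  proof (cases "i \<in> {1..n}")
    case False
    then show ?thesis by (simp only: exp_map_def if_False exp_der_eq_self[OF assms(1) assms(2)[OF False]])
  qed (simp only: exp_map_def if_True)
qed

theorem theorem2p2:
  fixes n l :: nat
  assumes "n \<ge> 3" and "l \<ge> 1"
  defines "f \<equiv> (f_n n :: 'k::field_char_0 mpoly)"
  defines "\<phi> \<equiv> comp_map (exp_map n (\<lambda>g. f ^ l * derD n g))
                  (comp_map (exp_map n (derD' n)) (exp_map n (\<lambda>g. - (f ^ l * derD n g))))"
  shows "locally_nilpotent n (\<lambda>g. f ^ l * derD n g) \<and>
         locally_nilpotent n (derD' n :: 'k mpoly \<Rightarrow> 'k mpoly) \<and>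
         \<phi> \<in> Aut n \<and>
         TA n \<subseteq> generate (AutGrp n) (insert \<phi> (Aff n))"
proof -
  note inv = f_n_invariant(1-3)[OF assms(1), where 'k = 'k, folded f_def]
  note dD = derivation_simps[OF derivation_derD]
  define t where "t = f ^ l"
  have t: "derD n t = 0" "derD n (- t) = 0" "t \<in> polys_in {1..n}"
    unfolding t_def using derivation_power_eq_0[OF derivation_derD inv(1)] polys_in_power[OF inv(3)]
    by (simp_all add: dD)
  let ?E = "exp_D n :: 'k mpoly \<Rightarrow> _" and ?L = "exp_D' n :: 'k \<Rightarrow> _"
  have em: "exp_map n (\<lambda>g. q * derD n g) = (\<lambda>i. ?E q (Var i))" for q
    unfolding exp_D_def by (rule exp_map_eq[OF derivation_smult[OF derivation_derD]]) (simp only: derD_Var if_False mult_zero_right)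
  have L1: "?L 1 = exp_der (derD' n)" by (simp add: exp_D'_def)
  have em': "exp_map n (derD' n) = (\<lambda>i. ?L 1 (Var i))"
    unfolding L1 by (rule exp_map_eq[OF derivation_derD']) (simp only: derD'_Var if_False)
  \<comment> \<open>A family containing \<open>\<phi>\<close> at \<open>r = 1\<close> and its
    inverse at \<open>r = -1\<close>, since the parameters of \<open>exp_D'\<close> add.\<close>
  define \<Phi> where "\<Phi> r g = ?E t (?L r (?E (- t) g))" for r g
  have hom: "alghom (\<Phi> r)" for r
    unfolding \<Phi>_def by (rule alghom_comp3[OF alghom_exp_D[OF t(1)] alghom_exp_D' alghom_exp_D[OF t(2)]])
  have "\<phi> = comp_map (\<lambda>i. ?E t (Var i)) (comp_map (\<lambda>i. ?L 1 (Var i)) (\<lambda>i. ?E (- t) (Var i)))"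
    unfolding \<phi>_def t_def[symmetric] em' em[symmetric] by simp
  also have "\<dots> = (\<lambda>i. \<Phi> 1 (Var i))"
    unfolding comp_map_alghom[OF alghom_exp_D'] \<Phi>_def
    by (rule comp_map_alghom[OF alghom_exp_D[OF t(1)]])
  finally have \<phi>: "\<phi> = (\<lambda>i. \<Phi> 1 (Var i))" .
  have inverse: "\<Phi> r (\<Phi> (- r) g) = g" for r g
    by (simp add: \<Phi>_def exp_D_add exp_D'_add t)
  have EP: "?E q p \<in> polys_in {1..n}" if "derD n q = 0" "q \<in> polys_in {1..n}" "p \<in> polys_in {1..n}" for p q
    unfolding exp_D_def using that
    by (intro exp_der_polys_in[OF lnd_smult[OF lnd_derD]] polys_in_mult derD_polys_in polys_in_Var)
  have LP: "?L r p \<in> polys_in {1..n}" if "p \<in> polys_in {1..n}" for r p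
    unfolding exp_D'_def
  proof (rule exp_der_polys_in[OF lnd_Const_mult[OF lnd_derD'] _ that])
    fix i assume i: "i \<in> {1..n}"
    then have "i = 1 \<or> i - 1 \<in> {1..n}" by auto
    then show "Const r * derD' n (Var i) \<in> polys_in {1..n}"
    proof
      assume "i = 1"
      then show ?thesis by (simp add: derD'_Var)
    next
      assume "i - 1 \<in> {1..n}"
      then show ?thesis
        using i by (simp only: derD'_Var if_True polys_in_mult polys_in_Const polys_in_of_nat polys_in_Var)
    qed
  qed
  have \<Phi>P: "\<Phi> r (Var i) \<in> polys_in {1..n}" if "i \<in> {1..n}" for r i
    unfolding \<Phi>_def by (intro EP LP t polys_in_uminus polys_in_Var that)
  have Eout: "?E q (Var i) = Var i" "?L r (Var i) = Var i" if "i \<notin> {1..n}" for q r i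
    unfolding exp_D_def exp_D'_def
    by (rule exp_der_eq_self[OF derivation_smult[OF derivation_derD]], simp only: derD_Var that if_False mult_zero_right)
       (rule exp_der_eq_self[OF derivation_smult[OF derivation_derD']], simp only: derD'_Var that if_False mult_zero_right)
  have \<Phi>out: "\<Phi> r (Var i) = Var i" if "i \<notin> {1..n}" for r i
    unfolding \<Phi>_def by (simp only: Eout[OF that])
  have Aut: "\<phi> \<in> Aut n"
    unfolding \<phi> using inverse[of "- 1"] by (intro AutI[OF hom hom[of "- 1"] inverse _ \<Phi>P \<Phi>P \<Phi>out \<Phi>out]) simp

  interpret G: group "AutGrp n :: (nat \<Rightarrow> 'k mpoly) monoid" by (rule group_AutGrp)
  let ?X = "generate (AutGrp n) (insert \<phi> (Aff n))"
  have carrier: "insert \<phi> (Aff n) \<subseteq> carrier (AutGrp n)"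
    using Aut Aff_subset_Aut by (auto simp: AutGrp_def)
  have X: "subgroup ?X (AutGrp n)"
    by (rule G.generate_is_subgroup[OF carrier])
  define S where "S = {\<Phi>. alghom \<Phi> \<and> (\<lambda>i. \<Phi> (Var i)) \<in> ?X}"
  interpret affine_overgroup n S
  proof
    fix \<Phi> \<Psi> :: "'k mpoly \<Rightarrow> 'k mpoly"
    assume S: "\<Phi> \<in> S"
    show "alghom \<Phi>" using S by (simp add: S_def)
    show "(\<lambda>p. \<Phi> (\<Psi> p)) \<in> S" if "\<Psi> \<in> S"
    proof -
      have "(\<lambda>i. \<Phi> (Var i)) \<in> ?X" "(\<lambda>i. \<Psi> (Var i)) \<in> ?X"
        using S that by (simp_all add: S_def)
      from subgroup.m_closed[OF X this]
      have "comp_map (\<lambda>i. \<Phi> (Var i)) (\<lambda>i. \<Psi> (Var i)) \<in> ?X"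
        by (simp add: AutGrp_def)
      then show ?thesis
        using S that by (simp add: S_def comp_map_alghom alghom_comp)
    qed
    show "\<Psi> \<in> S" if hom: "alghom \<Psi>" and inv: "\<And>p. \<Phi> (\<Psi> p) = p"
    proof -
      let ?F = "\<lambda>i. \<Phi> (Var i)" and ?G = "\<lambda>i. \<Psi> (Var i)"
      have F: "?F \<in> ?X" "alghom \<Phi>" using S by (simp_all add: S_def)
      have FG: "comp_map ?F ?G = Var"
        by (simp add: comp_map_alghom[OF F(2)] inv)
      let ?I = "inv\<^bsub>AutGrp n\<^esub> ?F"
      have "?F \<in> carrier (AutGrp n)" using F subgroup.subset[OF X] by blast
      then have IF: "comp_map ?I ?F = Var"
        using G.l_inv[of ?F] by (simp add: AutGrp_def)
      \<comment> \<open>The group inverse of \<open>?F\<close> exists in the subgroup; multiplying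
        \<open>FG\<close> by it from the left identifies it with \<open>?G\<close>.\<close>
      have "?I = comp_map ?I (comp_map ?F ?G)" by (simp only: FG comp_map_Var)
      also have "\<dots> = comp_map (comp_map ?I ?F) ?G" by (simp only: comp_map_assoc)
      also have "\<dots> = ?G" by (simp only: IF comp_map_Var)
      finally have "?I = ?G" .
      moreover have "?I \<in> ?X"
        by (rule subgroup.m_inv_closed[OF X F(1)])
      ultimately show ?thesis using hom by (simp add: S_def)
    qed
  next
    fix \<Phi> \<Psi> :: "'k mpoly \<Rightarrow> 'k mpoly"
    assume a: "affine_map n \<Phi>" "affine_map n \<Psi>" "\<And>p. \<Phi> (\<Psi> p) = p"
    then show "\<Phi> \<in> S"
      using affine_map_Aff[OF a] by (auto simp: S_def affine_map_def intro: generate.incl)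
  qed (rule assms(1))
  have "\<Phi> 1 \<in> S"
    using hom[of 1] \<phi> by (auto simp: S_def intro: generate.incl)
  then have "(\<lambda>g. ?E (f ^ l) (?L 1 (?E (- (f ^ l)) g))) \<in> S"
    unfolding \<Phi>_def t_def .
  from shears_all[OF assms(2) meta_eq_to_obj_eq[OF f_def] this]
  have "subst F \<in> S" if "F \<in> BA n" for F
    using that by (rule triangular_mem)
  then have "BA n \<subseteq> ?X"
    by (auto simp: S_def)
  moreover have "Aff n \<subseteq> ?X"
    by (auto intro: generate.incl)
  ultimately have "TA n \<subseteq> ?X"
    unfolding TA_def by (intro G.generate_subgroup_incl[OF _ X]) simp
  moreover have "locally_nilpotent n (\<lambda>g. f ^ l * derD n g)"
    using t(1) unfolding t_def by (intro lnd_locally_nilpotent lnd_smult lnd_derD)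
  moreover have "locally_nilpotent n (derD' n :: 'k mpoly \<Rightarrow> 'k mpoly)"
    by (intro lnd_locally_nilpotent lnd_derD')
  ultimately show ?thesis using Aut by blast
qed

end
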